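(* Let $n\ge 2$, let $D_1=B_{1/2}$ and $D_2=B_1$ be the open balls in $\mathbb{R}^n$ centered at the origin of radius $1/2$ and $1$, and let $$S_1=\{h\in H^1(D_1):\Delta h=0\text{ in }D_1\},\qquad S_2=\{u\in H^1(D_2):\Delta u=0\text{ in }D_2\}.$$ Then there exist a constant $c>0$ and a sequence $(h_j)_{j\ge 1}\subset S_1$ with $\|h_j\|_{H^1(D_1)}=1$ for all $j$ such that, for every $j$ and every $u\in S_2$ with $\|h_j-u\|_{L^2(D_1)}\le(10j)^{-1}$, one has $$\|u\|_{H^{1/2}(\partial D_2)}\ge c\,e^{cj}.$$
   Context: $\|u\|_{H^{1/2}(\partial D_2)}$ is the $H^{1/2}$ norm of the trace of $u$ on the unit sphere $\partial B_1$. The constant $c$ does not depend on $j$ or $u$. *)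

theory Defs
  imports "HOL-Analysis.Analysis"
begin

section \<open>Smooth functions and test functions\<close>

definition pderiv_at :: "'a::euclidean_space \<Rightarrow> ('a \<Rightarrow> real) \<Rightarrow> 'a \<Rightarrow> real" where
  "pderiv_at i f x = frechet_derivative f (at x) i"

definition grad :: "('a::euclidean_space \<Rightarrow> real) \<Rightarrow> 'a \<Rightarrow> 'a" where
  "grad f x = (\<Sum>i\<in>Basis. pderiv_at i f x *\<^sub>R i)"

primrec cont_diff :: "nat \<Rightarrow> ('a::euclidean_space \<Rightarrow> real) \<Rightarrow> bool" where
  "cont_diff 0 f \<longleftrightarrow> continuous_on UNIV f"
| "cont_diff (Suc k) f \<longleftrightarrow>
     (\<forall>x. f differentiable (at x)) \<and> (\<forall>i\<in>Basis. cont_diff k (pderiv_at i f))"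

definition smooth :: "('a::euclidean_space \<Rightarrow> real) \<Rightarrow> bool" where
  "smooth f \<longleftrightarrow> (\<forall>k. cont_diff k f)"

definition test_functions :: "'a::euclidean_space set \<Rightarrow> ('a \<Rightarrow> real) set" where
  "test_functions \<Omega> =
     {\<phi>. smooth \<phi> \<and> compact (closure {x. \<phi> x \<noteq> 0}) \<and> closure {x. \<phi> x \<noteq> 0} \<subseteq> \<Omega>}"


section \<open>The spaces \<open>L\<^sup>2\<close> and \<open>H\<^sup>1\<close>\<close>

text \<open>Elements are represented by functions on the whole type; only their values on \<open>\<Omega>\<close>,
  up to Lebesgue null sets, matter.\<close>

definition L2 :: "'a::euclidean_space set \<Rightarrow> ('a \<Rightarrow> 'b::euclidean_space) set" where
  "L2 \<Omega> = {f. f \<in> borel_measurable (lebesgue_on \<Omega>) \<and>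
              integrable (lebesgue_on \<Omega>) (\<lambda>x. (norm (f x))\<^sup>2)}"

definition norm_L2 :: "'a::euclidean_space set \<Rightarrow> ('a \<Rightarrow> 'b::euclidean_space) \<Rightarrow> real" where
  "norm_L2 \<Omega> f = sqrt (integral\<^sup>L (lebesgue_on \<Omega>) (\<lambda>x. (norm (f x))\<^sup>2))"

definition has_weak_grad ::
    "'a::euclidean_space set \<Rightarrow> ('a \<Rightarrow> real) \<Rightarrow> ('a \<Rightarrow> 'a) \<Rightarrow> bool" where
  "has_weak_grad \<Omega> u G \<longleftrightarrow> G \<in> L2 \<Omega> \<and>
     (\<forall>\<phi>\<in>test_functions \<Omega>. \<forall>i\<in>Basis.
        integral\<^sup>L (lebesgue_on \<Omega>) (\<lambda>x. u x * pderiv_at i \<phi> x) =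
        - integral\<^sup>L (lebesgue_on \<Omega>) (\<lambda>x. (G x \<bullet> i) * \<phi> x))"

definition H1 :: "'a::euclidean_space set \<Rightarrow> ('a \<Rightarrow> real) set" where
  "H1 \<Omega> = {u. u \<in> L2 \<Omega> \<and> (\<exists>G. has_weak_grad \<Omega> u G)}"

text \<open>On an open set the weak gradient of an \<open>H\<^sup>1\<close> function is unique up to null sets.\<close>

definition weak_grad :: "'a::euclidean_space set \<Rightarrow> ('a \<Rightarrow> real) \<Rightarrow> 'a \<Rightarrow> 'a" where
  "weak_grad \<Omega> u = (SOME G. has_weak_grad \<Omega> u G)"

definition norm_H1 :: "'a::euclidean_space set \<Rightarrow> ('a \<Rightarrow> real) \<Rightarrow> real" where
  "norm_H1 \<Omega> u = sqrt ((norm_L2 \<Omega> u)\<^sup>2 + (norm_L2 \<Omega> (weak_grad \<Omega> u))\<^sup>2)"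

text \<open>\<open>H\<^sup>1\<close> functions with \<open>\<Delta>u = 0\<close> in \<open>\<Omega>\<close>, the equation being understood in the weak sense.\<close>

definition harmonic_H1 :: "'a::euclidean_space set \<Rightarrow> ('a \<Rightarrow> real) set" where
  "harmonic_H1 \<Omega> = {u \<in> H1 \<Omega>. \<forall>\<phi>\<in>test_functions \<Omega>.
     integral\<^sup>L (lebesgue_on \<Omega>) (\<lambda>x. weak_grad \<Omega> u x \<bullet> grad \<phi> x) = 0}"


section \<open>The unit sphere: surface measure, trace, and \<open>H\<^sup>1\<^sup>/\<^sup>2\<close> norm\<close>

text \<open>Surface measure on the unit sphere of an \<open>n\<close>-dimensional space, by polar coordinates:
  \<open>\<sigma>(A)\<close> is \<open>n\<close> times the volume of the cone \<open>{r x | x \<in> A, 0 < r < 1}\<close>. It is a measure on all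
  Borel sets that vanishes off the sphere.\<close>

definition sphere_measure :: "'a::euclidean_space measure" where
  "sphere_measure = scale_measure (of_nat DIM('a))
     (distr (restrict_space lborel (ball 0 1 - {0})) borel (\<lambda>x. x /\<^sub>R norm x))"

text \<open>\<open>g\<close> is the trace of \<open>u \<in> H\<^sup>1(B\<^sub>1)\<close> on the unit sphere: the restrictions to the sphere of
  functions smooth up to the boundary that approximate \<open>u\<close> in \<open>H\<^sup>1(B\<^sub>1)\<close> converge to \<open>g\<close> in
  \<open>L\<^sup>2(\<sigma>)\<close>. By the trace theorem such a \<open>g\<close> exists, is unique \<open>\<sigma>\<close>-almost everywhere, and does
  not depend on the approximating sequence.\<close>

definition has_sphere_trace ::
    "('a::euclidean_space \<Rightarrow> real) \<Rightarrow> ('a \<Rightarrow> real) \<Rightarrow> bool" where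
  "has_sphere_trace u g \<longleftrightarrow> u \<in> H1 (ball 0 1) \<and> g \<in> borel_measurable borel \<and>
     (\<exists>\<phi> :: nat \<Rightarrow> 'a \<Rightarrow> real. (\<forall>k. smooth (\<phi> k)) \<and>
        (\<lambda>k. norm_H1 (ball 0 1) (\<lambda>x. \<phi> k x - u x)) \<longlonglongrightarrow> 0 \<and>
        (\<lambda>k. \<integral>\<^sup>+x. ennreal ((\<phi> k x - g x)\<^sup>2) \<partial>sphere_measure) \<longlonglongrightarrow> 0)"

definition sqrt_ennreal :: "ennreal \<Rightarrow> ennreal" where
  "sqrt_ennreal x = (if x = \<infinity> then \<infinity> else ennreal (sqrt (enn2real x)))"

text \<open>The Sobolev--Slobodeckij norm. The exponent of the distance is \<open>(n - 1) + 2 s = n\<close> for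
  order \<open>s = 1/2\<close> on the \<open>(n-1)\<close>-dimensional sphere.\<close>

definition norm_H_half_sphere :: "('a::euclidean_space \<Rightarrow> real) \<Rightarrow> ennreal" where
  "norm_H_half_sphere g = sqrt_ennreal (
     (\<integral>\<^sup>+x. ennreal ((g x)\<^sup>2) \<partial>sphere_measure) +
     (\<integral>\<^sup>+x. (\<integral>\<^sup>+y. ennreal ((g x - g y)\<^sup>2 / norm (x - y) ^ DIM('a)) \<partial>sphere_measure)
        \<partial>sphere_measure))"

end

theory Submission
  imports Defs "HOL-Real_Asymp.Real_Asymp"
begin

text \<open>
  Let \<open>P\<close> be a homogeneous harmonic polynomial of degree \<open>d\<close> in two of the variables, the real part of
  \<open>w * (x\<^sub>a + \<i> * x\<^sub>b) ^ d\<close>, normalised in \<open>H\<^sup>1\<close> of the half ball. Its \<open>L\<^sup>2\<close> norm there is at least of order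
  \<open>1 / d\<close>, so with \<open>d\<close> a small multiple of \<open>j\<close> every \<open>u\<close> within \<open>1 / (10 j)\<close> of \<open>P\<close> satisfies
  \<open>\<langle>u, P\<rangle> \<ge> \<parallel>P\<parallel>\<^sup>2 / 2\<close> on the half ball.

  If \<open>u\<close> is harmonic on the unit ball with trace \<open>g\<close>, then only its degree \<open>d\<close> part is seen by \<open>P\<close>, so
  \<open>\<integral>\<^sub>S g P = (n + 2 d) 2 ^ (n + 2 d) \<integral> u P\<close>, the last integral being over the half ball. To prove this in
  the weak setting, Green's identity with a radial cutoff first gives \<open>\<integral> P (x \<bullet> \<nabla>u) = d \<integral> u P\<close> on every ball
  \<open>B\<^sub>r\<close>; the smooth approximants of \<open>u\<close> satisfy this up to a small error, and for them the ray integrals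
  from the half ball to the ball and from the ball to the sphere are elementary. The same identity for
  \<open>u = P\<close> and the Cauchy--Schwarz inequality on the sphere bound \<open>\<parallel>g\<parallel>\<close> below by \<open>2 ^ d \<parallel>P\<parallel> / 2\<close>.
\<close>

subsection \<open>Calculus of smooth functions\<close>

text \<open>Passing from H^1 to L^2 costs only a polynomial factor: on the half ball the gradient of
  the degree d polynomial is at most a constant times d as large as the polynomial itself, whereas
  its values grow by 2^d from radius 1/2 to radius 1. With d = \<open>j div N\<close> and N at least
  the constant \<open>K\<close> of this comparison, the L^2 norm stays above 1 / (5 j), twice the
  allowed error, and the factor 1 / j is absorbed by the exponential growth.

  Powers of one complex coordinate z serve every dimension n at once: gradient, Laplacian and Euler
  identity of Re (w z^d) are explicit, and its norms reduce to integrals of |z|^(2 d).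

  The obstacle is that u is given only up to null sets and its trace only as an L^2 limit, so u
  itself cannot be followed along rays up to the sphere. Hence the ray arguments are stated for
  smooth functions with an error term. For the approximants this error is their H^1 distance to u
  times a constant that depends on d but not on the approximant, so it vanishes in the
  limit.\<close>

lemma pderiv_at_eqI:
  "(f has_derivative f') (at x) \<Longrightarrow> pderiv_at i f x = f' i"
  unfolding pderiv_at_def using frechet_derivative_at by metis

lemma grad_inner_Basis:
  "i \<in> Basis \<Longrightarrow> grad f x \<bullet> i = pderiv_at i f x"
  by (simp add: grad_def inner_sum_left inner_Basis if_distrib sum.delta cong: if_cong)

lemma has_derivative_grad:
  fixes f :: "'a::euclidean_space \<Rightarrow> real"
  assumes "f differentiable (at x)"
  shows "(f has_derivative (\<lambda>v. grad f x \<bullet> v)) (at x)"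
proof -
  let ?D = "frechet_derivative f (at x)"
  have D: "(f has_derivative ?D) (at x)"
    using assms frechet_derivative_works by blast
  then have lin: "linear ?D"
    by (rule has_derivative_linear)
  have "?D v = grad f x \<bullet> v" for v
  proof -
    have "?D v = ?D (\<Sum>i\<in>Basis. (v \<bullet> i) *\<^sub>R i)"
      by (simp add: euclidean_representation)
    also have "\<dots> = (\<Sum>i\<in>Basis. (v \<bullet> i) * ?D i)"
      by (simp add: linear_sum[OF lin] linear_scale[OF lin])
    also have "\<dots> = grad f x \<bullet> v"
      by (simp add: grad_def inner_sum_left pderiv_at_def inner_commute[of v] mult.commute[of _ "frechet_derivative f (at x) _"])
    finally show ?thesis .
  qed
  then have "?D = (\<lambda>v. grad f x \<bullet> v)"
    by blast
  then show ?thesis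
    using D by simp
qed

text \<open>Serves the product rule, where undifferentiated factors stand beside derivatives and
  have to be used at the lower order.\<close>

lemma cont_diff_SucD: "cont_diff (Suc k) f \<Longrightarrow> cont_diff k f"
proof (induction k arbitrary: f)
  case 0
  then show ?case
    by (auto simp: continuous_on_eq_continuous_within intro!: differentiable_imp_continuous_within)
next
  case (Suc k)
  then show ?case
    by simp
qed

lemma cont_diff_const: "cont_diff k (\<lambda>x. c)"
proof (induction k arbitrary: c)
  case (Suc k)
  have "pderiv_at i (\<lambda>x::'a. c) = (\<lambda>x. 0)" for i
    by (rule ext) (subst pderiv_at_eqI[OF has_derivative_const], simp)
  then show ?case
    using Suc by simp
qed simp

lemma cont_diff_inner_left: "cont_diff k (\<lambda>x. x \<bullet> a)"
proof (cases k)
  case (Suc m)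
  have "pderiv_at i (\<lambda>x. x \<bullet> a) = (\<lambda>x. i \<bullet> a)" for i :: 'a
    by (rule ext) (rule pderiv_at_eqI, auto intro!: derivative_eq_intros)
  moreover have "(\<lambda>x. x \<bullet> a) differentiable (at x)" for x :: 'a
    by (auto intro!: derivative_intros)
  ultimately show ?thesis
    using Suc by (simp add: cont_diff_const)
qed (simp add: continuous_intros)

lemma pderiv_at_add:
  assumes "f differentiable (at x)" "g differentiable (at x)"
  shows "pderiv_at i (\<lambda>x. f x + g x) x = pderiv_at i f x + pderiv_at i g x"
  by (rule pderiv_at_eqI, unfold pderiv_at_def)
     (intro has_derivative_add; use assms frechet_derivative_works in blast)

lemma pderiv_at_mult:
  fixes f g :: "'a::euclidean_space \<Rightarrow> real"
  assumes "f differentiable (at x)" "g differentiable (at x)"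
  shows "pderiv_at i (\<lambda>x. f x * g x) x = f x * pderiv_at i g x + pderiv_at i f x * g x"
proof -
  have "(f has_derivative frechet_derivative f (at x)) (at x)"
    "(g has_derivative frechet_derivative g (at x)) (at x)"
    using assms frechet_derivative_works by blast+
  from has_derivative_mult[OF this] show ?thesis
    by (simp add: pderiv_at_eqI pderiv_at_def[of i f] pderiv_at_def[of i g])
qed

lemma cont_diff_add: "cont_diff k f \<Longrightarrow> cont_diff k g \<Longrightarrow> cont_diff k (\<lambda>x. f x + g x)"
proof (induction k arbitrary: f g)
  case 0
  then show ?case by (auto intro: continuous_intros)
next
  case (Suc k)
  then have "pderiv_at i (\<lambda>x. f x + g x) = (\<lambda>x. pderiv_at i f x + pderiv_at i g x)" for i
    by (intro ext pderiv_at_add) auto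
  with Suc show ?case by (auto intro: derivative_intros)
qed

lemma cont_diff_mult: "cont_diff k f \<Longrightarrow> cont_diff k g \<Longrightarrow> cont_diff k (\<lambda>x. f x * g x)"
proof (induction k arbitrary: f g)
  case 0
  then show ?case by (auto intro: continuous_intros)
next
  case (Suc k)
  then have "pderiv_at i (\<lambda>x. f x * g x) =
      (\<lambda>x. f x * pderiv_at i g x + pderiv_at i f x * g x)" for i
    by (intro ext pderiv_at_mult) auto
  moreover have "cont_diff k f" "cont_diff k g"
    using Suc.prems cont_diff_SucD by blast+
  ultimately show ?case
    using Suc by (auto intro!: derivative_intros cont_diff_add)
qed

lemma smooth_const: "smooth (\<lambda>x. c)"
  by (simp add: smooth_def cont_diff_const)

lemma smooth_inner_left: "smooth (\<lambda>x. x \<bullet> a)"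
  by (simp add: smooth_def cont_diff_inner_left)

lemma smooth_add: "smooth f \<Longrightarrow> smooth g \<Longrightarrow> smooth (\<lambda>x. f x + g x)"
  by (simp add: smooth_def cont_diff_add)

lemma smooth_mult: "smooth f \<Longrightarrow> smooth g \<Longrightarrow> smooth (\<lambda>x. f x * g x)"
  by (simp add: smooth_def cont_diff_mult)

lemma smooth_cmult: "smooth f \<Longrightarrow> smooth (\<lambda>x. c * f x)"
  by (rule smooth_mult[OF smooth_const])

lemma smooth_diff: "smooth f \<Longrightarrow> smooth g \<Longrightarrow> smooth (\<lambda>x. f x - g x)"
  using smooth_add[OF _ smooth_cmult[of g "-1"], of f] by simp

lemma smooth_sum: "(\<And>i. i \<in> I \<Longrightarrow> smooth (f i)) \<Longrightarrow> smooth (\<lambda>x. \<Sum>i\<in>I. f i x)"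
  by (induction I rule: infinite_finite_induct) (auto intro: smooth_const smooth_add)

lemma smooth_prod: "(\<And>i. i \<in> I \<Longrightarrow> smooth (f i)) \<Longrightarrow> smooth (\<lambda>x. \<Prod>i\<in>I. f i x)"
  by (induction I rule: infinite_finite_induct) (auto intro: smooth_const smooth_mult)

lemma smooth_norm_power2: "smooth (\<lambda>x. (norm x)\<^sup>2)"
  unfolding power2_norm_eq_inner euclidean_inner[of x x for x]
  by (intro smooth_sum smooth_mult smooth_inner_left)

lemma smooth_differentiable: "smooth f \<Longrightarrow> f differentiable (at x)"
  unfolding smooth_def using cont_diff.simps(2)[of 0 f] by blast

lemma smooth_pderiv_at: "smooth f \<Longrightarrow> i \<in> Basis \<Longrightarrow> smooth (pderiv_at i f)"
  unfolding smooth_def using cont_diff.simps(2) by blast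

lemma smooth_continuous_on: "smooth f \<Longrightarrow> continuous_on S f"
  unfolding smooth_def using cont_diff.simps(1)[of f] continuous_on_subset by blast

lemma smooth_continuous_on_grad: "smooth f \<Longrightarrow> continuous_on S (grad f)"
  unfolding grad_def[abs_def]
  by (intro continuous_intros) (auto intro: smooth_continuous_on smooth_pderiv_at)

lemma smooth_has_derivative:
  "smooth f \<Longrightarrow> (f has_derivative (\<lambda>v. grad f x \<bullet> v)) (at x)"
  by (intro has_derivative_grad smooth_differentiable)

lemma grad_eqI:
  assumes "\<And>v. f' v = g \<bullet> v" "(f has_derivative f') (at x)"
  shows "grad f x = g"
  by (rule euclidean_eqI) (simp add: grad_inner_Basis pderiv_at_eqI[OF assms(2)] assms(1))

lemma grad_mult:
  "smooth f \<Longrightarrow> smooth g \<Longrightarrow> grad (\<lambda>x. f x * g x) x = f x *\<^sub>R grad g x + g x *\<^sub>R grad f x"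
  by (rule grad_eqI[OF _ has_derivative_mult[OF smooth_has_derivative smooth_has_derivative]])
     (auto simp: inner_add_left)

lemma grad_norm_power2: "grad (\<lambda>x. (norm x)\<^sup>2) x = 2 *\<^sub>R x"
  unfolding power2_norm_eq_inner
  by (rule grad_eqI[OF _ has_derivative_inner[OF has_derivative_ident has_derivative_ident]])
     (simp add: inner_commute)


subsection \<open>Flat functions\<close>

text \<open>The family p(1/t) exp(-1/t), extended by 0 to t at most 0, contains the usual bump
  function and is closed under differentiation. All cutoffs below are built from its members for p =
  1 and p = 1 + X.\<close>

definition flat :: "real poly \<Rightarrow> real \<Rightarrow> real" where
  "flat p t = (if t > 0 then poly p (1 / t) * exp (- (1 / t)) else 0)"

lemma poly_exp_minus_tendsto_0: "((\<lambda>x::real. poly p x * exp (- x)) \<longlongrightarrow> 0) at_top"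
proof -
  have "((\<lambda>x. \<Sum>i\<le>degree p. coeff p i * (x ^ i / exp x)) \<longlongrightarrow> (\<Sum>i\<le>degree p. coeff p i * 0)) at_top"
    by (intro tendsto_sum tendsto_mult tendsto_const tendsto_power_div_exp_0)
  then show ?thesis
    by (simp add: poly_altdef sum_distrib_right exp_minus divide_inverse mult.assoc)
qed

lemma flat_tendsto_0: "(flat p \<longlongrightarrow> 0) (at 0)"
proof -
  have "((\<lambda>t. poly p (1 / t) * exp (- (1 / t))) \<longlongrightarrow> 0) (at_right 0)"
    by (rule filterlim_compose[OF poly_exp_minus_tendsto_0])
       (simp add: inverse_eq_divide[symmetric] filterlim_inverse_at_top_right)
  moreover have "\<forall>\<^sub>F t in at_right 0. poly p (1 / t) * exp (- (1 / t)) = flat p t"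
    by (auto simp: eventually_at_filter flat_def)
  ultimately have "(flat p \<longlongrightarrow> 0) (at_right 0)"
    using Lim_transform_eventually by blast
  moreover have "(flat p \<longlongrightarrow> 0) (at_left 0)"
    by (rule Lim_transform_eventually[OF tendsto_const])
       (auto simp: eventually_at_filter flat_def)
  ultimately show ?thesis
    using filterlim_split_at by blast
qed

text \<open>The derivative of p(1/t) exp(-1/t) is (p - p')(1/t) exp(-1/t) / t^2. The two
  \<open>pCons 0\<close> multiply by the square of the polynomial variable 1/t.\<close>

definition flat_deriv :: "real poly \<Rightarrow> real poly" where
  "flat_deriv p = pCons 0 (pCons 0 (p - pderiv p))"

lemma DERIV_flat: "(flat p has_real_derivative flat (flat_deriv p) t) (at t)"
proof (cases t "0::real" rule: linorder_cases)
  case less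
  have "((\<lambda>t. 0) has_real_derivative 0) (at t)"
    by simp
  then have "(flat p has_real_derivative 0) (at t)"
    by (rule has_field_derivative_transform_within_open[where S="{..<0}"]) (use less in \<open>auto simp: flat_def\<close>)
  then show ?thesis
    using less by (simp add: flat_def)
next
  case equal
  \<comment> \<open>Dividing by h is one more multiplication by the variable 1/h, so the difference
    quotient at 0 is again a flat function and tends to 0.\<close>
  have "\<forall>\<^sub>F h in at 0. flat (pCons 0 p) h = (flat p (0 + h) - flat p 0) / h"
    by (auto simp: eventually_at_filter flat_def)
  then have "((\<lambda>h. (flat p (0 + h) - flat p 0) / h) \<longlongrightarrow> 0) (at 0)"
    by (rule Lim_transform_eventually[OF flat_tendsto_0])
  then show ?thesis
    using equal by (simp add: DERIV_def flat_def)
next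
  case greater
  have inv: "((\<lambda>t. 1 / t) has_real_derivative - (1 / t\<^sup>2)) (at t)"
    using greater by (auto intro!: derivative_eq_intros simp: power2_eq_square)
  have "((\<lambda>t. poly p (1 / t)) has_real_derivative poly (pderiv p) (1 / t) * - (1 / t\<^sup>2)) (at t)"
    by (rule DERIV_chain2[OF poly_DERIV inv])
  moreover have "((\<lambda>t. exp (- (1 / t))) has_real_derivative exp (- (1 / t)) * (1 / t\<^sup>2)) (at t)"
    using DERIV_chain2[OF DERIV_exp DERIV_minus[OF inv]] by simp
  ultimately have "((\<lambda>t. poly p (1 / t) * exp (- (1 / t))) has_real_derivative
      poly (pderiv p) (1 / t) * - (1 / t\<^sup>2) * exp (- (1 / t)) +
      exp (- (1 / t)) * (1 / t\<^sup>2) * poly p (1 / t)) (at t)"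
    by (rule DERIV_mult)
  moreover have "poly (pderiv p) (1 / t) * - (1 / t\<^sup>2) * exp (- (1 / t)) +
      exp (- (1 / t)) * (1 / t\<^sup>2) * poly p (1 / t) = flat (flat_deriv p) t"
    using greater by (simp add: flat_def flat_deriv_def power2_eq_square algebra_simps)
  ultimately have "((\<lambda>t. poly p (1 / t) * exp (- (1 / t))) has_real_derivative
      flat (flat_deriv p) t) (at t)"
    by simp
  then show ?thesis
    by (rule has_field_derivative_transform_within_open[where S="{0<..}"]) (use greater in \<open>auto simp: flat_def\<close>)
qed

lemma has_derivative_flat:
  assumes "f differentiable (at x)"
  shows "((\<lambda>x. flat p (f x)) has_derivative
    (\<lambda>v. flat (flat_deriv p) (f x) * frechet_derivative f (at x) v)) (at x)"
  using DERIV_compose_FDERIV[OF DERIV_flat] assms frechet_derivative_works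
  by (metis (no_types, lifting) ext mult.commute)

text \<open>The induction on the order quantifies over all p, because each derivative replaces p by
  \<open>flat_deriv p\<close>.\<close>

lemma smooth_flat:
  assumes "smooth f"
  shows "smooth (\<lambda>x. flat p (f x))"
proof -
  have "cont_diff k (\<lambda>x. flat p (f x))" for k p
  proof (induction k arbitrary: p)
    case 0
    have "continuous_on UNIV (flat p)"
      using DERIV_flat by (intro DERIV_continuous_on) (auto intro: has_field_derivative_at_within)
    then show ?case
      using smooth_continuous_on[OF assms] continuous_on_compose2[of UNIV "flat p" UNIV f] by simp
  next
    case (Suc k)
    have eq: "pderiv_at i (\<lambda>x. flat p (f x)) = (\<lambda>x. flat (flat_deriv p) (f x) * pderiv_at i f x)" for i
      unfolding pderiv_at_def[of i f]
      by (intro ext pderiv_at_eqI has_derivative_flat smooth_differentiable assms)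
    have diff: "(\<lambda>x. flat p (f x)) differentiable (at x)" for x
      using has_derivative_flat[OF smooth_differentiable[OF assms]] differentiableI by blast
    show ?case
      unfolding cont_diff.simps eq
      using Suc.IH smooth_pderiv_at[OF assms] diff
      by (auto intro!: cont_diff_mult simp: smooth_def)
  qed
  then show ?thesis
    by (simp add: smooth_def)
qed

lemma grad_flat: "smooth f \<Longrightarrow> grad (\<lambda>x. flat p (f x)) x = flat (flat_deriv p) (f x) *\<^sub>R grad f x"
  by (rule grad_eqI[OF _ DERIV_compose_FDERIV[OF DERIV_flat smooth_has_derivative]]) auto

lemma flat_nonpos: "t \<le> 0 \<Longrightarrow> flat p t = 0"
  by (simp add: flat_def)

text \<open>With s = 1/t the upper bound is exp(s) >= 1 for p = 1 and exp(s) >= 1 + s for p = 1 +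
  X.\<close>

lemma flat_le_1:
  assumes "p = 1 \<or> p = [:1, 1:]"
  shows "0 \<le> flat p t \<and> flat p t \<le> 1"
proof -
  have "1 + 1 / t \<le> exp (1 / t)" "exp 0 \<le> exp (1 / t)" if "t > 0"
    using that exp_ge_add_one_self[of "1 / t"] by (auto intro: order_trans simp del: exp_zero)
  then show ?thesis
    using assms by (auto simp: flat_def exp_minus field_simps)
qed

lemma flat_tendsto_1: 
  assumes "p = 1 \<or> p = [:1, 1:]"
  shows "(flat p \<longlongrightarrow> 1) at_top"
proof -
  have "((\<lambda>t. poly p (1 / t) * exp (- (1 / t))) \<longlongrightarrow> poly p 0 * exp (- 0)) at_top"
    by (intro tendsto_intros real_tendsto_divide_at_top[OF tendsto_const] filterlim_ident)
  moreover have "\<forall>\<^sub>F t in at_top. poly p (1 / t) * exp (- (1 / t)) = flat p t"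
    using eventually_gt_at_top[of "0::real"] by eventually_elim (simp add: flat_def)
  ultimately have "(flat p \<longlongrightarrow> poly p 0 * exp (- 0)) at_top"
    by (rule Lim_transform_eventually)
  then show ?thesis
    using assms by auto
qed

text \<open>The antiderivative of \<open>flat [:1, 1:]\<close> is \<open>t * exp (- 1 / t)\<close>.\<close>

lemma grad_mult_flat:
  assumes "smooth f"
  shows "grad (\<lambda>x. f x * flat 1 (f x)) x = flat [:1, 1:] (f x) *\<^sub>R grad f x"
proof -
  have "f x * flat (flat_deriv 1) (f x) + flat 1 (f x) = flat [:1, 1:] (f x)"
    by (auto simp: flat_def flat_deriv_def field_simps pderiv_1)
  then show ?thesis
    by (simp add: grad_mult[OF assms smooth_flat[OF assms]] grad_flat[OF assms]
        flip: scaleR_add_left)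
qed

subsection \<open>Integrals over bounded open sets\<close>

lemma
  fixes f :: "'a::euclidean_space \<Rightarrow> real"
  assumes "S \<in> sets borel" "f \<in> borel_measurable borel"
  shows integral_lebesgue_on_borel:
      "integral\<^sup>L (lebesgue_on S) f = (\<integral>x. indicator S x * f x \<partial>lborel)"
    and integrable_lebesgue_on_borel:
      "integrable (lebesgue_on S) f \<longleftrightarrow> integrable lborel (\<lambda>x. indicator S x * f x)"
proof -
  have [measurable]: "S \<in> sets borel" "f \<in> borel_measurable borel"
    by fact+
  have "(\<lambda>x. indicator S x *\<^sub>R f x) \<in> borel_measurable lborel"
    by measurable
  then show "integral\<^sup>L (lebesgue_on S) f = (\<integral>x. indicator S x * f x \<partial>lborel)"
    "integrable (lebesgue_on S) f \<longleftrightarrow> integrable lborel (\<lambda>x. indicator S x * f x)"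
    by (simp_all add: integral_restrict_space integrable_restrict_space
        integral_completion integrable_completion)
qed

lemma integrable_indicator_bounded:
  fixes f :: "'a::euclidean_space \<Rightarrow> real"
  assumes "continuous_on UNIV f" "bounded S" "S \<in> sets borel"
  shows "integrable lborel (\<lambda>x. indicator S x * f x)"
proof -
  have "integrable lborel (\<lambda>x. indicator (closure S) x *\<^sub>R f x)" 
    by (rule borel_integrable_compact[OF _ continuous_on_subset[OF assms(1) subset_UNIV]])
      (unfold compact_closure, rule assms(2))
  then show ?thesis
  proof (rule Bochner_Integration.integrable_bound)
    have [measurable]: "f \<in> borel_measurable borel" "S \<in> sets borel"
      using assms(1,3) borel_measurable_continuous_onI by blast+
    show "(\<lambda>x. indicator S x * f x) \<in> borel_measurable lborel"
      by measurable
    show "AE x in lborel. norm (indicator S x * f x) \<le> norm (indicator (closure S) x *\<^sub>R f x)"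
      using closure_subset[of S] by (auto simp: indicator_def)
  qed
qed

lemma integrable_lebesgue_on_continuous:
  fixes f :: "'a::euclidean_space \<Rightarrow> real"
  assumes "continuous_on UNIV f" "bounded S" "S \<in> sets borel"
  shows "integrable (lebesgue_on S) f"
  using integrable_indicator_bounded[OF assms] assms
  by (simp add: integrable_lebesgue_on_borel borel_measurable_continuous_onI)

lemma continuous_measurable_lebesgue_on:
  "continuous_on UNIV f \<Longrightarrow> f \<in> borel_measurable (lebesgue_on S)"
  by (intro measurable_restrict_space1 measurable_completion)
    (simp add: borel_measurable_continuous_onI)

lemma
  fixes f g :: "'a \<Rightarrow> real"
  assumes [measurable]: "f \<in> borel_measurable M" "g \<in> borel_measurable M"
    and f: "integrable M (\<lambda>x. (f x)\<^sup>2)" and g: "integrable M (\<lambda>x. (g x)\<^sup>2)"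
  shows integrable_mult_L2: "integrable M (\<lambda>x. f x * g x)"
    and Cauchy_Schwarz_L2:
      "(\<integral>x. f x * g x \<partial>M)\<^sup>2 \<le> (\<integral>x. (f x)\<^sup>2 \<partial>M) * (\<integral>x. (g x)\<^sup>2 \<partial>M)"
proof -
  show fg: "integrable M (\<lambda>x. f x * g x)"
  proof (rule Bochner_Integration.integrable_bound[OF Bochner_Integration.integrable_add[OF f g]])
    have "\<bar>a * b\<bar> \<le> a\<^sup>2 + b\<^sup>2" for a b :: real
      using sum_squares_bound[of "\<bar>a\<bar>" "\<bar>b\<bar>"] mult_nonneg_nonneg[of "\<bar>a\<bar>" "\<bar>b\<bar>"]
      unfolding abs_mult power2_abs by linarith
    then show "AE x in M. norm (f x * g x) \<le> norm ((f x)\<^sup>2 + (g x)\<^sup>2)"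
      by (simp add: abs_of_nonneg)
  qed measurable
  define A B C where "A = (\<integral>x. (f x)\<^sup>2 \<partial>M)" and "B = (\<integral>x. f x * g x \<partial>M)"
    and "C = (\<integral>x. (g x)\<^sup>2 \<partial>M)"
  \<comment> \<open>The square of f + t g has nonnegative integral for every t; Cauchy-Schwarz is
    the discriminant condition of this quadratic in t.\<close>
  have quad: "0 \<le> A + 2 * t * B + t\<^sup>2 * C" for t
  proof -
    have "0 \<le> (\<integral>x. (f x + t * g x)\<^sup>2 \<partial>M)"
      by (rule integral_nonneg_AE) simp
    also have "(\<lambda>x. (f x + t * g x)\<^sup>2) = (\<lambda>x. (f x)\<^sup>2 + (2 * t * (f x * g x) + t\<^sup>2 * (g x)\<^sup>2))"
      by (auto simp: power2_eq_square algebra_simps)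
    also have "(\<integral>x. (f x)\<^sup>2 + (2 * t * (f x * g x) + t\<^sup>2 * (g x)\<^sup>2) \<partial>M) = A + 2 * t * B + t\<^sup>2 * C"
      using f g fg by (simp add: A_def B_def C_def)
    finally show ?thesis .
  qed
  have "B\<^sup>2 \<le> A * C"
  proof (cases "C = 0")
    case True
    \<comment> \<open>In the degenerate case the quadratic is affine. If B were nonzero, this t
      would give it the value -1.\<close>
    have "A + 2 * (- (A + 1) / (2 * B)) * B \<ge> 0"
      using quad[of "- (A + 1) / (2 * B)"] True by simp
    then have "B = 0"
      by (rule_tac ccontr) (simp add: field_simps)
    then show ?thesis
      using True by simp
  next
    case False
    have "C \<ge> 0"
      unfolding C_def by (rule integral_nonneg_AE) simp
    then have "C > 0"
      using False by simp
    then show ?thesis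
      using quad[of "- B / C"] by (simp add: field_simps power2_eq_square)
  qed
  then show "(\<integral>x. f x * g x \<partial>M)\<^sup>2 \<le> (\<integral>x. (f x)\<^sup>2 \<partial>M) * (\<integral>x. (g x)\<^sup>2 \<partial>M)"
    by (simp add: A_def B_def C_def)
qed


subsection \<open>Integration by parts\<close>

lemma test_functionsD:
  assumes "\<phi> \<in> test_functions \<Omega>"
  shows "smooth \<phi>" "compact (closure {x. \<phi> x \<noteq> 0})" "\<And>x. x \<notin> \<Omega> \<Longrightarrow> \<phi> x = 0"
  using assms closure_subset[of "{x. \<phi> x \<noteq> 0}"] by (auto simp: test_functions_def)

lemma test_functionsI:
  assumes "smooth \<phi>" "compact K" "K \<subseteq> \<Omega>" "\<And>x. x \<notin> K \<Longrightarrow> \<phi> x = 0"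
  shows "\<phi> \<in> test_functions \<Omega>"
proof -
  have "closure {x. \<phi> x \<noteq> 0} \<subseteq> K"
    using assms by (intro closure_minimal compact_imp_closed) auto
  moreover from this have "compact (closure {x. \<phi> x \<noteq> 0})"
    using assms(2) closed_Int_compact[of "closure {x. \<phi> x \<noteq> 0}" K] by (simp add: Int_absorb2)
  ultimately show ?thesis
    using assms by (auto simp: test_functions_def)
qed

lemma grad_eq_0_outside:
  assumes "x \<notin> closure {x. f x \<noteq> 0}"
  shows "grad f x = 0"
proof (rule grad_eqI)
  show "(f has_derivative (\<lambda>v. 0)) (at x)"
  proof (rule has_derivative_transform_within_open[OF has_derivative_const])
    show "open (- closure {x. f x \<noteq> 0})" "x \<in> - closure {x. f x \<noteq> 0}"
      using assms by auto
    show "0 = f y" if "y \<in> - closure {x. f x \<noteq> 0}" for y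
      using that closure_subset[of "{x. f x \<noteq> 0}"] by auto
  qed
qed simp

text \<open>By translation invariance every difference quotient of v in direction i has integral
  zero. The quotients are bounded by a Lipschitz constant of v on a common ball, so dominated
  convergence carries this over to the derivative.\<close>

lemma integral_pderiv_at_eq_0:
  fixes v :: "'a::euclidean_space \<Rightarrow> real"
  assumes v: "smooth v" and K: "compact (closure {x. v x \<noteq> 0})" and i: "i \<in> Basis"
  shows "(\<integral>x. pderiv_at i v x \<partial>lborel) = 0"
proof -
  let ?K = "closure {x. v x \<noteq> 0}"
  have "bounded (grad v ` ?K)"
    using K smooth_continuous_on_grad[OF v] by (intro compact_imp_bounded compact_continuous_image)
  then obtain C where C: "\<And>x. x \<in> ?K \<Longrightarrow> norm (grad v x) \<le> C"
    by (auto simp: bounded_iff)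
  have C: "norm (grad v x) \<le> max C 0" for x
    using C[of x] grad_eq_0_outside[of x v] by (cases "x \<in> ?K") auto
  define D where "D = max C 0"
  have lip: "\<bar>v x - v y\<bar> \<le> D * norm (x - y)" for x y
  proof -
    have "onorm (\<lambda>h. grad v x \<bullet> h) \<le> D" for x
    proof (rule onorm_bound)
      fix h
      show "norm (grad v x \<bullet> h) \<le> D * norm h"
        using Cauchy_Schwarz_ineq2[of "grad v x" h] mult_right_mono[OF C norm_ge_zero, of x h]
        by (simp add: D_def)
    qed (simp add: D_def)
    then have "norm (v x - v y) \<le> D * norm (x - y)"
      by (intro differentiable_bound[of UNIV v "\<lambda>x h. grad v x \<bullet> h"]) (simp_all add: smooth_has_derivative[OF v])
    then show ?thesis
      by simp
  qed
  obtain R where R: "?K \<subseteq> cball 0 R"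
    using compact_imp_bounded[OF K] unfolding bounded_iff subset_iff mem_cball_0 by blast
  have vR: "v x = 0" if "x \<notin> cball 0 R" for x
    using that R closure_subset[of "{x. v x \<noteq> 0}"] by auto
  have v_meas [measurable]: "v \<in> borel_measurable borel"
    using v smooth_continuous_on borel_measurable_continuous_onI by blast
  have v_int: "integrable lborel v"
  proof -
    have "(\<lambda>x. indicator (cball 0 R) x * v x) = v"
      using vR by (intro ext) (auto split: split_indicator)
    then show ?thesis
      using integrable_indicator_bounded[of v "cball 0 R"] smooth_continuous_on[OF v] by simp
  qed
  define h where "h k = inverse (real (Suc k))" for k
  have h: "h k > 0" "h k \<le> 1" for k
    by (auto simp: h_def field_simps)
  define s where "s k x = (v (x + h k *\<^sub>R i) - v x) / h k" for k x
  have int_v_shift: "(\<integral>x. v (x + c) \<partial>lborel) = (\<integral>x. v x \<partial>lborel)"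
    "integrable lborel (\<lambda>x. v (x + c))" for c
  proof -
    have eq: "lborel = distr lborel borel (\<lambda>x. x + c)"
      using lborel_distr_plus[of c] by (simp add: add.commute[of _ c])
    show "(\<integral>x. v (x + c) \<partial>lborel) = (\<integral>x. v x \<partial>lborel)"
      by (subst (2) eq) (simp add: integral_distr)
    show "integrable lborel (\<lambda>x. v (x + c))"
      using v_int by (subst (asm) eq) (simp add: integrable_distr_eq)
  qed
  have s0: "(\<integral>x. s k x \<partial>lborel) = 0" for k
    unfolding s_def using v_int int_v_shift by simp
  have "(\<lambda>k. \<integral>x. s k x \<partial>lborel) \<longlonglongrightarrow> (\<integral>x. pderiv_at i v x \<partial>lborel)"
  proof (rule integral_dominated_convergence)
    show "pderiv_at i v \<in> borel_measurable lborel"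
      using borel_measurable_continuous_onI[OF smooth_continuous_on[OF smooth_pderiv_at[OF v i]]] by simp
    show "s k \<in> borel_measurable lborel" for k
      unfolding s_def by measurable
    \<comment> \<open>Since \<open>h k\<close> is at most 1, all quotients \<open>s k\<close> vanish
      outside the support ball enlarged by 1.\<close>
    show "integrable lborel (\<lambda>x::'a. indicator (cball 0 (R + 1)) x * D)"
      by (rule integrable_indicator_bounded) auto
    show "AE x in lborel. (\<lambda>k. s k x) \<longlonglongrightarrow> pderiv_at i v x"
    proof (rule AE_I2)
      fix x
      have "((\<lambda>t. v (x + t *\<^sub>R i)) has_derivative (\<lambda>t. grad v x \<bullet> (t *\<^sub>R i))) (at 0)"
        by (rule has_derivative_compose[where g=v])
          (auto intro!: derivative_eq_intros simp: smooth_has_derivative[OF v])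
      then have "((\<lambda>t. v (x + t *\<^sub>R i)) has_real_derivative pderiv_at i v x) (at 0)"
        by (simp add: has_field_derivative_def grad_inner_Basis[OF i] mult_commute_abs)
      then have "((\<lambda>t. (v (x + t *\<^sub>R i) - v x) / t) \<longlongrightarrow> pderiv_at i v x) (at 0)"
        by (simp add: DERIV_def)
      moreover have "filterlim h (at 0) sequentially"
        using LIMSEQ_inverse_real_of_nat h unfolding h_def[abs_def]
        by (auto simp: filterlim_at)
      ultimately show "(\<lambda>k. s k x) \<longlonglongrightarrow> pderiv_at i v x"
        unfolding s_def by (rule filterlim_compose)
    qed
    show "AE x in lborel. norm (s k x) \<le> indicator (cball 0 (R + 1)) x * D" for k
    proof (rule AE_I2)
      fix x
      show "norm (s k x) \<le> indicator (cball 0 (R + 1)) x * D"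
      proof (cases "x \<in> cball 0 (R + 1)")
        case True
        have "\<bar>v (x + h k *\<^sub>R i) - v x\<bar> \<le> D * h k"
          using lip[of "x + h k *\<^sub>R i" x] h[of k] i by simp
        then show ?thesis
          using True h[of k] by (simp add: s_def field_simps)
      next
        case False
        have "norm x \<le> norm (x + h k *\<^sub>R i) + norm (h k *\<^sub>R i)"
          by (metis add_diff_cancel_right' norm_triangle_ineq4)
        then have "norm (x + h k *\<^sub>R i) > R"
          using False h[of k] i by auto
        then show ?thesis
          using False vR[of x] vR[of "x + h k *\<^sub>R i"] by (simp add: s_def)
      qed
    qed
  qed
  then show ?thesis
    by (simp add: s0 LIMSEQ_const_iff)
qed

lemma smooth_borel_measurable: "smooth f \<Longrightarrow> f \<in> borel_measurable borel"
  using smooth_continuous_on borel_measurable_continuous_onI by blast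

lemma continuous_L2:
  assumes "continuous_on UNIV f" "bounded S" "S \<in> sets borel"
  shows "f \<in> L2 S"
  unfolding L2_def using assms continuous_measurable_lebesgue_on[OF assms(1)]
  by (auto intro!: integrable_lebesgue_on_continuous continuous_on_power continuous_on_norm)

lemma smooth_L2:
  assumes "smooth f" "bounded S" "S \<in> sets borel"
  shows "f \<in> L2 S" "grad f \<in> L2 S"
  using assms smooth_continuous_on[OF assms(1)] smooth_continuous_on_grad[OF assms(1)]
  by (auto intro: continuous_L2)

text \<open>The product of f and a test function has compact support, so integrating its partial
  derivative over the whole space gives zero; the product rule splits this into the two required
  integrals.\<close>

lemma has_weak_grad_smooth:
  fixes f :: "'a::euclidean_space \<Rightarrow> real"
  assumes f: "smooth f" and S: "bounded S" "S \<in> sets borel"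
  shows "has_weak_grad S f (grad f)"
  unfolding has_weak_grad_def
proof (intro conjI ballI)
  fix \<phi> :: "'a \<Rightarrow> real" and i :: 'a
  assume \<phi>: "\<phi> \<in> test_functions S" and i: "i \<in> Basis"
  note \<phi>D = test_functionsD[OF \<phi>]
  let ?v = "\<lambda>x. f x * \<phi> x"
  have sub: "{x. ?v x \<noteq> 0} \<subseteq> {x. \<phi> x \<noteq> 0}"
    by auto
  have "compact (closure {x. ?v x \<noteq> 0})"
    using bounded_subset[OF _ sub] bounded_subset[OF _ closure_subset] \<phi>D(2) compact_imp_bounded
    unfolding compact_closure by blast
  from integral_pderiv_at_eq_0[OF smooth_mult[OF f \<phi>D(1)] this i]
  have "(\<integral>x. f x * pderiv_at i \<phi> x + pderiv_at i f x * \<phi> x \<partial>lborel) = 0"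
    using f \<phi>D by (simp add: pderiv_at_mult[OF smooth_differentiable smooth_differentiable])
  have out: "\<phi> x = 0" "pderiv_at i \<phi> x = 0" if "x \<notin> S" for x
  proof -
    have "x \<notin> closure {x. \<phi> x \<noteq> 0}"
      using that \<phi> by (auto simp: test_functions_def)
    then show "pderiv_at i \<phi> x = 0"
      using grad_eq_0_outside[of x \<phi>] grad_inner_Basis[OF i, of \<phi> x] by simp
  qed (use \<phi>D that in auto)
  have sm: "smooth (\<lambda>x. f x * pderiv_at i \<phi> x)" "smooth (\<lambda>x. pderiv_at i f x * \<phi> x)"
    using f \<phi>D i by (auto intro: smooth_mult smooth_pderiv_at)
  have "(\<integral>x. f x * pderiv_at i \<phi> x + pderiv_at i f x * \<phi> x \<partial>lborel) =
      (\<integral>x. indicator S x * (f x * pderiv_at i \<phi> x) + indicator S x * (pderiv_at i f x * \<phi> x) \<partial>lborel)"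
    by (rule Bochner_Integration.integral_cong) (use out in \<open>auto simp: indicator_def\<close>)
  also have "\<dots> = (\<integral>x. indicator S x * (f x * pderiv_at i \<phi> x) \<partial>lborel) +
      (\<integral>x. indicator S x * (pderiv_at i f x * \<phi> x) \<partial>lborel)"
    using sm S by (intro Bochner_Integration.integral_add integrable_indicator_bounded smooth_continuous_on)
  finally have "(\<integral>x. indicator S x * (f x * pderiv_at i \<phi> x) \<partial>lborel) =
      - (\<integral>x. indicator S x * (pderiv_at i f x * \<phi> x) \<partial>lborel)"
    using \<open>(\<integral>x. f x * pderiv_at i \<phi> x + pderiv_at i f x * \<phi> x \<partial>lborel) = 0\<close> by simp
  then show "integral\<^sup>L (lebesgue_on S) (\<lambda>x. f x * pderiv_at i \<phi> x) =
      - integral\<^sup>L (lebesgue_on S) (\<lambda>x. (grad f x \<bullet> i) * \<phi> x)"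
    using S sm[THEN smooth_borel_measurable]
    by (simp add: integral_lebesgue_on_borel grad_inner_Basis[OF i])
qed (rule smooth_L2[OF assms])


subsection \<open>Uniqueness of weak gradients\<close>

text \<open>The test functions are products of one-dimensional bumps which converge to the indicator
  function of the box; the shift by 1 keeps their support in the open box.\<close>

lemma box_indicator_limit:
  fixes a b :: "'a::euclidean_space"
  assumes "box a b \<subseteq> \<Omega>"
  obtains \<phi> :: "nat \<Rightarrow> 'a \<Rightarrow> real" where "\<And>k. \<phi> k \<in> test_functions \<Omega>"
    "\<And>k x. \<bar>\<phi> k x\<bar> \<le> 1" "\<And>x. (\<lambda>k. \<phi> k x) \<longlonglongrightarrow> indicator (box a b) x"
proof -
  define L where "L k i x = real (Suc k) * (x \<bullet> i - a \<bullet> i) - 1" for k i x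
  define R where "R k i x = real (Suc k) * (b \<bullet> i - x \<bullet> i) - 1" for k i x
  define \<phi> where "\<phi> k x = (\<Prod>i\<in>Basis. flat 1 (L k i x) * flat 1 (R k i x))" for k x
  have fl: "0 \<le> flat 1 t" "flat 1 t \<le> 1" for t
    using flat_le_1 by auto
  show ?thesis
  proof
    fix k
    define K where "K = cbox (a + inverse (real (Suc k)) *\<^sub>R One) (b - inverse (real (Suc k)) *\<^sub>R One)"
    show "\<phi> k \<in> test_functions \<Omega>"
    proof (rule test_functionsI)
      show "smooth (\<phi> k)"
        unfolding \<phi>_def L_def R_def
        by (intro smooth_prod smooth_mult smooth_flat smooth_diff smooth_cmult smooth_const smooth_inner_left)
      show "compact K"
        by (simp add: K_def)
      have "K \<subseteq> box a b"
      proof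
        fix x assume x: "x \<in> K"
        have "a \<bullet> i < x \<bullet> i \<and> x \<bullet> i < b \<bullet> i" if "i \<in> Basis" for i
        proof -
          have "a \<bullet> i + inverse (real (Suc k)) \<le> x \<bullet> i \<and> x \<bullet> i \<le> b \<bullet> i - inverse (real (Suc k))"
            using x that by (auto simp: K_def mem_box inner_simps)
          moreover have "inverse (real (Suc k)) > 0"
            by simp
          ultimately show ?thesis
            by linarith
        qed
        then show "x \<in> box a b"
          by (simp add: mem_box)
      qed
      then show "K \<subseteq> \<Omega>"
        using assms by blast
      fix x assume "x \<notin> K"
      then obtain i where i: "i \<in> Basis"
        "x \<bullet> i < a \<bullet> i + inverse (real (Suc k)) \<or> b \<bullet> i - inverse (real (Suc k)) < x \<bullet> i"
        by (auto simp: K_def mem_box inner_simps not_le)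
      then have "L k i x \<le> 0 \<or> R k i x \<le> 0"
        by (auto simp: L_def R_def field_simps)
      then have "flat 1 (L k i x) * flat 1 (R k i x) = 0"
        using flat_nonpos by auto
      then show "\<phi> k x = 0"
        using i(1) by (auto simp: \<phi>_def)
    qed
    fix x
    show "\<bar>\<phi> k x\<bar> \<le> 1"
    proof -
      have "0 \<le> \<phi> k x" "\<phi> k x \<le> 1"
        unfolding \<phi>_def using fl by (auto intro!: prod_nonneg prod_le_1 mult_le_one)
      then show ?thesis by simp
    qed
  next
    fix x
    show "(\<lambda>k. \<phi> k x) \<longlonglongrightarrow> indicator (box a b) x"
    proof (cases "x \<in> box a b")
      case True
      have lim: "(\<lambda>k. flat 1 (real (Suc k) * c - 1)) \<longlonglongrightarrow> 1" if "c > 0" for c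
        using that by (intro filterlim_compose[OF flat_tendsto_1]) (simp, real_asymp)
      have "(\<lambda>k. \<phi> k x) \<longlonglongrightarrow> (\<Prod>i\<in>(Basis::'a set). 1 * 1)"
        unfolding \<phi>_def L_def R_def
        by (intro tendsto_prod tendsto_mult lim) (use True in \<open>auto simp: mem_box\<close>)
      then show ?thesis
        using True by simp
    next
      case False
      then obtain i where i: "i \<in> Basis" "x \<bullet> i \<le> a \<bullet> i \<or> b \<bullet> i \<le> x \<bullet> i"
        by (auto simp: mem_box not_less)
      have "L k i x \<le> 0 \<or> R k i x \<le> 0" for k
        using i(2) mult_nonneg_nonpos[of "real (Suc k)" "x \<bullet> i - a \<bullet> i"]
          mult_nonneg_nonpos[of "real (Suc k)" "b \<bullet> i - x \<bullet> i"]
        by (auto simp: L_def R_def)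
      then have "flat 1 (L k i x) * flat 1 (R k i x) = 0" for k
        using flat_nonpos mult_eq_0_iff by blast
      then have "\<phi> k x = 0" for k
        using i(1) by (auto simp: \<phi>_def)
      then show ?thesis
        using False by simp
    qed
  qed
qed

text \<open>Boxes are stable under intersection and generate the Borel sets, so a Dynkin argument
  extends the vanishing integrals to all Borel subsets of \<open>box a b\<close>. Among these are
  the sets where f is positive or negative.\<close>

lemma AE_eq_0_if_box_integrals_eq_0:
  fixes f :: "'a::euclidean_space \<Rightarrow> real"
  assumes f: "integrable lborel f"
    and box: "\<And>c d. box c d \<subseteq> box a b \<Longrightarrow> (\<integral>x. indicator (box c d) x * f x \<partial>lborel) = 0"
  shows "AE x in lborel. x \<in> box a b \<longrightarrow> f x = 0"
proof -
  have [measurable]: "f \<in> borel_measurable borel"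
    using f by auto
  have int: "integrable lborel (\<lambda>x. indicator A x * f x)" if "A \<in> sets borel" for A
    using integrable_mult_indicator[of A lborel f] f that by simp
  have sets: "sigma_sets UNIV (range (\<lambda>(a, b). box a b)) = sets (borel :: 'a measure)"
    unfolding borel_eq_box by (rule sets_measure_of[symmetric]) auto
  have zero: "(\<integral>x. indicator (A \<inter> box a b) x * f x \<partial>lborel) = 0"
    if "A \<in> sigma_sets UNIV (range (\<lambda>(a, b). box a b))" for A
  proof (rule sigma_sets_induct_disjoint[OF _ _ that])
    show "Int_stable (range (\<lambda>(a, b). box a b :: 'a set))"
      by (auto simp: Int_stable_def box_Int_box)
    fix A :: "'a set" assume A: "A \<in> range (\<lambda>(a, b). box a b)"
    then obtain c d where "A \<inter> box a b = box c d"
      by (auto simp: box_Int_box)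
    then show "(\<integral>x. indicator (A \<inter> box a b) x * f x \<partial>lborel) = 0"
      using box[of c d] by auto
  next
    fix A assume A: "A \<in> sigma_sets UNIV (range (\<lambda>(a, b). box a b))"
      and 0: "(\<integral>x. indicator (A \<inter> box a b) x * f x \<partial>lborel) = 0"
    have "(\<lambda>x. indicator ((UNIV - A) \<inter> box a b) x * f x) =
        (\<lambda>x. indicator (box a b) x * f x - indicator (A \<inter> box a b) x * f x)"
      by (auto simp: indicator_def)
    then show "(\<integral>x. indicator ((UNIV - A) \<inter> box a b) x * f x \<partial>lborel) = 0"
      using int[of "box a b"] int[of "A \<inter> box a b"] 0 box[of a b] A by (simp add: sets)
  next
    fix A :: "nat \<Rightarrow> 'a set"
    assume A: "disjoint_family A" "range A \<subseteq> sigma_sets UNIV (range (\<lambda>(a, b). box a b))"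
      and 0: "\<And>i. (\<integral>x. indicator (A i \<inter> box a b) x * f x \<partial>lborel) = 0"
    have m: "A i \<inter> box a b \<in> sets lborel" for i
      using A(2) by (auto simp: sets)
    have "(\<integral>x. indicator (\<Union>i. A i \<inter> box a b) x *\<^sub>R f x \<partial>lborel) =
        (\<Sum>i. \<integral>x. indicator (A i \<inter> box a b) x *\<^sub>R f x \<partial>lborel)"
      by (rule lebesgue_integral_countable_add[unfolded set_lebesgue_integral_def])
        (use m A(1) int[OF sets.countable_UN, of "\<lambda>i. A i \<inter> box a b" UNIV]
          in \<open>auto simp: disjoint_family_on_def set_integrable_def image_subset_iff simp del: UN_simps\<close>)
    also have "(\<Union>i. A i \<inter> box a b) = (\<Union>i. A i) \<inter> box a b"
      by auto
    finally show "(\<integral>x. indicator ((\<Union>i. A i) \<inter> box a b) x * f x \<partial>lborel) = 0"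
      using 0 by simp
  qed auto
  \<comment> \<open>On the set where s f > 0 a nonnegative function has integral zero and hence
    vanishes almost everywhere. The signs s = 1 and s = -1 together give f = 0.\<close>
  have pos: "AE x in lborel. x \<in> box a b \<longrightarrow> s * f x \<le> 0" for s
  proof -
    let ?A = "{x. s * f x > 0}"
    have [measurable]: "?A \<in> sets borel"
      by measurable
    have m: "?A \<inter> box a b \<in> sets borel"
      by measurable
    have "(\<integral>x. s * (indicator (?A \<inter> box a b) x * f x) \<partial>lborel) = 0"
      using zero[of ?A] by (simp add: sets)
    moreover have "integrable lborel (\<lambda>x. s * (indicator (?A \<inter> box a b) x * f x))"
      using int[OF m] by simp
    ultimately have "AE x in lborel. s * (indicator (?A \<inter> box a b) x * f x) = 0"
      by (subst (asm) integral_nonneg_eq_0_iff_AE) (auto simp: indicator_def)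
    then show ?thesis
      by eventually_elim (auto simp: indicator_def split: if_splits)
  qed
  from pos[of 1] pos[of "-1"] show ?thesis
    by eventually_elim auto
qed

text \<open>This is the fundamental lemma of the calculus of variations. Bounded limits of test
  functions give the indicators of boxes inside the domain, and countably many such boxes exhaust
  it.\<close>

lemma AE_eq_0_if_test_integrals_eq_0:
  fixes f :: "'a::euclidean_space \<Rightarrow> real"
  assumes \<Omega>: "open \<Omega>" and f: "integrable (lebesgue_on \<Omega>) f"
    and test: "\<And>\<phi>. \<phi> \<in> test_functions \<Omega> \<Longrightarrow> integral\<^sup>L (lebesgue_on \<Omega>) (\<lambda>x. f x * \<phi> x) = 0"
  shows "AE x in lebesgue_on \<Omega>. f x = 0"
proof -
  have [measurable]: "\<Omega> \<in> sets borel" "\<Omega> \<in> sets lebesgue"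
    using \<Omega> by auto
  let ?F = "\<lambda>x. indicator \<Omega> x * f x"
  have F: "integrable lebesgue ?F"
    using f by (simp add: integrable_restrict_space)
  \<comment> \<open>The Dynkin argument runs over Borel sets, whereas f is only Lebesgue measurable;
    hence the passage to a Borel version.\<close>
  then obtain F' where [measurable]: "F' \<in> borel_measurable borel" and ae: "AE x in lborel. ?F x = F' x"
    using completion_ex_borel_measurable_real[of ?F lborel] by auto
  have ae': "AE x in lebesgue. ?F x = F' x"
    using AE_completion[OF ae] .
  have "integrable lebesgue F'"
    using F ae' by (subst integrable_cong_AE[symmetric]) (auto intro: measurable_completion)
  then have F': "integrable lborel F'"
    by (simp add: integrable_completion)
  have test': "(\<integral>x. F' x * \<phi> x \<partial>lborel) = 0" if \<phi>: "\<phi> \<in> test_functions \<Omega>" for \<phi>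
  proof -
    have [measurable]: "\<phi> \<in> borel_measurable borel"
      using test_functionsD(1)[OF \<phi>] smooth_borel_measurable by blast
    have "(\<integral>x. F' x * \<phi> x \<partial>lborel) = (\<integral>x. F' x * \<phi> x \<partial>lebesgue)"
      by (simp add: integral_completion)
    also have "\<dots> = (\<integral>x. ?F x * \<phi> x \<partial>lebesgue)"
    proof (rule integral_cong_AE)
      show "(\<lambda>x. ?F x * \<phi> x) \<in> borel_measurable lebesgue"
        using borel_measurable_integrable[OF F]
        by (rule borel_measurable_times) (auto intro: measurable_completion)
      show "AE x in lebesgue. F' x * \<phi> x = ?F x * \<phi> x"
        using ae' by eventually_elim simp
    qed (auto intro: measurable_completion)
    also have "\<dots> = 0"
      using test[OF \<phi>] by (simp add: integral_restrict_space mult.assoc)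
    finally show ?thesis .
  qed
  have box0: "(\<integral>x. indicator (box a b) x * F' x \<partial>lborel) = 0" if ab: "box a b \<subseteq> \<Omega>" for a b
  proof -
    from box_indicator_limit[OF ab] obtain \<phi> :: "nat \<Rightarrow> 'a \<Rightarrow> real" where
      \<phi>: "\<And>k. \<phi> k \<in> test_functions \<Omega>"
      "\<And>k x. \<bar>\<phi> k x\<bar> \<le> 1" "\<And>x. (\<lambda>k. \<phi> k x) \<longlonglongrightarrow> indicator (box a b) x"
      by blast
    have [measurable]: "\<phi> k \<in> borel_measurable borel" for k
      using test_functionsD(1)[OF \<phi>(1)] smooth_borel_measurable by blast
    have "(\<lambda>k. \<integral>x. F' x * \<phi> k x \<partial>lborel) \<longlonglongrightarrow> (\<integral>x. F' x * indicator (box a b) x \<partial>lborel)"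
    proof (rule integral_dominated_convergence[where w="\<lambda>x. norm (F' x)"])
      show "AE x in lborel. norm (F' x * \<phi> k x) \<le> norm (F' x)" for k
        using \<phi>(2)[of k] by (auto simp: abs_mult intro!: mult_left_le)
      show "AE x in lborel. (\<lambda>k. F' x * \<phi> k x) \<longlonglongrightarrow> F' x * indicator (box a b) x"
        using \<phi>(3) by (auto intro!: tendsto_intros)
    qed (use F' in auto)
    then show ?thesis
      by (simp add: test'[OF \<phi>(1)] LIMSEQ_const_iff mult.commute)
  qed
  obtain \<D> where \<D>: "countable \<D>" "\<D> \<subseteq> Pow \<Omega>" "\<And>X. X \<in> \<D> \<Longrightarrow> \<exists>a b. X = box a b" "\<Union>\<D> = \<Omega>"
    using open_countable_Union_open_box[OF \<Omega>] by metis
  \<comment> \<open>Countability of the cover keeps the union of the exceptional null sets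
    null.\<close>
  have "AE x in lborel. \<forall>X\<in>\<D>. x \<in> X \<longrightarrow> F' x = 0"
  proof (subst AE_ball_countable[OF \<D>(1)], intro ballI)
    fix X assume X: "X \<in> \<D>"
    then obtain a b where ab: "X = box a b"
      using \<D>(3) by blast
    show "AE x in lborel. x \<in> X \<longrightarrow> F' x = 0"
      unfolding ab by (rule AE_eq_0_if_box_integrals_eq_0[OF F' box0]) (use X ab \<D>(2) in blast)
  qed
  then have "AE x in lborel. x \<in> \<Omega> \<longrightarrow> F' x = 0"
    by eventually_elim (use \<D>(4) in auto)
  with ae have "AE x in lborel. x \<in> \<Omega> \<longrightarrow> f x = 0"
    by eventually_elim (auto simp: indicator_def)
  then show ?thesis
    by (simp add: AE_restrict_space_iff AE_completion)
qed

subsection \<open>Integration along rays\<close>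

lemma ball_in_borel [measurable]: "ball x r \<in> sets borel"
  by simp

lemma
  fixes f :: "'a::euclidean_space \<Rightarrow> real"
  assumes [measurable]: "f \<in> borel_measurable borel" and c: "c \<noteq> 0"
  shows lborel_integral_scaleR:
      "(\<integral>x. f (c *\<^sub>R x) \<partial>lborel) = (\<integral>x. f x \<partial>lborel) / \<bar>c\<bar> ^ DIM('a)"
    and lborel_integrable_scaleR: "integrable lborel f \<Longrightarrow> integrable lborel (\<lambda>x. f (c *\<^sub>R x))"
proof -
  let ?D = "distr lborel borel (\<lambda>x::'a. c *\<^sub>R x)"
  have eq: "lborel = density ?D (\<lambda>_. ennreal (\<bar>c\<bar> ^ DIM('a)))"
    using lborel_affine[OF c, of "0::'a"] by (simp add: ennreal_power)
  have "(\<integral>x. f x \<partial>lborel) = \<bar>c\<bar> ^ DIM('a) * (\<integral>x. f (c *\<^sub>R x) \<partial>lborel)"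
    by (subst eq) (simp add: integral_density integral_distr)
  then show "(\<integral>x. f (c *\<^sub>R x) \<partial>lborel) = (\<integral>x. f x \<partial>lborel) / \<bar>c\<bar> ^ DIM('a)"
    using c by simp
  assume "integrable lborel f"
  then show "integrable lborel (\<lambda>x. f (c *\<^sub>R x))"
    using c by (subst (asm) eq) (simp add: integrable_density integrable_distr_eq)
qed

lemma DERIV_along_ray:
  assumes "smooth \<psi>" "(g has_real_derivative g') (at t)"
  shows "((\<lambda>t. \<psi> (g t *\<^sub>R x)) has_real_derivative g' * (grad \<psi> (g t *\<^sub>R x) \<bullet> x)) (at t)"
proof -
  have "((\<lambda>t. g t *\<^sub>R x) has_derivative (\<lambda>h. (g' * h) *\<^sub>R x)) (at t)"
    using assms(2) by (auto simp: has_field_derivative_def intro!: has_derivative_scaleR_left)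
  then have "((\<lambda>t. \<psi> (g t *\<^sub>R x)) has_derivative (\<lambda>h. grad \<psi> (g t *\<^sub>R x) \<bullet> ((g' * h) *\<^sub>R x))) (at t)"
    by (rule has_derivative_compose[OF _ smooth_has_derivative[OF assms(1)]])
  then show ?thesis
    by (simp add: has_field_derivative_def mult_ac mult_commute_abs)
qed

lemma continuous_isCont: "continuous_on UNIV f \<Longrightarrow> isCont f x"
  by (simp add: continuous_on_eq_continuous_at)

text \<open>This is the divergence theorem for the field \<open>x \<mapsto> \<psi> x *\<^sub>R x\<close> on the unit ball.\<close>

lemma integral_sphere_projection:
  fixes \<psi> :: "'a::euclidean_space \<Rightarrow> real"
  assumes \<psi>: "smooth \<psi>"
  shows "DIM('a) * (\<integral>x. indicator (ball 0 1) x * \<psi> (x /\<^sub>R norm x) \<partial>lborel) =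
    (\<integral>x. indicator (ball 0 1) x * (DIM('a) * \<psi> x + grad \<psi> x \<bullet> x) \<partial>lborel)"
proof -
  define n where "n = DIM('a)"
  have n: "n > 0"
    by (simp add: n_def)
  define \<theta> where "\<theta> x = grad \<psi> x \<bullet> x" for x
  have cont: "continuous_on UNIV \<psi>" "continuous_on UNIV \<theta>"
    unfolding \<theta>_def
    using smooth_continuous_on[OF \<psi>] smooth_continuous_on_grad[OF \<psi>] by (auto intro!: continuous_intros)
  note [measurable] = cont[THEN borel_measurable_continuous_onI]
  define F where "F x = indicator (ball 0 1) x * \<theta> x" for x :: 'a
  have [measurable]: "F \<in> borel_measurable borel"
    unfolding F_def by measurable
  have F_int: "integrable lborel F"
    unfolding F_def[abs_def] using cont by (intro integrable_indicator_bounded) auto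
  \<comment> \<open>Up to truncation this is the derivative in t of -\<psi>(x / t). The t-integral
    moves x along its ray to the sphere; the x-integral only rescales \<open>F\<close> and yields
    t^(n-1). Comparing the two orders of integration proves the identity.\<close>
  define g where "g t x = indicator {0<..1} t * (F (inverse t *\<^sub>R x) / t)" for t :: real and x :: 'a
  have scale: "(\<integral>x. indicator {0<..1} t * (H (inverse t *\<^sub>R x) / t) \<partial>lborel) =
      indicator {0<..1} t * t ^ (n - 1) * (\<integral>x. H x \<partial>lborel)"
    if [measurable]: "H \<in> borel_measurable borel" for H :: "'a \<Rightarrow> real" and t
  proof (cases "t \<in> {0<..1}")
    case True
    then have "(\<integral>x. H (inverse t *\<^sub>R x) \<partial>lborel) = (\<integral>x. H x \<partial>lborel) * t ^ n"
      by (subst lborel_integral_scaleR) (auto simp: n_def field_simps power_inverse)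
    moreover have "t ^ n = t * t ^ (n - 1)"
      using n by (simp flip: power_Suc)
    ultimately show ?thesis
      using True by simp
  qed simp
  have pow: "has_bochner_integral lborel (\<lambda>t. indicator {0<..1} t * t ^ (n - 1)) (1 / n)"
  proof -
    have "has_bochner_integral lborel (\<lambda>t. t ^ (n - 1) * indicator {0..1} t) (1 ^ n / n - 0 ^ n / n)"
      by (rule has_bochner_integral_FTC_Icc_real)
        (use n in \<open>auto intro!: derivative_eq_intros continuous_intros\<close>)
    then have "has_bochner_integral lborel (\<lambda>t. t ^ (n - 1) * indicator {0..1} t) (1 / n)"
      using n by (simp add: zero_power)
    moreover have "AE t in lborel. t ^ (n - 1) * indicator {0..1} t = indicator {0<..1::real} t * t ^ (n - 1)"
      using AE_lborel_singleton[of 0] by eventually_elim (auto simp: indicator_def)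
    ultimately show ?thesis
      by (subst has_bochner_integral_cong_AE[symmetric]) auto
  qed
  have g_meas: "case_prod g \<in> borel_measurable (lborel \<Otimes>\<^sub>M lborel)"
    unfolding g_def by measurable
  have g_int: "integrable (lborel \<Otimes>\<^sub>M lborel) (case_prod g)"
  proof (rule lborel_pair.Fubini_integrable[OF g_meas])
    have "norm (g t x) = indicator {0<..1} t * (\<bar>F (inverse t *\<^sub>R x)\<bar> / t)" for t x
      by (auto simp: g_def indicator_def)
    then have "(\<lambda>t. \<integral>x. norm (case_prod g (t, x)) \<partial>lborel) =
        (\<lambda>t. indicator {0<..1} t * t ^ (n - 1) * (\<integral>x. \<bar>F x\<bar> \<partial>lborel))"
      using scale[of "\<lambda>x. \<bar>F x\<bar>"] by simp
    then show "integrable lborel (\<lambda>t. \<integral>x. norm (case_prod g (t, x)) \<partial>lborel)"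
      using pow by (simp add: has_bochner_integral_iff)
    have "integrable lborel (g t)" for t
    proof (cases "t \<in> {0<..1}")
      case True
      then show ?thesis
        unfolding g_def using F_int by (auto intro: lborel_integrable_scaleR)
    qed (simp add: g_def[abs_def])
    then show "AE t in lborel. integrable lborel (\<lambda>x. case_prod g (t, x))"
      by simp
  qed
  have ray: "(\<integral>t. g t x \<partial>lborel) = indicator (ball 0 1) x * (\<psi> (x /\<^sub>R norm x) - \<psi> x)" for x
  proof (cases "x = 0 \<or> x \<notin> ball 0 1")
    case True
    have "g t x = 0" for t
    proof (cases "x = 0")
      case False
      with True have "norm x \<ge> 1" by simp
      then have "inverse t *\<^sub>R x \<notin> ball 0 1" if "0 < t" "t \<le> 1"
        using that by (auto simp: field_simps)
      then show ?thesis
        by (auto simp: g_def F_def indicator_def)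
    qed (simp add: g_def F_def \<theta>_def)
    then show ?thesis
      using True by auto
  next
    case False
    then have x: "0 < norm x" "norm x < 1"
      by auto
    have "(\<integral>t. (\<theta> (inverse t *\<^sub>R x) / t) * indicator {norm x..1} t \<partial>lborel) =
        - \<psi> (inverse 1 *\<^sub>R x) - - \<psi> (inverse (norm x) *\<^sub>R x)"
    proof (rule integral_FTC_Icc_real)
      fix t assume t: "norm x \<le> t" "t \<le> 1"
      then have "t > 0"
        using x by linarith
      then have inv: "(inverse has_real_derivative - (inverse t ^ 2)) (at t)"
        using DERIV_inverse[of t UNIV] by (simp add: numeral_2_eq_2)
      have "inverse t ^ 2 * (grad \<psi> (inverse t *\<^sub>R x) \<bullet> x) = \<theta> (inverse t *\<^sub>R x) / t"
        by (simp add: \<theta>_def power2_eq_square divide_inverse)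
      with DERIV_minus[OF DERIV_along_ray[OF \<psi> inv, of x]]
      show "((\<lambda>t. - \<psi> (inverse t *\<^sub>R x)) has_real_derivative \<theta> (inverse t *\<^sub>R x) / t) (at t)"
        by simp
      show "isCont (\<lambda>t. \<theta> (inverse t *\<^sub>R x) / t) t"
        using \<open>t > 0\<close>
        by (intro continuous_intros isCont_o2[OF _ continuous_isCont[OF cont(2)]]) auto
    qed (use x in auto)
    moreover have "(\<integral>t. g t x \<partial>lborel) = (\<integral>t. (\<theta> (inverse t *\<^sub>R x) / t) * indicator {norm x..1} t \<partial>lborel)"
    proof (rule integral_cong_AE)
      \<comment> \<open>At t = |x| the point x / t lies on the sphere, outside the open ball, while
        the closed interval contains this t.\<close>
      show "AE t in lborel. g t x = (\<theta> (inverse t *\<^sub>R x) / t) * indicator {norm x..1} t"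
        using AE_lborel_singleton[of "norm x"]
      proof eventually_elim
        case (elim t)
        show ?case
        proof (cases "0 < t \<and> t \<le> 1")
          case True
          then have "inverse t *\<^sub>R x \<in> ball 0 1 \<longleftrightarrow> norm x < t"
            by (auto simp: field_simps)
          then show ?thesis
            using True elim by (auto simp: g_def F_def indicator_def)
        next
          case False
          then have "\<not> (norm x \<le> t \<and> t \<le> 1)"
            using x(1) by linarith
          then show ?thesis
            using False by (auto simp: g_def indicator_def)
        qed
      qed
    qed (unfold g_def, measurable)
    ultimately show ?thesis
      using x by simp
  qed
  have "(\<integral>x. indicator (ball 0 1) x * (\<psi> (x /\<^sub>R norm x) - \<psi> x) \<partial>lborel) =
      (\<integral>x. (\<integral>t. g t x \<partial>lborel) \<partial>lborel)"
    by (simp add: ray)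
  also have "\<dots> = (\<integral>t. (\<integral>x. g t x \<partial>lborel) \<partial>lborel)"
    by (rule lborel_pair.Fubini_integral[OF g_int])
  also have "\<dots> = (\<integral>t. indicator {0<..1} t * t ^ (n - 1) * (\<integral>x. F x \<partial>lborel) \<partial>lborel)"
    unfolding g_def by (subst scale) auto
  also have "\<dots> = (\<integral>x. F x \<partial>lborel) / n"
    using pow by (simp add: has_bochner_integral_iff)
  finally have diff: "n * (\<integral>x. indicator (ball 0 1) x * (\<psi> (x /\<^sub>R norm x) - \<psi> x) \<partial>lborel) =
      (\<integral>x. F x \<partial>lborel)"
    using n by simp
  have "integrable lborel (\<lambda>x. indicator (ball 0 1) x * \<psi> x)"
    using cont by (intro integrable_indicator_bounded) auto
  note int = this integrable_mult_right[OF this, of "real n"]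
  \<comment> \<open>The function \<psi>(x / |x|) need not be continuous at the origin; its
    integrability on the ball is taken from Fubini.\<close>
  have "integrable lborel (\<lambda>x. (\<integral>t. g t x \<partial>lborel))"
    using lborel_pair.integrable_snd[OF g_int] .
  then have int2: "integrable lborel (\<lambda>x. indicator (ball 0 1) x * (\<psi> (x /\<^sub>R norm x) - \<psi> x))"
    by (simp add: ray)
  have "(\<integral>x. indicator (ball 0 1) x * \<psi> (x /\<^sub>R norm x) \<partial>lborel) =
      (\<integral>x. indicator (ball 0 1) x * (\<psi> (x /\<^sub>R norm x) - \<psi> x) + indicator (ball 0 1) x * \<psi> x \<partial>lborel)"
    by (simp flip: distrib_left)
  also have "\<dots> = (\<integral>x. indicator (ball 0 1) x * (\<psi> (x /\<^sub>R norm x) - \<psi> x) \<partial>lborel) +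
      (\<integral>x. indicator (ball 0 1) x * \<psi> x \<partial>lborel)"
    using int int2 by simp
  finally have "n * (\<integral>x. indicator (ball 0 1) x * \<psi> (x /\<^sub>R norm x) \<partial>lborel) =
      (\<integral>x. F x \<partial>lborel) + n * (\<integral>x. indicator (ball 0 1) x * \<psi> x \<partial>lborel)"
    using diff by (simp add: distrib_left)
  also have "\<dots> = (\<integral>x. F x + n * (indicator (ball 0 1) x * \<psi> x) \<partial>lborel)"
    using int F_int by simp
  also have "\<dots> = (\<integral>x. indicator (ball 0 1) x * (n * \<psi> x + \<theta> x) \<partial>lborel)"
    by (simp add: F_def algebra_simps)
  finally show ?thesis
    by (simp add: n_def \<theta>_def)
qed

text \<open>If the Euler identity of degree k holds on average over all balls, the integral over the
  ball of radius r scales like r^(n+k), which gives the factor 2^(n+k) between the radii 1/2 and 1.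
  The proof integrates the derivative of t^(-k) \<psi>(t x) over t from 1/2 to 1; its x-integral at
  fixed t is the averaged defect on the ball of radius t, so the error \<epsilon> is carried
  along.\<close>

lemma integral_half_ball_growth:
  fixes \<psi> :: "'a::euclidean_space \<Rightarrow> real"
  assumes \<psi>: "smooth \<psi>"
    and bound: "\<And>\<rho>. 0 < \<rho> \<Longrightarrow> \<rho> \<le> 1 \<Longrightarrow>
      \<bar>\<integral>x. indicator (ball 0 \<rho>) x * (grad \<psi> x \<bullet> x - real k * \<psi> x) \<partial>lborel\<bar> \<le> \<epsilon>"
  shows "\<bar>(\<integral>x. indicator (ball 0 1) x * \<psi> x \<partial>lborel) -
      2 ^ (DIM('a) + k) * (\<integral>x. indicator (ball 0 (1/2)) x * \<psi> x \<partial>lborel)\<bar> \<le> 2 ^ (DIM('a) + k + 1) * \<epsilon>"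
proof -
  define n where "n = DIM('a)"
  define \<theta> where "\<theta> x = grad \<psi> x \<bullet> x - real k * \<psi> x" for x
  have cont: "continuous_on UNIV \<psi>" "continuous_on UNIV \<theta>"
    unfolding \<theta>_def
    using smooth_continuous_on[OF \<psi>] smooth_continuous_on_grad[OF \<psi>] by (auto intro!: continuous_intros)
  note [measurable] = cont[THEN borel_measurable_continuous_onI]
  have "\<epsilon> \<ge> 0"
    using bound[of 1] by linarith
  have scale: "(\<integral>x. indicator (ball 0 1) x * H (r *\<^sub>R x) \<partial>lborel) =
      inverse r ^ n * (\<integral>x. indicator (ball 0 r) x * H x \<partial>lborel)"
    if [measurable]: "H \<in> borel_measurable borel" and r: "r > 0" for H :: "'a \<Rightarrow> real" and r
  proof -
    have "(\<integral>x. indicator (ball 0 r) (r *\<^sub>R x) * H (r *\<^sub>R x) \<partial>lborel) =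
        (\<integral>x. indicator (ball 0 r) x * H x \<partial>lborel) / \<bar>r\<bar> ^ n"
      unfolding n_def by (rule lborel_integral_scaleR) (use r in auto)
    moreover have "indicator (ball 0 r) (r *\<^sub>R x) = (indicator (ball 0 1) x :: real)" for x :: 'a
      using r by (auto simp: indicator_def)
    ultimately show ?thesis
      using r by (simp add: divide_inverse power_inverse mult.commute)
  qed
  \<comment> \<open>On the unit ball this is the derivative in t of t^(-k) \<psi>(t x), because the
    term from differentiating t^(-k) is the one subtracted in \<open>\<theta>\<close>.\<close>
  define g where "g t x = indicator {1/2..1} t * (indicator (ball 0 1) x * (inverse t ^ Suc k * \<theta> (t *\<^sub>R x)))"
    for t :: real and x :: 'a
  have g_int: "integrable (lborel \<Otimes>\<^sub>M lborel) (case_prod g)"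
  proof -
    let ?G = "\<lambda>(t::real, x::'a). inverse t ^ Suc k * \<theta> (t *\<^sub>R x)"
    have "integrable lborel (\<lambda>z. indicator ({1/2..1} \<times> cball 0 1) z *\<^sub>R ?G z)"
    proof (rule borel_integrable_compact)
      show "continuous_on ({1/2..1} \<times> cball 0 1) ?G"
        unfolding case_prod_beta
        by (intro continuous_intros continuous_on_compose2[OF cont(2)]) auto
    qed (intro compact_Times; simp)
    then have "integrable (lborel \<Otimes>\<^sub>M lborel) (\<lambda>z. indicator ({1/2..1} \<times> cball 0 1) z *\<^sub>R ?G z)"
      by (simp add: lborel_prod)
    then show ?thesis
    proof (rule Bochner_Integration.integrable_bound)
      show "case_prod g \<in> borel_measurable (lborel \<Otimes>\<^sub>M lborel)"
        unfolding g_def by measurable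
      show "AE z in lborel \<Otimes>\<^sub>M lborel. norm (case_prod g z) \<le>
          norm (indicator ({1/2..1} \<times> cball 0 1) z *\<^sub>R ?G z)"
        by (intro AE_I2) (auto simp: g_def indicator_def)
    qed
  qed
  have ray: "(\<integral>t. g t x \<partial>lborel) = indicator (ball 0 1) x * (\<psi> x - 2 ^ k * \<psi> ((1/2) *\<^sub>R x))" for x
  proof -
    have "(\<integral>t. (inverse t ^ Suc k * \<theta> (t *\<^sub>R x)) * indicator {1/2..1} t \<partial>lborel) =
        inverse 1 ^ k * \<psi> (1 *\<^sub>R x) - inverse (1/2) ^ k * \<psi> ((1/2) *\<^sub>R x)"
    proof (rule integral_FTC_Icc_real)
      fix t :: real assume t: "1/2 \<le> t" "t \<le> 1"
      then have "t \<noteq> 0"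
        by linarith
      have "((\<lambda>t. inverse t ^ k) has_real_derivative real k * (inverse t ^ (k - 1) * - (inverse t ^ 2))) (at t)"
        using DERIV_power[OF DERIV_inverse[OF \<open>t \<noteq> 0\<close>, of UNIV], of k] by (simp add: numeral_2_eq_2 mult_ac)
      moreover have "real k * (inverse t ^ (k - 1) * - (inverse t ^ 2)) = - (real k * inverse t ^ Suc k)"
        by (cases k) (simp_all add: power2_eq_square)
      ultimately have "((\<lambda>t. inverse t ^ k) has_real_derivative - (real k * inverse t ^ Suc k)) (at t)"
        by (simp only:)
      from DERIV_mult[OF this DERIV_along_ray[OF \<psi> DERIV_ident, of x]]
      have "((\<lambda>t. inverse t ^ k * \<psi> (t *\<^sub>R x)) has_real_derivative
          - (real k * inverse t ^ Suc k) * \<psi> (t *\<^sub>R x) + (grad \<psi> (t *\<^sub>R x) \<bullet> x) * inverse t ^ k) (at t)"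
        by simp
      moreover have "inverse t ^ k = inverse t ^ Suc k * t"
        using \<open>t \<noteq> 0\<close> by simp
      then have "- (real k * inverse t ^ Suc k) * \<psi> (t *\<^sub>R x) + (grad \<psi> (t *\<^sub>R x) \<bullet> x) * inverse t ^ k =
          inverse t ^ Suc k * \<theta> (t *\<^sub>R x)"
        by (simp add: \<theta>_def algebra_simps del: power_Suc)
      ultimately show "((\<lambda>t. inverse t ^ k * \<psi> (t *\<^sub>R x)) has_real_derivative
          inverse t ^ Suc k * \<theta> (t *\<^sub>R x)) (at t)"
        by simp
      show "isCont (\<lambda>t. inverse t ^ Suc k * \<theta> (t *\<^sub>R x)) t"
        using \<open>t \<noteq> 0\<close>
        by (intro continuous_intros isCont_o2[OF _ continuous_isCont[OF cont(2)]]) auto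
    qed simp
    then have "(\<integral>t. indicator (ball 0 1) x * ((inverse t ^ Suc k * \<theta> (t *\<^sub>R x)) * indicator {1/2..1} t) \<partial>lborel) =
        indicator (ball 0 1) x * (\<psi> x - 2 ^ k * \<psi> ((1/2) *\<^sub>R x))"
      by simp
    then show ?thesis
      by (simp add: g_def mult_ac)
  qed
  have inner: "(\<integral>x. g t x \<partial>lborel) = indicator {1/2..1} t *
      (inverse t ^ (n + k + 1) * (\<integral>x. indicator (ball 0 t) x * \<theta> x \<partial>lborel))" for t
  proof (cases "t \<in> {1/2..1}")
    case True
    then have "(\<integral>x. g t x \<partial>lborel) = (\<integral>x. inverse t ^ Suc k * (indicator (ball 0 1) x * \<theta> (t *\<^sub>R x)) \<partial>lborel)"
      by (simp add: g_def mult_ac)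
    also have "\<dots> = inverse t ^ Suc k * (inverse t ^ n * (\<integral>x. indicator (ball 0 t) x * \<theta> x \<partial>lborel))"
      using True by (subst integral_mult_right_zero, subst scale) auto
    finally show ?thesis
      using True by (simp add: power_add mult_ac)
  qed (simp add: g_def)
  have "\<bar>\<integral>x. (\<integral>t. g t x \<partial>lborel) \<partial>lborel\<bar> = \<bar>\<integral>t. (\<integral>x. g t x \<partial>lborel) \<partial>lborel\<bar>"
    by (simp add: lborel_pair.Fubini_integral[OF g_int])
  also have "\<dots> \<le> (\<integral>t. indicator {1/2..1::real} t * (2 ^ (n + k + 1) * \<epsilon>) \<partial>lborel)"
  proof (rule integral_abs_bound_integral)
    show "integrable lborel (\<lambda>t. \<integral>x. g t x \<partial>lborel)"
      using lborel_pair.integrable_fst[OF g_int] .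
    show "integrable lborel (\<lambda>t. indicator {1/2..1::real} t * (2 ^ (n + k + 1) * \<epsilon>))"
      by (rule integrable_indicator_bounded) auto
    fix t :: real
    show "\<bar>\<integral>x. g t x \<partial>lborel\<bar> \<le> indicator {1/2..1} t * (2 ^ (n + k + 1) * \<epsilon>)"
    proof (cases "t \<in> {1/2..1}")
      case True
      have "inverse t ^ (n + k + 1) \<le> 2 ^ (n + k + 1)"
        using True by (intro power_mono) (auto simp: field_simps)
      moreover have "inverse t ^ (n + k + 1) \<ge> 0"
        using True by simp
      ultimately have "inverse t ^ (n + k + 1) * \<bar>\<integral>x. indicator (ball 0 t) x * \<theta> x \<partial>lborel\<bar> \<le> 2 ^ (n + k + 1) * \<epsilon>"
        using bound[of t] True unfolding \<theta>_def[symmetric] by (intro mult_mono) auto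
      then show ?thesis
        using True unfolding inner by (simp add: abs_mult)
    qed (simp add: inner)
  qed
  \<comment> \<open>The interval has length 1/2; this factor is given away.\<close>
  also have "\<dots> \<le> 2 ^ (n + k + 1) * \<epsilon>"
    using \<open>\<epsilon> \<ge> 0\<close> by simp
  finally have main: "\<bar>\<integral>x. (\<integral>t. g t x \<partial>lborel) \<partial>lborel\<bar> \<le> 2 ^ (n + k + 1) * \<epsilon>" .
  have "(\<integral>x. (\<integral>t. g t x \<partial>lborel) \<partial>lborel) =
      (\<integral>x. indicator (ball 0 1) x * \<psi> x - 2 ^ k * (indicator (ball 0 1) x * \<psi> ((1/2) *\<^sub>R x)) \<partial>lborel)"
    unfolding ray by (simp add: algebra_simps)
  also have "\<dots> = (\<integral>x. indicator (ball 0 1) x * \<psi> x \<partial>lborel) -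
      2 ^ k * (\<integral>x. indicator (ball 0 1) x * \<psi> ((1/2) *\<^sub>R x) \<partial>lborel)"
  proof -
    have "integrable lborel (\<lambda>x. indicator (ball 0 1) x * \<psi> x)"
      "integrable lborel (\<lambda>x. indicator (ball 0 1) x * \<psi> ((1/2) *\<^sub>R x))"
      by (intro integrable_indicator_bounded continuous_on_compose2[OF cont(1)] continuous_intros; simp add: cont)+
    then show ?thesis
      by simp
  qed
  also have "\<dots> = (\<integral>x. indicator (ball 0 1) x * \<psi> x \<partial>lborel) -
      2 ^ (n + k) * (\<integral>x. indicator (ball 0 (1/2)) x * \<psi> x \<partial>lborel)"
    by (subst scale) (simp_all add: power_add)
  finally show ?thesis
    using main by (simp add: n_def)
qed


subsection \<open>Integration over the sphere\<close>

text \<open>With the scaling written as a constant density, Bochner integrals can be computed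
  through the image measure.\<close>

lemma sphere_measure_eq_density:
  "sphere_measure = density (distr (restrict_space lborel (ball 0 1 - {0})) borel (\<lambda>x. x /\<^sub>R norm x))
     (\<lambda>_::'a::euclidean_space. ennreal (real DIM('a)))"
  unfolding sphere_measure_def
  by (rule measure_eqI) (auto simp: emeasure_density nn_integral_cmult_indicator ennreal_of_nat_eq_real_of_nat)

lemma
  fixes f :: "'a::euclidean_space \<Rightarrow> real"
  assumes [measurable]: "f \<in> borel_measurable borel"
  shows integral_sphere_measure: "integral\<^sup>L sphere_measure f =
      DIM('a) * (\<integral>x. indicator (ball 0 1) x * f (x /\<^sub>R norm x) \<partial>lborel)"
    and integrable_sphere_measure: "integrable sphere_measure f \<longleftrightarrow>
      integrable lborel (\<lambda>x. indicator (ball 0 1) x * f (x /\<^sub>R norm x))"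
proof -
  \<comment> \<open>The origin, removed in the definition of the measure, is a null set.\<close>
  have ae: "AE x in lborel. indicator (ball 0 1 - {0}) x * f (x /\<^sub>R norm x) =
      indicator (ball 0 1) x * f (x /\<^sub>R norm x)"
    using AE_lborel_singleton[of 0] by eventually_elim (auto simp: indicator_def)
  have m: "(\<lambda>x::'a. x /\<^sub>R norm x) \<in> measurable (restrict_space lborel (ball 0 1 - {0})) borel"
    by (rule measurable_restrict_space1) measurable
  have "(\<integral>x. indicator (ball 0 1 - {0}) x * f (x /\<^sub>R norm x) \<partial>lborel) =
      (\<integral>x. indicator (ball 0 1) x * f (x /\<^sub>R norm x) \<partial>lborel)"
    by (rule integral_cong_AE[OF _ _ ae]) measurable
  then show "integral\<^sup>L sphere_measure f =
      DIM('a) * (\<integral>x. indicator (ball 0 1) x * f (x /\<^sub>R norm x) \<partial>lborel)"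
    using m by (simp add: sphere_measure_eq_density integral_density integral_distr integral_restrict_space)
  have "integrable lborel (\<lambda>x. indicator (ball 0 1 - {0}) x * f (x /\<^sub>R norm x)) \<longleftrightarrow>
      integrable lborel (\<lambda>x. indicator (ball 0 1) x * f (x /\<^sub>R norm x))"
    by (rule integrable_cong_AE[OF _ _ ae]) measurable
  then show "integrable sphere_measure f \<longleftrightarrow>
      integrable lborel (\<lambda>x. indicator (ball 0 1) x * f (x /\<^sub>R norm x))"
    using m by (simp add: sphere_measure_eq_density integrable_density integrable_distr_eq integrable_restrict_space)
qed

lemma sets_sphere_measure [measurable_cong, simp]: "sets sphere_measure = sets borel"
  by (simp add: sphere_measure_def)

lemma integrable_sphere_measure_continuous:
  fixes f :: "'a::euclidean_space \<Rightarrow> real"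
  assumes "continuous_on UNIV f"
  shows "integrable sphere_measure f"
proof -
  have [measurable]: "f \<in> borel_measurable borel"
    using assms by (rule borel_measurable_continuous_onI)
  have "bounded (f ` cball 0 1)"
    using continuous_on_subset[OF assms subset_UNIV]
    by (intro compact_imp_bounded compact_continuous_image) auto
  then obtain C where C: "\<And>x. norm x \<le> 1 \<Longrightarrow> \<bar>f x\<bar> \<le> C"
    unfolding bounded_iff by (metis image_eqI mem_cball_0 real_norm_def)
  have "integrable lborel (\<lambda>x::'a. indicator (ball 0 1) x * C)"
    by (rule integrable_indicator_bounded) auto
  then have "integrable lborel (\<lambda>x. indicator (ball 0 1) x * f (x /\<^sub>R norm x))"
  proof (rule Bochner_Integration.integrable_bound)
    \<comment> \<open>At x = 0 the projection has the default value 0, so a bound for f on the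
      closed unit ball covers all cases.\<close>
    have "\<bar>f (x /\<^sub>R norm x)\<bar> \<le> \<bar>C\<bar>" for x
      using C[of "x /\<^sub>R norm x"] by (cases "x = 0") auto
    then show "AE x in lborel. norm (indicator (ball 0 1) x * f (x /\<^sub>R norm x)) \<le> norm (indicator (ball 0 1) x * C)"
      by (auto simp: indicator_def)
  qed measurable
  then show ?thesis
    by (simp add: integrable_sphere_measure)
qed

lemma integral_sphere_measure_smooth:
  fixes \<psi> :: "'a::euclidean_space \<Rightarrow> real"
  assumes "smooth \<psi>"
  shows "integral\<^sup>L sphere_measure \<psi> =
    (\<integral>x. indicator (ball 0 1) x * (DIM('a) * \<psi> x + grad \<psi> x \<bullet> x) \<partial>lborel)"
  using assms integral_sphere_projection by (simp add: integral_sphere_measure smooth_borel_measurable)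

subsection \<open>Weak gradients\<close>

lemma L2_integrable_inner:
  fixes G V :: "'a::euclidean_space \<Rightarrow> 'b::euclidean_space"
  assumes G: "G \<in> L2 S" and V: "V \<in> L2 S"
  shows "integrable (lebesgue_on S) (\<lambda>x. G x \<bullet> V x)"
proof (rule Bochner_Integration.integrable_bound)
  show "integrable (lebesgue_on S) (\<lambda>x. (norm (G x))\<^sup>2 + (norm (V x))\<^sup>2)"
    using G V by (simp add: L2_def)
  show "(\<lambda>x. G x \<bullet> V x) \<in> borel_measurable (lebesgue_on S)"
    using G V by (auto simp: L2_def intro: borel_measurable_inner)
  have "\<bar>y \<bullet> z\<bar> \<le> (norm y)\<^sup>2 + (norm z)\<^sup>2" for y z :: 'b
    using Cauchy_Schwarz_ineq2[of y z] sum_squares_bound[of "norm y" "norm z"]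
      mult_nonneg_nonneg[OF norm_ge_zero norm_ge_zero, of y z] by linarith
  then show "AE x in lebesgue_on S. norm (G x \<bullet> V x) \<le> norm ((norm (G x))\<^sup>2 + (norm (V x))\<^sup>2)"
    by (simp add: abs_of_nonneg)
qed

lemma L2_integrable_mult:
  fixes f g :: "'a::euclidean_space \<Rightarrow> real"
  assumes "f \<in> L2 S" "g \<in> L2 S"
  shows "integrable (lebesgue_on S) (\<lambda>x. f x * g x)"
  using L2_integrable_inner[OF assms] by simp

lemma L2_diff:
  fixes G V :: "'a::euclidean_space \<Rightarrow> 'b::euclidean_space"
  assumes G: "G \<in> L2 S" and V: "V \<in> L2 S"
  shows "(\<lambda>x. G x - V x) \<in> L2 S"
proof -
  have "integrable (lebesgue_on S) (\<lambda>x. (norm (G x))\<^sup>2 + (norm (V x))\<^sup>2 - 2 * (G x \<bullet> V x))"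
    using G V L2_integrable_inner[OF G V] by (simp add: L2_def)
  moreover have "(norm (y - z))\<^sup>2 = (norm y)\<^sup>2 + (norm z)\<^sup>2 - 2 * (y \<bullet> z)" for y z :: 'b
    by (simp add: power2_norm_eq_inner inner_diff_left inner_diff_right inner_commute)
  ultimately show ?thesis
    using G V by (auto simp: L2_def)
qed

lemma L2_component:
  fixes G :: "'a::euclidean_space \<Rightarrow> 'b::euclidean_space"
  assumes G: "G \<in> L2 S"
  shows "(\<lambda>x. G x \<bullet> i) \<in> L2 S"
proof -
  have m: "(\<lambda>x. G x \<bullet> i) \<in> borel_measurable (lebesgue_on S)"
    using G by (auto simp: L2_def)
  have "integrable (lebesgue_on S) (\<lambda>x. (norm i)\<^sup>2 * (norm (G x))\<^sup>2)"
    using G by (simp add: L2_def)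
  then have "integrable (lebesgue_on S) (\<lambda>x. (norm (G x \<bullet> i))\<^sup>2)"
  proof (rule Bochner_Integration.integrable_bound)
    have "(norm (y \<bullet> i))\<^sup>2 \<le> (norm i)\<^sup>2 * (norm y)\<^sup>2" for y
      using Cauchy_Schwarz_ineq[of y i] by (simp add: power2_norm_eq_inner power2_abs mult.commute)
    then show "AE x in lebesgue_on S. norm ((norm (G x \<bullet> i))\<^sup>2) \<le> norm ((norm i)\<^sup>2 * (norm (G x))\<^sup>2)"
      by (auto simp: abs_mult)
  qed (use m in measurable)
  with m show ?thesis
    by (simp add: L2_def)
qed

lemma has_weak_grad_diff:
  fixes u v :: "'a::euclidean_space \<Rightarrow> real"
  assumes S: "bounded S" "S \<in> sets borel"
    and u: "u \<in> L2 S" "has_weak_grad S u G" and v: "v \<in> L2 S" "has_weak_grad S v H"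
  shows "has_weak_grad S (\<lambda>x. u x - v x) (\<lambda>x. G x - H x)"
  unfolding has_weak_grad_def
proof (intro conjI ballI)
  show "(\<lambda>x. G x - H x) \<in> L2 S"
    using u v by (intro L2_diff) (auto simp: has_weak_grad_def)
  fix \<phi> :: "'a \<Rightarrow> real" and i :: 'a
  assume \<phi>: "\<phi> \<in> test_functions S" and i: "i \<in> Basis"
  have L: "\<phi> \<in> L2 S" "pderiv_at i \<phi> \<in> L2 S" "(\<lambda>x. G x \<bullet> i) \<in> L2 S" "(\<lambda>x. H x \<bullet> i) \<in> L2 S"
    using \<phi> i test_functionsD(1)[OF \<phi>] S u v
    by (auto intro: smooth_L2 smooth_pderiv_at L2_component simp: has_weak_grad_def)
  have "integral\<^sup>L (lebesgue_on S) (\<lambda>x. u x * pderiv_at i \<phi> x) =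
      - integral\<^sup>L (lebesgue_on S) (\<lambda>x. (G x \<bullet> i) * \<phi> x)"
    "integral\<^sup>L (lebesgue_on S) (\<lambda>x. v x * pderiv_at i \<phi> x) =
      - integral\<^sup>L (lebesgue_on S) (\<lambda>x. (H x \<bullet> i) * \<phi> x)"
    using u v \<phi> i by (auto simp: has_weak_grad_def)
  then show "integral\<^sup>L (lebesgue_on S) (\<lambda>x. (u x - v x) * pderiv_at i \<phi> x) =
      - integral\<^sup>L (lebesgue_on S) (\<lambda>x. ((G x - H x) \<bullet> i) * \<phi> x)"
    using L u v by (simp add: left_diff_distrib inner_diff_left L2_integrable_mult)
qed

text \<open>Componentwise, both fields have the same integrals against all test functions, so their
  difference falls under the fundamental lemma. This allows the chosen \<open>weak_grad\<close> to
  be replaced by any weak gradient at hand.\<close>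

lemma has_weak_grad_unique:
  fixes u :: "'a::euclidean_space \<Rightarrow> real"
  assumes S: "bounded S" "open S" and G: "has_weak_grad S u G" and H: "has_weak_grad S u H"
  shows "AE x in lebesgue_on S. G x = H x"
proof -
  have L: "(\<lambda>x. G x \<bullet> i) \<in> L2 S" "(\<lambda>x. H x \<bullet> i) \<in> L2 S" for i
    using G H L2_component by (auto simp: has_weak_grad_def)
  have "AE x in lebesgue_on S. (G x - H x) \<bullet> i = 0" if i: "i \<in> Basis" for i
  proof (rule AE_eq_0_if_test_integrals_eq_0[OF S(2)])
    have 1: "(\<lambda>x. 1 :: real) \<in> L2 S"
      using S by (intro smooth_L2(1) smooth_const) auto
    show "integrable (lebesgue_on S) (\<lambda>x. (G x - H x) \<bullet> i)"
      using L2_integrable_mult[OF L(1) 1] L2_integrable_mult[OF L(2) 1] by (simp add: inner_diff_left)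
    fix \<phi> assume \<phi>: "\<phi> \<in> test_functions S"
    have "\<phi> \<in> L2 S"
      using test_functionsD(1)[OF \<phi>] S by (auto intro: smooth_L2)
    moreover have "integral\<^sup>L (lebesgue_on S) (\<lambda>x. (G x \<bullet> i) * \<phi> x) =
        integral\<^sup>L (lebesgue_on S) (\<lambda>x. (H x \<bullet> i) * \<phi> x)"
      using G H \<phi> i by (auto simp: has_weak_grad_def)
    ultimately show "integral\<^sup>L (lebesgue_on S) (\<lambda>x. ((G x - H x) \<bullet> i) * \<phi> x) = 0"
      using L by (simp add: left_diff_distrib inner_diff_left L2_integrable_mult)
  qed
  then have "AE x in lebesgue_on S. \<forall>i\<in>Basis. (G x - H x) \<bullet> i = 0"
    by (intro AE_finite_allI) auto
  then show ?thesis
    by eventually_elim (metis euclidean_all_zero_iff right_minus_eq)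
qed

lemma has_weak_grad_weak_grad:
  "has_weak_grad S u G \<Longrightarrow> has_weak_grad S u (weak_grad S u)"
  unfolding weak_grad_def by (rule someI[of "has_weak_grad S u"])

lemma norm_L2_power2:
  "(norm_L2 S f)\<^sup>2 = integral\<^sup>L (lebesgue_on S) (\<lambda>x. (norm (f x))\<^sup>2)"
  unfolding norm_L2_def by (intro real_sqrt_pow2 integral_nonneg_AE) simp

text \<open>Frees the norm from the choice hidden in \<open>weak_grad\<close>: for smooth functions
  it can be computed with the classical gradient.\<close>

lemma norm_H1_power2:
  fixes u :: "'a::euclidean_space \<Rightarrow> real"
  assumes S: "bounded S" "open S" and G: "has_weak_grad S u G"
  shows "(norm_H1 S u)\<^sup>2 = (norm_L2 S u)\<^sup>2 + (norm_L2 S G)\<^sup>2"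
proof -
  note W = has_weak_grad_weak_grad[OF G]
  have "norm_L2 S (weak_grad S u) = norm_L2 S G"
    unfolding norm_L2_def
  proof (rule arg_cong[where f=sqrt], rule integral_cong_AE)
    show "AE x in lebesgue_on S. (norm (weak_grad S u x))\<^sup>2 = (norm (G x))\<^sup>2"
      using has_weak_grad_unique[OF S W G] by eventually_elim simp
  qed (use G W in \<open>auto simp: has_weak_grad_def L2_def\<close>)
  then show ?thesis
    by (simp add: norm_H1_def)
qed

lemma norm_H1_nonneg: "norm_H1 S u \<ge> 0"
  by (simp add: norm_H1_def)

text \<open>Cauchy-Schwarz against the constant 1. It converts smallness in H^1 into smallness of
  integrals with bounded weights.\<close>

lemma L1_le_L2:
  fixes f :: "'a::euclidean_space \<Rightarrow> 'b::euclidean_space"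
  assumes S: "bounded S" "S \<in> sets borel" and f: "f \<in> L2 S"
  shows "integrable (lebesgue_on S) (\<lambda>x. norm (f x))"
    "integral\<^sup>L (lebesgue_on S) (\<lambda>x. norm (f x)) \<le> sqrt (measure lebesgue S) * norm_L2 S f"
proof -
  have f': "(\<lambda>x. norm (f x)) \<in> borel_measurable (lebesgue_on S)"
    "integrable (lebesgue_on S) (\<lambda>x. (norm (f x))\<^sup>2)"
    using f by (auto simp: L2_def)
  have 1: "integrable (lebesgue_on S) (\<lambda>x. 1\<^sup>2 :: real)"
    using S by (intro integrable_lebesgue_on_continuous) auto
  show "integrable (lebesgue_on S) (\<lambda>x. norm (f x))"
    using integrable_mult_L2[OF f'(1) _ f'(2) 1] by simp
  have "S \<in> sets lebesgue"
    using S by auto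
  then have "integral\<^sup>L (lebesgue_on S) (\<lambda>x. 1\<^sup>2 :: real) = measure lebesgue S"
    by (simp add: measure_restrict_space)
  with Cauchy_Schwarz_L2[OF f'(1) _ f'(2) 1]
  have "(integral\<^sup>L (lebesgue_on S) (\<lambda>x. norm (f x)))\<^sup>2 \<le> (norm_L2 S f)\<^sup>2 * measure lebesgue S"
    by (simp add: norm_L2_power2)
  then have "integral\<^sup>L (lebesgue_on S) (\<lambda>x. norm (f x)) \<le> sqrt ((norm_L2 S f)\<^sup>2 * measure lebesgue S)"
    by (rule real_le_rsqrt)
  then show "integral\<^sup>L (lebesgue_on S) (\<lambda>x. norm (f x)) \<le> sqrt (measure lebesgue S) * norm_L2 S f"
    by (simp add: real_sqrt_mult norm_L2_def mult.commute)
qed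


subsection \<open>Harmonic polynomials in two of the variables\<close>

locale coordinate_plane =
  fixes a b :: "'a::euclidean_space"
  assumes ab: "a \<in> Basis" "b \<in> Basis" "a \<noteq> b"
begin

definition plane :: "'a \<Rightarrow> complex" where
  "plane x = complex_of_real (x \<bullet> a) + \<i> * complex_of_real (x \<bullet> b)"

text \<open>The complex weight makes the family closed under both partial derivatives and under real
  scaling, and it contains real and imaginary parts alike: w = -i turns the real part into the
  imaginary part of z^d.\<close>

definition harm :: "complex \<Rightarrow> nat \<Rightarrow> 'a \<Rightarrow> real" where
  "harm w d x = Re (w * plane x ^ d)"

lemma norm_plane_power2: "(norm (plane x))\<^sup>2 = (x \<bullet> a)\<^sup>2 + (x \<bullet> b)\<^sup>2"
  by (simp add: plane_def cmod_power2)

lemma norm_plane_le: "norm (plane x) \<le> norm x"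
proof -
  have "(x \<bullet> a)\<^sup>2 + (x \<bullet> b)\<^sup>2 = (\<Sum>i\<in>{a, b}. (x \<bullet> i)\<^sup>2)"
    using ab by simp
  also have "\<dots> \<le> (\<Sum>i\<in>Basis. (x \<bullet> i)\<^sup>2)"
    using ab by (intro sum_mono2) auto
  also have "\<dots> = (norm x)\<^sup>2"
    unfolding power2_norm_eq_inner euclidean_inner[of x x] by (simp add: power2_eq_square)
  finally show ?thesis
    unfolding norm_plane_power2[symmetric] by (rule power2_le_imp_le) simp
qed

lemma abs_harm_le:
  assumes "norm x \<le> 1"
  shows "\<bar>harm w d x\<bar> \<le> norm w"
proof -
  have "norm (plane x) ^ d \<le> 1"
    using norm_plane_le[of x] assms by (intro power_le_one) auto
  then have "norm (w * plane x ^ d) \<le> norm w"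
    by (simp add: norm_mult norm_power mult_left_le)
  then show ?thesis
    unfolding harm_def using abs_Re_le_cmod order_trans by blast
qed

lemma smooth_harm: "smooth (harm w d)"
proof -
  have "smooth (\<lambda>x. Re (plane x ^ d)) \<and> smooth (\<lambda>x. Im (plane x ^ d))"
  proof (induction d)
    case 0
    then show ?case by (simp add: smooth_const)
  next
    case (Suc d)
    then show ?case
      by (auto simp: plane_def intro!: smooth_add smooth_diff smooth_mult smooth_inner_left)
  qed
  then show ?thesis
    unfolding harm_def[abs_def] by (auto intro!: smooth_diff smooth_mult smooth_const)
qed

text \<open>The complex derivative of w z^d is d w z^(d-1), and z has the partial derivatives 1 and
  i. At d = 0 the truncated exponent is harmless since the coefficient is zero.\<close>

lemma grad_harm:
  "grad (harm w d) x = harm (of_nat d * w) (d - 1) x *\<^sub>R a + harm (of_nat d * (\<i> * w)) (d - 1) x *\<^sub>R b"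
proof (rule grad_eqI)
  have "(plane has_derivative plane) (at x)"
    unfolding plane_def[abs_def] by (auto intro!: derivative_eq_intros)
  then show "(harm w d has_derivative (\<lambda>v. Re (w * (of_nat d * plane v * plane x ^ (d - 1))))) (at x)"
    unfolding harm_def[abs_def]
    by (intro bounded_linear.has_derivative[OF bounded_linear_Re] has_derivative_mult_right has_derivative_power)
  fix v
  show "Re (w * (of_nat d * plane v * plane x ^ (d - 1))) =
      (harm (of_nat d * w) (d - 1) x *\<^sub>R a + harm (of_nat d * (\<i> * w)) (d - 1) x *\<^sub>R b) \<bullet> v"
  proof -
    have "w * (of_nat d * plane v * plane x ^ (d - 1)) =
        complex_of_real (v \<bullet> a) * (of_nat d * w * plane x ^ (d - 1)) +
        complex_of_real (v \<bullet> b) * (of_nat d * (\<i> * w) * plane x ^ (d - 1))"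
      by (simp add: plane_def algebra_simps)
    then have "Re (w * (of_nat d * plane v * plane x ^ (d - 1))) =
        (v \<bullet> a) * Re (of_nat d * w * plane x ^ (d - 1)) + (v \<bullet> b) * Re (of_nat d * (\<i> * w) * plane x ^ (d - 1))"
      by simp
    then show ?thesis
      by (simp only: harm_def inner_add_left inner_scaleR_left inner_commute[of a v]
          inner_commute[of b v] mult.commute[of "Re _" "_ \<bullet> _"])
  qed
qed

lemma pderiv_at_harm:
  "pderiv_at a (harm w d) = harm (of_nat d * w) (d - 1)"
  "pderiv_at b (harm w d) = harm (of_nat d * (\<i> * w)) (d - 1)"
  using ab by (auto simp: fun_eq_iff grad_inner_Basis[symmetric] grad_harm inner_add_left inner_Basis)

lemma euler_harm: "grad (harm w d) x \<bullet> x = d * harm w d x"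
proof (cases d)
  case 0
  then show ?thesis
    by (simp add: grad_harm harm_def)
next
  case (Suc m)
  have "of_nat d * (w * plane x ^ d) =
      complex_of_real (x \<bullet> a) * (of_nat d * w * plane x ^ (d - 1)) +
      complex_of_real (x \<bullet> b) * (of_nat d * (\<i> * w) * plane x ^ (d - 1))"
    by (simp add: Suc) (simp add: plane_def algebra_simps)
  then have "Re (of_nat d * (w * plane x ^ d)) =
      (x \<bullet> a) * harm (of_nat d * w) (d - 1) x + (x \<bullet> b) * harm (of_nat d * (\<i> * w)) (d - 1) x"
    unfolding harm_def by simp
  moreover have "Re (of_nat d * (w * plane x ^ d)) = d * harm w d x"
    by (simp add: harm_def)
  ultimately show ?thesis
    by (simp only: grad_harm inner_add_left inner_scaleR_left inner_commute[of a x]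
        inner_commute[of b x] mult.commute[of "harm _ _ _" "_ \<bullet> _"])
qed

text \<open>By the Cauchy-Riemann equations the two components are the real part and minus the
  imaginary part of one complex number, so the length is its modulus.\<close>

lemma norm_grad_harm: "(norm (grad (harm w d) x))\<^sup>2 = (d * norm w * norm (plane x) ^ (d - 1))\<^sup>2"
proof -
  have "a \<bullet> b = 0" "a \<bullet> a = 1" "b \<bullet> b = 1"
    using ab by (auto simp: inner_Basis)
  then have "(norm (grad (harm w d) x))\<^sup>2 =
      (harm (of_nat d * w) (d - 1) x)\<^sup>2 + (harm (of_nat d * (\<i> * w)) (d - 1) x)\<^sup>2"
    unfolding grad_harm power2_norm_eq_inner
    by (simp add: inner_add_left inner_add_right inner_commute[of b a] power2_eq_square)
  also have "\<dots> = (norm (of_nat d * w * plane x ^ (d - 1)))\<^sup>2"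
  proof -
    have "harm (of_nat d * (\<i> * w)) (d - 1) x = - Im (of_nat d * w * plane x ^ (d - 1))"
      unfolding harm_def by (simp add: algebra_simps)
    then show ?thesis
      unfolding cmod_power2 by (simp only: harm_def power2_minus)
  qed
  finally show ?thesis
    by (simp add: norm_mult norm_power)
qed

text \<open>Two derivatives in the direction b produce i^2 = -1 times those in the direction
  a.\<close>

lemma laplace_harm:
  "pderiv_at a (harm (of_nat d * w) (d - 1)) x + pderiv_at b (harm (of_nat d * (\<i> * w)) (d - 1)) x = 0"
  by (simp add: pderiv_at_harm) (simp add: harm_def algebra_simps)

text \<open>The divergence of \<Phi> grad P is grad \<Phi> . grad P because P is harmonic, so the
  components of \<Phi> grad P can serve as test functions for the weak gradient. Applied once to the
  given u with a radial cutoff, and once to u = 1 to see that P is weakly harmonic.\<close>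

lemma green_test:
  fixes u :: "'a \<Rightarrow> real"
  assumes L: "u \<in> L2 S" and G: "has_weak_grad S u G" and S: "bounded S" "S \<in> sets borel"
    and K: "compact K" "K \<subseteq> S" "\<And>x. x \<notin> K \<Longrightarrow> \<Phi> x = 0" and \<Phi>: "smooth \<Phi>"
  shows "integral\<^sup>L (lebesgue_on S) (\<lambda>x. G x \<bullet> (\<Phi> x *\<^sub>R grad (harm w d) x)) =
    - integral\<^sup>L (lebesgue_on S) (\<lambda>x. u x * (grad \<Phi> x \<bullet> grad (harm w d) x))"
proof -
  let ?Q = "\<lambda>v. harm (of_nat d * v) (d - 1)"
  have test: "(\<lambda>x. ?Q v x * \<Phi> x) \<in> test_functions S" for v
    using K \<Phi> smooth_harm by (intro test_functionsI[OF smooth_mult K(1,2)]) auto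
  have ibp: "integral\<^sup>L (lebesgue_on S) (\<lambda>x. u x * pderiv_at i (\<lambda>x. ?Q v x * \<Phi> x) x) =
      - integral\<^sup>L (lebesgue_on S) (\<lambda>x. (G x \<bullet> i) * (?Q v x * \<Phi> x))" if "i \<in> Basis" for i v
    using G test[of v] that by (auto simp: has_weak_grad_def)
  have int1: "integrable (lebesgue_on S) (\<lambda>x. u x * pderiv_at i (\<lambda>x. ?Q v x * \<Phi> x) x)"
    if "i \<in> Basis" for i v
    using test_functionsD(1)[OF test] that S
    by (intro L2_integrable_mult[OF L] smooth_L2(1) smooth_pderiv_at) auto
  have int2: "integrable (lebesgue_on S) (\<lambda>x. (G x \<bullet> i) * (?Q v x * \<Phi> x))" for i v
    using G S test_functionsD(1)[OF test] by (intro L2_integrable_mult L2_component smooth_L2) (auto simp: has_weak_grad_def)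
  have "integral\<^sup>L (lebesgue_on S) (\<lambda>x. G x \<bullet> (\<Phi> x *\<^sub>R grad (harm w d) x)) =
      integral\<^sup>L (lebesgue_on S) (\<lambda>x. (G x \<bullet> a) * (?Q w x * \<Phi> x) + (G x \<bullet> b) * (?Q (\<i> * w) x * \<Phi> x))"
    by (simp add: grad_harm inner_add_right algebra_simps)
  also have "\<dots> = - (integral\<^sup>L (lebesgue_on S) (\<lambda>x. u x * pderiv_at a (\<lambda>x. ?Q w x * \<Phi> x) x +
      u x * pderiv_at b (\<lambda>x. ?Q (\<i> * w) x * \<Phi> x) x))"
    using ab int1 int2 ibp by simp
  also have "(\<lambda>x. u x * pderiv_at a (\<lambda>x. ?Q w x * \<Phi> x) x + u x * pderiv_at b (\<lambda>x. ?Q (\<i> * w) x * \<Phi> x) x) =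
      (\<lambda>x. u x * (grad \<Phi> x \<bullet> grad (harm w d) x))"
  proof
    fix x
    have "pderiv_at a (\<lambda>x. ?Q w x * \<Phi> x) x + pderiv_at b (\<lambda>x. ?Q (\<i> * w) x * \<Phi> x) x =
        ?Q w x * pderiv_at a \<Phi> x + ?Q (\<i> * w) x * pderiv_at b \<Phi> x +
        (pderiv_at a (?Q w) x + pderiv_at b (?Q (\<i> * w)) x) * \<Phi> x"
      by (simp add: pderiv_at_mult smooth_differentiable smooth_harm \<Phi> algebra_simps)
    also have "\<dots> = grad \<Phi> x \<bullet> grad (harm w d) x"
      unfolding laplace_harm using ab
      by (simp add: grad_harm inner_add_right grad_inner_Basis)
    finally show "u x * pderiv_at a (\<lambda>x. ?Q w x * \<Phi> x) x + u x * pderiv_at b (\<lambda>x. ?Q (\<i> * w) x * \<Phi> x) x =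
        u x * (grad \<Phi> x \<bullet> grad (harm w d) x)"
      by (simp flip: distrib_left)
  qed
  finally show ?thesis .
qed

end

subsection \<open>Weakly harmonic functions tested against harmonic polynomials\<close>

lemma harmonic_H1D:
  assumes "u \<in> harmonic_H1 S"
  shows "u \<in> L2 S" "has_weak_grad S u (weak_grad S u)"
    "\<phi> \<in> test_functions S \<Longrightarrow> integral\<^sup>L (lebesgue_on S) (\<lambda>x. weak_grad S u x \<bullet> grad \<phi> x) = 0"
  using assms has_weak_grad_weak_grad by (auto simp: harmonic_H1_def H1_def)

lemma norm_L2_le_norm_H1:
  fixes u :: "'a::euclidean_space \<Rightarrow> real"
  assumes "bounded S" "open S" "has_weak_grad S u G"
  shows "norm_L2 S u \<le> norm_H1 S u" "norm_L2 S G \<le> norm_H1 S u"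
  by (rule power2_le_imp_le[OF _ norm_H1_nonneg], simp add: norm_H1_power2[OF assms])+

lemma integral_lebesgue_on_indicator:
  fixes f :: "'a::euclidean_space \<Rightarrow> real"
  assumes "S \<subseteq> T" "S \<in> sets borel" "T \<in> sets borel"
  shows "integral\<^sup>L (lebesgue_on S) f = integral\<^sup>L (lebesgue_on T) (\<lambda>x. indicator S x * f x)"
proof -
  have "S \<in> sets lebesgue" "T \<in> sets lebesgue"
    using assms by auto
  moreover have "(\<lambda>x. indicator T x * (indicator S x * f x)) = (\<lambda>x. indicator S x * f x)"
    using assms(1) by (intro ext) (auto split: split_indicator)
  ultimately show ?thesis
    by (simp add: integral_restrict_space)
qed

lemma integrable_lebesgue_on_indicator:
  fixes f :: "'a::euclidean_space \<Rightarrow> real"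
  assumes "integrable (lebesgue_on T) f" "S \<in> sets borel" "T \<in> sets borel"
  shows "integrable (lebesgue_on T) (\<lambda>x. indicator S x * f x)"
proof (rule Bochner_Integration.integrable_bound[OF assms(1)])
  have "(indicator S :: 'a \<Rightarrow> real) \<in> borel_measurable (lebesgue_on T)"
    using assms(2) by (intro measurable_restrict_space1 measurable_completion) simp
  then show "(\<lambda>x. indicator S x * f x) \<in> borel_measurable (lebesgue_on T)"
    using assms(1) by (intro borel_measurable_times) auto
qed (auto simp: indicator_def)

text \<open>With m = k + 1 the argument of \<open>flat\<close> is m^2 (r^2 - |x|^2) - m. It is
  nonpositive once |x|^2 >= r^2 - 1/m, so each cutoff lives strictly inside the ball, and for |x| <
  r it tends to infinity, where \<open>flat [:1, 1:]\<close> tends to 1.\<close>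

lemma ball_cutoff_limit:
  fixes H :: "'a::euclidean_space \<Rightarrow> real"
  assumes H: "integrable (lebesgue_on S) H" and r: "0 < r" and S: "S \<in> sets borel"
  shows "(\<lambda>k. integral\<^sup>L (lebesgue_on S) (\<lambda>x.
      flat [:1, 1:] ((real (Suc k))\<^sup>2 * r\<^sup>2 - real (Suc k) - (real (Suc k))\<^sup>2 * (norm x)\<^sup>2) * H x)) \<longlonglongrightarrow>
    integral\<^sup>L (lebesgue_on S) (\<lambda>x. indicator (ball 0 r) x * H x)"
proof (rule integral_dominated_convergence[where w="\<lambda>x. norm (H x)"])
  let ?f = "\<lambda>k x::'a. (real (Suc k))\<^sup>2 * r\<^sup>2 - real (Suc k) - (real (Suc k))\<^sup>2 * (norm x)\<^sup>2"
  have fl: "0 \<le> flat [:1, 1:] t" "flat [:1, 1:] t \<le> 1" for t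
    using flat_le_1 by auto
  show "(\<lambda>x. indicator (ball 0 r) x * H x) \<in> borel_measurable (lebesgue_on S)"
    using integrable_lebesgue_on_indicator[OF H _ S, of "ball 0 r"] by auto
  have "smooth (?f k)" for k
    by (intro smooth_diff smooth_cmult smooth_const smooth_norm_power2)
  then have "(\<lambda>x. flat [:1, 1:] (?f k x)) \<in> borel_measurable (lebesgue_on S)" for k
    by (intro continuous_measurable_lebesgue_on smooth_continuous_on smooth_flat)
  then show "(\<lambda>x. flat [:1, 1:] (?f k x) * H x) \<in> borel_measurable (lebesgue_on S)" for k
    using H by (intro borel_measurable_times) auto
  show "AE x in lebesgue_on S. norm (flat [:1, 1:] (?f k x) * H x) \<le> norm (H x)" for k
    using fl by (intro AE_I2) (simp add: abs_mult mult_left_le_one_le)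
  show "AE x in lebesgue_on S. (\<lambda>k. flat [:1, 1:] (?f k x) * H x) \<longlonglongrightarrow> indicator (ball 0 r) x * H x"
  proof (intro AE_I2 tendsto_mult tendsto_const)
    fix x :: 'a
    show "(\<lambda>k. flat [:1, 1:] (?f k x)) \<longlonglongrightarrow> indicator (ball 0 r) x"
    proof (cases "norm x < r")
      case True
      then have "r\<^sup>2 - (norm x)\<^sup>2 > 0"
        using r by (simp add: power_strict_mono)
      moreover define c where "c = r\<^sup>2 - (norm x)\<^sup>2"
      ultimately have "filterlim (\<lambda>k. (real (Suc k))\<^sup>2 * c - real (Suc k)) at_top sequentially"
        by real_asymp
      moreover have "(\<lambda>k. ?f k x) = (\<lambda>k. (real (Suc k))\<^sup>2 * c - real (Suc k))"
        by (auto simp: c_def algebra_simps)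
      ultimately have "(\<lambda>k. flat [:1, 1:] (?f k x)) \<longlonglongrightarrow> 1"
        by (intro filterlim_compose[OF flat_tendsto_1]) auto
      then show ?thesis
        using True by simp
    next
      case False
      have "?f k x \<le> 0" for k
      proof -
        have "r\<^sup>2 \<le> (norm x)\<^sup>2"
          using False r by (intro power_mono) auto
        then have "(real (Suc k))\<^sup>2 * r\<^sup>2 \<le> (real (Suc k))\<^sup>2 * (norm x)\<^sup>2"
          by (intro mult_left_mono) auto
        then show ?thesis
          using of_nat_0_le_iff[of "Suc k", where 'a=real] by linarith
      qed
      then show ?thesis
        using False by (simp add: flat_nonpos)
    qed
  qed
qed (use H in auto)

context coordinate_plane
begin

text \<open>Green's identity with the cutoff \<open>\<Phi>\<close> of \<open>harm w d\<close>: since \<open>grad \<Phi> x\<close> is a multiple of \<open>x\<close>,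
  both sides carry the same weight and the choice of the cutoff is immaterial.\<close>

lemma radial_derivative_cutoff:
  fixes u :: "'a \<Rightarrow> real"
  assumes u: "u \<in> harmonic_H1 (ball 0 1)" and AB: "A < B" "0 < B"
  shows "integral\<^sup>L (lebesgue_on (ball 0 1)) (\<lambda>x. flat [:1, 1:] (A - B * (norm x)\<^sup>2) *
      (harm w d x * (weak_grad (ball 0 1) u x \<bullet> x))) =
    integral\<^sup>L (lebesgue_on (ball 0 1)) (\<lambda>x. flat [:1, 1:] (A - B * (norm x)\<^sup>2) * (d * (u x * harm w d x)))"
proof -
  let ?S = "ball (0::'a) 1" and ?P = "harm w d"
  let ?M = "lebesgue_on ?S"
  note uD = harmonic_H1D[OF u]
  define G where "G = weak_grad ?S u"
  have G: "has_weak_grad ?S u G"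
    using uD by (simp add: G_def)
  define f where "f x = A - B * (norm x)\<^sup>2" for x :: 'a
  \<comment> \<open>This cutoff is chosen for its gradient: the radial weight \<open>\<zeta>\<close>
    in it takes values between 0 and 1, so that it can later converge to the indicator of a
    ball.\<close>
  define \<Phi> where "\<Phi> x = f x * flat 1 (f x)" for x
  define \<zeta> where "\<zeta> x = flat [:1, 1:] (f x)" for x
  have f: "smooth f"
    unfolding f_def by (intro smooth_diff smooth_cmult smooth_const smooth_norm_power2)
  have \<Phi>: "smooth \<Phi>"
    unfolding \<Phi>_def by (intro smooth_mult smooth_flat f)
  have "grad f x = (- 2 * B) *\<^sub>R x" for x
  proof (rule grad_eqI)
    show "(f has_derivative (\<lambda>v. - (B * (2 * (x \<bullet> v))))) (at x)"
      unfolding f_def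
      by (rule has_derivative_eq_rhs, rule has_derivative_diff, rule has_derivative_const,
          rule has_derivative_mult_right, rule smooth_has_derivative[OF smooth_norm_power2])
        (simp add: grad_norm_power2)
  qed simp
  then have grad_\<Phi>: "grad \<Phi> x = (- 2 * B * \<zeta> x) *\<^sub>R x" for x
    unfolding \<Phi>_def \<zeta>_def by (simp add: grad_mult_flat[OF f] mult_ac)
  define K where "K = {x::'a. B * (norm x)\<^sup>2 \<le> A}"
  have "K \<subseteq> ?S"
  proof
    fix x assume "x \<in> K"
    then have "B * (norm x)\<^sup>2 < B * 1"
      using AB(1) unfolding K_def by simp
    then have "(norm x)\<^sup>2 < 1"
      using AB(2) by (rule mult_less_cancel_left_pos[THEN iffD1, rotated])
    then show "x \<in> ?S"
      using abs_square_less_1[of "norm x"] by simp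
  qed
  moreover have "closed K"
    unfolding K_def by (intro closed_Collect_le continuous_intros)
  ultimately have K: "compact K" "K \<subseteq> ?S"
    using bounded_subset[OF bounded_ball] by (auto simp: compact_eq_bounded_closed)
  have out: "\<Phi> x = 0" if "x \<notin> K" for x
    using that by (simp add: \<Phi>_def f_def K_def flat_nonpos)
  \<comment> \<open>Testing the equation for u with P \<Phi> gives two terms. The one with grad P is
    moved onto u by \<open>green_test\<close>; the one with grad \<Phi> is the radial derivative of
    u.\<close>
  have "(\<lambda>x. ?P x * \<Phi> x) \<in> test_functions ?S"
    using out by (intro test_functionsI[OF smooth_mult[OF smooth_harm \<Phi>] K]) simp
  from uD(3)[OF this]
  have "integral\<^sup>L ?M (\<lambda>x. G x \<bullet> (?P x *\<^sub>R grad \<Phi> x) + G x \<bullet> (\<Phi> x *\<^sub>R grad ?P x)) = 0"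
    by (simp only: G_def grad_mult[OF smooth_harm \<Phi>] inner_add_right)
  moreover have "integrable ?M (\<lambda>x. G x \<bullet> (?P x *\<^sub>R grad \<Phi> x))"
    "integrable ?M (\<lambda>x. G x \<bullet> (\<Phi> x *\<^sub>R grad ?P x))"
  proof -
    have "G \<in> L2 ?S"
      using G by (simp add: has_weak_grad_def)
    then show "integrable ?M (\<lambda>x. G x \<bullet> (?P x *\<^sub>R grad \<Phi> x))"
      "integrable ?M (\<lambda>x. G x \<bullet> (\<Phi> x *\<^sub>R grad ?P x))"
      by (rule L2_integrable_inner, intro continuous_L2 continuous_on_scaleR
          smooth_continuous_on smooth_continuous_on_grad smooth_harm \<Phi>; simp)+
  qed
  ultimately have "integral\<^sup>L ?M (\<lambda>x. G x \<bullet> (?P x *\<^sub>R grad \<Phi> x)) =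
      integral\<^sup>L ?M (\<lambda>x. u x * (grad \<Phi> x \<bullet> grad ?P x))"
    using green_test[OF uD(1) G _ _ K out \<Phi>, of w d] by simp
  moreover have "G x \<bullet> (?P x *\<^sub>R grad \<Phi> x) = (- 2 * B) * (\<zeta> x * (?P x * (G x \<bullet> x)))" for x
    by (simp add: grad_\<Phi>)
  moreover have "u x * (grad \<Phi> x \<bullet> grad ?P x) = (- 2 * B) * (\<zeta> x * (d * (u x * ?P x)))" for x
    using euler_harm[of w d x] by (simp add: grad_\<Phi> inner_commute[of x])
  ultimately have "(- 2 * B) * integral\<^sup>L ?M (\<lambda>x. \<zeta> x * (?P x * (G x \<bullet> x))) =
      (- 2 * B) * integral\<^sup>L ?M (\<lambda>x. \<zeta> x * (d * (u x * ?P x)))"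
    by (simp only: integral_mult_right_zero)
  then show ?thesis
    using AB by (simp add: \<zeta>_def G_def f_def)
qed

text \<open>The cutoff identity is passed to the limit in which the weights become the indicator of
  the ball. As each cutoff has compact support inside the ball, no boundary term arises, even for r
  = 1.\<close>

lemma radial_derivative_ball:
  fixes u :: "'a \<Rightarrow> real"
  assumes u: "u \<in> harmonic_H1 (ball 0 1)" and r: "0 < r" "r \<le> 1"
  shows "integral\<^sup>L (lebesgue_on (ball 0 1)) (\<lambda>x. indicator (ball 0 r) x *
      (harm w d x * (weak_grad (ball 0 1) u x \<bullet> x))) =
    integral\<^sup>L (lebesgue_on (ball 0 1)) (\<lambda>x. indicator (ball 0 r) x * (d * (u x * harm w d x)))"
proof -
  let ?S = "ball (0::'a) 1"
  let ?A = "\<lambda>k. (real (Suc k))\<^sup>2 * r\<^sup>2 - real (Suc k)"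
  have "weak_grad ?S u \<in> L2 ?S"
    using harmonic_H1D(2)[OF u] by (simp add: has_weak_grad_def)
  then have "integrable (lebesgue_on ?S) (\<lambda>x. weak_grad ?S u x \<bullet> (harm w d x *\<^sub>R x))"
    by (rule L2_integrable_inner)
      (auto intro!: continuous_L2 continuous_intros smooth_continuous_on smooth_harm)
  then have i1: "integrable (lebesgue_on ?S) (\<lambda>x. harm w d x * (weak_grad ?S u x \<bullet> x))"
    by simp
  have i2: "integrable (lebesgue_on ?S) (\<lambda>x. d * (u x * harm w d x))"
    by (intro integrable_mult_right L2_integrable_mult[OF harmonic_H1D(1)[OF u]] smooth_L2(1) smooth_harm) auto
  \<comment> \<open>The subtracted \<open>real (Suc k)\<close> makes the inequality strict also for
    r = 1.\<close>
  have "?A k < (real (Suc k))\<^sup>2" for k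
  proof -
    have "(real (Suc k))\<^sup>2 * r\<^sup>2 \<le> (real (Suc k))\<^sup>2 * 1"
      using r by (intro mult_left_mono power_le_one) auto
    then show ?thesis
      using of_nat_0_less_iff[of "Suc k", where 'a=real] by linarith
  qed
  then have eq: "integral\<^sup>L (lebesgue_on ?S) (\<lambda>x. flat [:1, 1:] (?A k - (real (Suc k))\<^sup>2 * (norm x)\<^sup>2) *
      (harm w d x * (weak_grad ?S u x \<bullet> x))) =
    integral\<^sup>L (lebesgue_on ?S) (\<lambda>x. flat [:1, 1:] (?A k - (real (Suc k))\<^sup>2 * (norm x)\<^sup>2) *
      (d * (u x * harm w d x)))" for k
    by (intro radial_derivative_cutoff[OF u]) auto
  show ?thesis
    by (rule LIMSEQ_unique[OF ball_cutoff_limit[OF i1 r(1), unfolded eq] ball_cutoff_limit[OF i2 r(1)]]) auto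
qed

text \<open>By \<open>radial_derivative_ball\<close> the integral is unchanged if \<open>\<phi>\<close> is replaced by \<open>\<phi> - u\<close>.\<close>

lemma radial_defect_bound:
  fixes u \<phi> :: "'a \<Rightarrow> real" and w :: complex and d :: nat
  assumes u: "u \<in> harmonic_H1 (ball 0 1)" and \<phi>: "smooth \<phi>" and r: "0 < r" "r \<le> 1"
  defines "\<psi> \<equiv> \<lambda>x. \<phi> x * harm w d x"
  shows "\<bar>\<integral>x. indicator (ball 0 r) x * (grad \<psi> x \<bullet> x - real (2 * d) * \<psi> x) \<partial>lborel\<bar> \<le>
    norm w * (1 + d) * sqrt (measure lebesgue (ball (0::'a) 1)) * norm_H1 (ball 0 1) (\<lambda>x. \<phi> x - u x)"
proof -
  let ?S = "ball (0::'a) 1" and ?P = "harm w d"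
  let ?M = "lebesgue_on ?S" and ?I = "\<lambda>x. indicator (ball 0 r) x :: real"
  note uD = harmonic_H1D[OF u]
  define G where "G = weak_grad ?S u"
  have GL: "G \<in> L2 ?S"
    using uD by (simp add: G_def has_weak_grad_def)
  define \<nu> where "\<nu> = norm_H1 ?S (\<lambda>x. \<phi> x - u x)"
  define D where "D x = grad \<phi> x - G x" for x
  define e where "e x = \<phi> x - u x" for x
  have wg: "has_weak_grad ?S (\<lambda>x. \<phi> x - u x) D"
    unfolding D_def G_def
    by (intro has_weak_grad_diff[OF _ _ smooth_L2(1)[OF \<phi>] has_weak_grad_smooth[OF \<phi>] uD(1,2)]) auto
  have DL: "D \<in> L2 ?S"
    using wg by (simp add: has_weak_grad_def)
  have eL: "e \<in> L2 ?S"
    unfolding e_def[abs_def] by (intro L2_diff[OF smooth_L2(1)[OF \<phi>] uD(1)]) auto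
  have "norm_L2 ?S D \<le> \<nu>" "norm_L2 ?S e \<le> \<nu>"
    using norm_L2_le_norm_H1[OF _ _ wg] by (auto simp: \<nu>_def e_def[abs_def])
  then have le: "integral\<^sup>L ?M (\<lambda>x. norm (D x)) \<le> sqrt (measure lebesgue ?S) * \<nu>"
    "integral\<^sup>L ?M (\<lambda>x. norm (e x)) \<le> sqrt (measure lebesgue ?S) * \<nu>"
    using L1_le_L2(2)[OF _ _ DL] L1_le_L2(2)[OF _ _ eL]
    by (auto intro: order_trans mult_left_mono)
  have int: "integrable ?M (\<lambda>x. ?P x * (G x \<bullet> x))" "integrable ?M (\<lambda>x. ?P x * (grad \<phi> x \<bullet> x))"
    "integrable ?M (\<lambda>x. d * (u x * ?P x))" "integrable ?M (\<lambda>x. d * (\<phi> x * ?P x))"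
  proof -
    have "integrable ?M (\<lambda>x. G x \<bullet> (?P x *\<^sub>R x))" "integrable ?M (\<lambda>x. grad \<phi> x \<bullet> (?P x *\<^sub>R x))"
      by (intro L2_integrable_inner[OF GL] L2_integrable_inner[OF smooth_L2(2)[OF \<phi>]] continuous_L2
          continuous_intros smooth_continuous_on smooth_harm; simp)+
    then show "integrable ?M (\<lambda>x. ?P x * (G x \<bullet> x))" "integrable ?M (\<lambda>x. ?P x * (grad \<phi> x \<bullet> x))"
      by simp_all
    show "integrable ?M (\<lambda>x. d * (u x * ?P x))" "integrable ?M (\<lambda>x. d * (\<phi> x * ?P x))"
      by (intro integrable_mult_right L2_integrable_mult[OF uD(1)]
          L2_integrable_mult[OF smooth_L2(1)[OF \<phi>]] smooth_L2(1) smooth_harm; simp)+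
  qed
  have intI: "integrable ?M (\<lambda>x. ?I x * H x)" if "integrable ?M H" for H :: "'a \<Rightarrow> real"
    using that by (rule integrable_lebesgue_on_indicator) auto
  have zero: "integral\<^sup>L ?M (\<lambda>x. ?I x * (?P x * (G x \<bullet> x)) - ?I x * (d * (u x * ?P x))) = 0"
    using radial_derivative_ball[OF u r, of w d] int[THEN intI] by (simp add: G_def)
  \<comment> \<open>P is homogeneous of degree d, so the product rule uses up half of the factor 2
    d. What remains is the identity of degree d that \<open>radial_derivative_ball\<close> provides
    for u.\<close>
  have "grad \<psi> x \<bullet> x - real (2 * d) * \<psi> x = ?P x * (grad \<phi> x \<bullet> x) - d * (\<phi> x * ?P x)" for x
    unfolding \<psi>_def grad_mult[OF \<phi> smooth_harm]
    using euler_harm[of w d x] by (simp add: inner_add_left algebra_simps)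
  then have "(\<integral>x. ?I x * (grad \<psi> x \<bullet> x - real (2 * d) * \<psi> x) \<partial>lborel) =
      (\<integral>x. indicator ?S x * (?I x * (?P x * (grad \<phi> x \<bullet> x) - d * (\<phi> x * ?P x))) \<partial>lborel)"
    using r by (intro Bochner_Integration.integral_cong) (auto simp: indicator_def)
  also have "\<dots> = integral\<^sup>L ?M (\<lambda>x. ?I x * (?P x * (grad \<phi> x \<bullet> x) - d * (\<phi> x * ?P x)))"
  proof (rule integral_lebesgue_on_borel[symmetric])
    have [measurable]: "grad \<phi> \<in> borel_measurable borel" "\<phi> \<in> borel_measurable borel"
      "?P \<in> borel_measurable borel"
      using \<phi> smooth_harm
      by (auto intro!: borel_measurable_continuous_onI smooth_continuous_on smooth_continuous_on_grad)
    show "(\<lambda>x. ?I x * (?P x * (grad \<phi> x \<bullet> x) - d * (\<phi> x * ?P x))) \<in> borel_measurable borel"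
      by measurable
  qed auto
  also have "\<dots> = integral\<^sup>L ?M (\<lambda>x. ?I x * (?P x * (grad \<phi> x \<bullet> x)) - ?I x * (d * (\<phi> x * ?P x))) -
      integral\<^sup>L ?M (\<lambda>x. ?I x * (?P x * (G x \<bullet> x)) - ?I x * (d * (u x * ?P x)))"
    unfolding zero by (simp add: right_diff_distrib)
  also have "\<dots> = integral\<^sup>L ?M (\<lambda>x. ?I x * (?P x * (grad \<phi> x \<bullet> x)) - ?I x * (d * (\<phi> x * ?P x)) -
      (?I x * (?P x * (G x \<bullet> x)) - ?I x * (d * (u x * ?P x))))"
    using int[THEN intI] by (intro Bochner_Integration.integral_diff[symmetric] Bochner_Integration.integrable_diff)
  also have "\<dots> = integral\<^sup>L ?M (\<lambda>x. ?I x * (?P x * (D x \<bullet> x - d * e x)))"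
    by (simp add: D_def e_def inner_diff_left algebra_simps)
  finally have eq: "(\<integral>x. ?I x * (grad \<psi> x \<bullet> x - real (2 * d) * \<psi> x) \<partial>lborel) =
      integral\<^sup>L ?M (\<lambda>x. ?I x * (?P x * (D x \<bullet> x - d * e x)))" .
  have n1: "integrable ?M (\<lambda>x. norm (D x))" "integrable ?M (\<lambda>x. norm (e x))"
    using L1_le_L2(1)[OF _ _ DL] L1_le_L2(1)[OF _ _ eL] by auto
  have "\<bar>integral\<^sup>L ?M (\<lambda>x. ?I x * (?P x * (D x \<bullet> x - d * e x)))\<bar> \<le>
      integral\<^sup>L ?M (\<lambda>x. norm w * (norm (D x) + d * norm (e x)))"
  proof (rule integral_abs_bound_integral)
    have "integrable ?M (\<lambda>x. ?P x * (grad \<phi> x \<bullet> x) - d * (\<phi> x * ?P x) -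
        (?P x * (G x \<bullet> x) - d * (u x * ?P x)))"
      using int by (intro Bochner_Integration.integrable_diff)
    then have "integrable ?M (\<lambda>x. ?P x * (D x \<bullet> x - d * e x))"
      by (simp add: D_def e_def inner_diff_left algebra_simps)
    then show "integrable ?M (\<lambda>x. ?I x * (?P x * (D x \<bullet> x - d * e x)))"
      by (rule intI)
    show "integrable ?M (\<lambda>x. norm w * (norm (D x) + d * norm (e x)))"
      using n1 by simp
    fix x assume "x \<in> space ?M"
    then have x: "norm x \<le> 1"
      by (simp add: space_restrict_space)
    have "\<bar>D x \<bullet> x\<bar> \<le> norm (D x) * 1"
      using Cauchy_Schwarz_ineq2[of "D x" x] x by (meson mult_left_mono norm_ge_zero order_trans)
    then have "\<bar>D x \<bullet> x - d * e x\<bar> \<le> norm (D x) + d * norm (e x)"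
      using abs_triangle_ineq4[of "D x \<bullet> x" "d * e x"] by (simp add: abs_mult)
    then have "\<bar>?P x\<bar> * \<bar>D x \<bullet> x - d * e x\<bar> \<le> norm w * (norm (D x) + d * norm (e x))"
      using abs_harm_le[OF x] by (intro mult_mono) auto
    moreover have "0 \<le> norm w * (norm (D x) + d * norm (e x))"
      by simp
    ultimately show "\<bar>?I x * (?P x * (D x \<bullet> x - d * e x))\<bar> \<le> norm w * (norm (D x) + d * norm (e x))"
      by (auto simp: abs_mult indicator_def)
  qed
  also have "\<dots> = norm w * (integral\<^sup>L ?M (\<lambda>x. norm (D x)) + d * integral\<^sup>L ?M (\<lambda>x. norm (e x)))"
    using n1 by simp
  also have "\<dots> \<le> norm w * (sqrt (measure lebesgue ?S) * \<nu> + d * (sqrt (measure lebesgue ?S) * \<nu>))"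
    using le by (intro mult_left_mono add_mono) auto
  also have "\<dots> = norm w * (1 + d) * sqrt (measure lebesgue ?S) * \<nu>"
    by (simp add: algebra_simps)
  finally show ?thesis
    unfolding eq \<nu>_def .
qed

text \<open>The divergence theorem writes the sphere integral of \<psi> = \<phi> P as n times its
  ball integral plus the Euler defect of degree 2 d, and \<open>integral_half_ball_growth\<close>
  replaces the unit ball by the half ball. The constant in front of the H^1 distance does not
  involve \<phi>, so a limit along approximants is possible.\<close>

lemma sphere_integral_approx:
  fixes u \<phi> :: "'a \<Rightarrow> real" and w :: complex and d :: nat
  assumes u: "u \<in> harmonic_H1 (ball 0 1)" and \<phi>: "smooth \<phi>"
  defines "n \<equiv> DIM('a) + 2 * d"
  shows "\<bar>(\<integral>x. \<phi> x * harm w d x \<partial>sphere_measure) -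
      real n * 2 ^ n * integral\<^sup>L (lebesgue_on (ball 0 (1/2))) (\<lambda>x. \<phi> x * harm w d x)\<bar> \<le>
    (1 + n * 2 ^ (n + 1)) * (norm w * (1 + d) * sqrt (measure lebesgue (ball (0::'a) 1))) *
      norm_H1 (ball 0 1) (\<lambda>x. \<phi> x - u x)"
proof -
  define \<psi> where "\<psi> x = \<phi> x * harm w d x" for x
  define \<epsilon> where "\<epsilon> = norm w * (1 + d) * sqrt (measure lebesgue (ball (0::'a) 1)) *
      norm_H1 (ball 0 1) (\<lambda>x. \<phi> x - u x)"
  define T where "T = (\<integral>x. indicator (ball 0 1) x * (grad \<psi> x \<bullet> x - real (2 * d) * \<psi> x) \<partial>lborel)"
  define E where "E r = (\<integral>x. indicator (ball 0 r) x * \<psi> x \<partial>lborel)" for r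
  have \<psi>: "smooth \<psi>"
    unfolding \<psi>_def by (intro smooth_mult \<phi> smooth_harm)
  have defect: "\<bar>\<integral>x. indicator (ball 0 r) x * (grad \<psi> x \<bullet> x - real (2 * d) * \<psi> x) \<partial>lborel\<bar> \<le> \<epsilon>"
    if "0 < r" "r \<le> 1" for r
    using radial_defect_bound[OF u \<phi> that, where w=w and d=d] by (simp add: \<psi>_def[abs_def] \<epsilon>_def)
  have growth: "\<bar>E 1 - 2 ^ n * E (1/2)\<bar> \<le> 2 ^ (n + 1) * \<epsilon>"
    using integral_half_ball_growth[OF \<psi> defect] by (simp add: E_def n_def)
  have int: "integrable lborel (\<lambda>x. indicator (ball 0 1) x * (grad \<psi> x \<bullet> x - real (2 * d) * \<psi> x))"
    "integrable lborel (\<lambda>x. n * (indicator (ball 0 1) x * \<psi> x))"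
    by (intro integrable_mult_right integrable_indicator_bounded continuous_intros
        smooth_continuous_on smooth_continuous_on_grad \<psi>; simp)+
  have "integral\<^sup>L sphere_measure \<psi> = (\<integral>x. indicator (ball 0 1) x * (grad \<psi> x \<bullet> x - real (2 * d) * \<psi> x) +
      n * (indicator (ball 0 1) x * \<psi> x) \<partial>lborel)"
    unfolding integral_sphere_measure_smooth[OF \<psi>] by (simp add: n_def algebra_simps)
  also have "\<dots> = T + n * E 1"
    using int by (simp add: T_def E_def)
  finally have "integral\<^sup>L sphere_measure \<psi> - real n * 2 ^ n * E (1/2) = T + n * (E 1 - 2 ^ n * E (1/2))"
    by (simp add: algebra_simps)
  also have "\<bar>\<dots>\<bar> \<le> \<bar>T\<bar> + n * \<bar>E 1 - 2 ^ n * E (1/2)\<bar>"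
    using abs_triangle_ineq[of T "n * (E 1 - 2 ^ n * E (1/2))"] by (simp add: abs_mult)
  also have "\<dots> \<le> \<epsilon> + n * (2 ^ (n + 1) * \<epsilon>)"
    using defect[of 1] growth by (intro add_mono mult_left_mono) (auto simp: T_def)
  finally have "\<bar>integral\<^sup>L sphere_measure \<psi> - real n * 2 ^ n * E (1/2)\<bar> \<le> (1 + n * 2 ^ (n + 1)) * \<epsilon>"
    by (simp add: algebra_simps)
  moreover have "E (1/2) = integral\<^sup>L (lebesgue_on (ball 0 (1/2))) \<psi>"
    unfolding E_def using \<psi> by (intro integral_lebesgue_on_borel[symmetric] smooth_borel_measurable) auto
  ultimately show ?thesis
    by (simp add: \<psi>_def[abs_def] \<epsilon>_def mult_ac)
qed

text \<open>Limit of \<open>sphere_integral_approx\<close> along the functions defining the trace: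
  the sphere side converges by L^2 convergence on the sphere, the half ball side by H^1 convergence,
  and the error tends to zero.\<close>

lemma sphere_trace_integral:
  fixes u g :: "'a \<Rightarrow> real" and w :: complex and d :: nat
  assumes u: "u \<in> harmonic_H1 (ball 0 1)" and g: "has_sphere_trace u g"
  defines "n \<equiv> DIM('a) + 2 * d"
  shows "integrable sphere_measure (\<lambda>x. (g x)\<^sup>2)"
    and "(\<integral>x. g x * harm w d x \<partial>sphere_measure) =
      real n * 2 ^ n * integral\<^sup>L (lebesgue_on (ball 0 (1/2))) (\<lambda>x. u x * harm w d x)"
proof -
  let ?S = "ball (0::'a) 1" and ?H = "ball (0::'a) (1/2)" and ?P = "harm w d"
  obtain \<phi> :: "nat \<Rightarrow> 'a \<Rightarrow> real" where \<phi>: "\<And>k. smooth (\<phi> k)"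
    and lim_H1: "(\<lambda>k. norm_H1 ?S (\<lambda>x. \<phi> k x - u x)) \<longlonglongrightarrow> 0"
    and lim_S: "(\<lambda>k. \<integral>\<^sup>+x. ennreal ((\<phi> k x - g x)\<^sup>2) \<partial>sphere_measure) \<longlonglongrightarrow> 0"
    using g by (auto simp: has_sphere_trace_def)
  have [measurable]: "g \<in> borel_measurable borel"
    using g by (simp add: has_sphere_trace_def)
  have [measurable]: "\<phi> k \<in> borel_measurable borel" "?P \<in> borel_measurable borel" for k
    using \<phi> smooth_harm smooth_borel_measurable by blast+
  note uD = harmonic_H1D[OF u]
  define \<nu> where "\<nu> k = norm_H1 ?S (\<lambda>x. \<phi> k x - u x)" for k
  have \<nu>: "\<nu> \<longlonglongrightarrow> 0"
    using lim_H1 by (simp add: \<nu>_def[abs_def])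
  have P2: "integrable sphere_measure (\<lambda>x. (?P x)\<^sup>2)" "integrable sphere_measure (\<lambda>x. (\<phi> k x)\<^sup>2)" for k
    by (intro integrable_sphere_measure_continuous continuous_on_power smooth_continuous_on smooth_harm \<phi>)+
  \<comment> \<open>Convergence of the extended integrals to 0 makes them finite from some index on;
    only then do Bochner integrals and Cauchy-Schwarz apply.\<close>
  have "\<forall>\<^sub>F k in sequentially. (\<integral>\<^sup>+x. ennreal ((\<phi> k x - g x)\<^sup>2) \<partial>sphere_measure) < 1"
    using lim_S by (rule order_tendstoD) simp
  then have fin: "\<forall>\<^sub>F k in sequentially. integrable sphere_measure (\<lambda>x. (\<phi> k x - g x)\<^sup>2)"
    by eventually_elim
      (auto simp: integrable_iff_bounded less_top[symmetric] dest: order.strict_trans[OF _ ennreal_one_less_top])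
  then obtain k where k: "integrable sphere_measure (\<lambda>x. (\<phi> k x - g x)\<^sup>2)"
    by (auto simp: eventually_sequentially)
  have "integrable sphere_measure (\<lambda>x. 2 * (\<phi> k x)\<^sup>2 + 2 * (\<phi> k x - g x)\<^sup>2)"
    using k P2 by simp
  then show g2: "integrable sphere_measure (\<lambda>x. (g x)\<^sup>2)"
  proof (rule Bochner_Integration.integrable_bound)
    \<comment> \<open>The right side exceeds the left by (2 z - y)^2.\<close>
    have "y\<^sup>2 \<le> 2 * z\<^sup>2 + 2 * (z - y)\<^sup>2" for y z :: real
      using zero_le_power2[of "2 * z - y"] by (simp add: power2_eq_square algebra_simps)
    then show "AE x in sphere_measure. norm ((g x)\<^sup>2) \<le> norm (2 * (\<phi> k x)\<^sup>2 + 2 * (\<phi> k x - g x)\<^sup>2)"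
      by simp
  qed measurable
  define X where "X k = (\<integral>x. \<phi> k x * ?P x \<partial>sphere_measure)" for k
  define Y where "Y k = integral\<^sup>L (lebesgue_on ?H) (\<lambda>x. \<phi> k x * ?P x)" for k
  have X: "X \<longlonglongrightarrow> (\<integral>x. g x * ?P x \<partial>sphere_measure)"
  proof (rule LIM_zero_cancel, rule Lim_null_comparison)
    define q where "q = (\<integral>x. (?P x)\<^sup>2 \<partial>sphere_measure)"
    show "\<forall>\<^sub>F k in sequentially. norm (X k - (\<integral>x. g x * ?P x \<partial>sphere_measure)) \<le>
        sqrt (enn2real (\<integral>\<^sup>+x. ennreal ((\<phi> k x - g x)\<^sup>2) \<partial>sphere_measure) * q)"
      using fin
    proof eventually_elim
      case (elim k)
      have "X k - (\<integral>x. g x * ?P x \<partial>sphere_measure) = (\<integral>x. (\<phi> k x - g x) * ?P x \<partial>sphere_measure)"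
        unfolding X_def left_diff_distrib
        by (rule Bochner_Integration.integral_diff[symmetric]; rule integrable_mult_L2) (use P2 g2 in measurable)
      moreover have "(\<integral>x. (\<phi> k x - g x) * ?P x \<partial>sphere_measure)\<^sup>2 \<le>
          (\<integral>x. (\<phi> k x - g x)\<^sup>2 \<partial>sphere_measure) * q"
        unfolding q_def by (rule Cauchy_Schwarz_L2[OF _ _ elim P2(1)]) measurable
      moreover have "(\<integral>x. (\<phi> k x - g x)\<^sup>2 \<partial>sphere_measure) =
          enn2real (\<integral>\<^sup>+x. ennreal ((\<phi> k x - g x)\<^sup>2) \<partial>sphere_measure)"
        by (rule integral_eq_nn_integral) auto
      ultimately show ?case
        by (auto intro: real_le_rsqrt)
    qed
    have "(\<lambda>k. enn2real (\<integral>\<^sup>+x. ennreal ((\<phi> k x - g x)\<^sup>2) \<partial>sphere_measure)) \<longlonglongrightarrow> enn2real 0"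
      using lim_S by (intro tendsto_enn2real) auto
    from tendsto_real_sqrt[OF tendsto_mult_right[OF this, of q]]
    show "(\<lambda>k. sqrt (enn2real (\<integral>\<^sup>+x. ennreal ((\<phi> k x - g x)\<^sup>2) \<partial>sphere_measure) * q)) \<longlonglongrightarrow> 0"
      by simp
  qed
  have Y: "Y \<longlonglongrightarrow> integral\<^sup>L (lebesgue_on ?H) (\<lambda>x. u x * ?P x)"
  proof (rule LIM_zero_cancel, rule Lim_null_comparison)
    show "\<forall>\<^sub>F k in sequentially. norm (Y k - integral\<^sup>L (lebesgue_on ?H) (\<lambda>x. u x * ?P x)) \<le>
        norm w * (sqrt (measure lebesgue ?S) * \<nu> k)"
    proof (rule always_eventually, rule allI)
      fix k
      have eL: "(\<lambda>x. \<phi> k x - u x) \<in> L2 ?S"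
        by (intro L2_diff[OF smooth_L2(1)[OF \<phi>] uD(1)]) auto
      have wg: "has_weak_grad ?S (\<lambda>x. \<phi> k x - u x) (\<lambda>x. grad (\<phi> k) x - weak_grad ?S u x)"
        by (intro has_weak_grad_diff[OF _ _ smooth_L2(1)[OF \<phi>] has_weak_grad_smooth[OF \<phi>] uD(1,2)]) auto
      have i: "integrable (lebesgue_on ?S) (\<lambda>x. indicator ?H x * (\<phi> k x * ?P x))"
        "integrable (lebesgue_on ?S) (\<lambda>x. indicator ?H x * (u x * ?P x))"
        by (intro integrable_lebesgue_on_indicator L2_integrable_mult[OF uD(1)]
            L2_integrable_mult[OF smooth_L2(1)[OF \<phi>]] smooth_L2(1) smooth_harm; simp)+
      have "Y k - integral\<^sup>L (lebesgue_on ?H) (\<lambda>x. u x * ?P x) =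
          integral\<^sup>L (lebesgue_on ?S) (\<lambda>x. indicator ?H x * (\<phi> k x * ?P x)) -
          integral\<^sup>L (lebesgue_on ?S) (\<lambda>x. indicator ?H x * (u x * ?P x))"
        unfolding Y_def by (subst (1 2) integral_lebesgue_on_indicator[where T="?S"]) auto
      also have "\<dots> = integral\<^sup>L (lebesgue_on ?S) (\<lambda>x. indicator ?H x * (\<phi> k x * ?P x) - indicator ?H x * (u x * ?P x))"
        using i by simp
      also have "\<bar>\<dots>\<bar> \<le> integral\<^sup>L (lebesgue_on ?S) (\<lambda>x. norm w * norm (\<phi> k x - u x))"
      proof (rule integral_abs_bound_integral)
        show "integrable (lebesgue_on ?S) (\<lambda>x. norm w * norm (\<phi> k x - u x))"
          using L1_le_L2(1)[OF _ _ eL] by simp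
        fix x assume "x \<in> space (lebesgue_on ?S)"
        then have "\<bar>?P x\<bar> \<le> norm w"
          by (intro abs_harm_le) (simp add: space_restrict_space)
        then have "\<bar>(\<phi> k x - u x) * ?P x\<bar> \<le> norm w * norm (\<phi> k x - u x)"
          unfolding abs_mult by (subst mult.commute) (intro mult_mono, auto)
        moreover have "0 \<le> norm w * norm (\<phi> k x - u x)"
          by simp
        ultimately show "\<bar>indicator ?H x * (\<phi> k x * ?P x) - indicator ?H x * (u x * ?P x)\<bar> \<le>
            norm w * norm (\<phi> k x - u x)"
          by (auto simp: indicator_def left_diff_distrib)
      qed (use i in auto)
      also have "\<dots> \<le> norm w * (sqrt (measure lebesgue ?S) * norm_L2 ?S (\<lambda>x. \<phi> k x - u x))"
        using L1_le_L2(2)[OF _ _ eL] by (auto intro!: mult_left_mono)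
      also have "\<dots> \<le> norm w * (sqrt (measure lebesgue ?S) * \<nu> k)"
        using norm_L2_le_norm_H1(1)[OF _ _ wg] by (intro mult_left_mono) (auto simp: \<nu>_def)
      finally show "norm (Y k - integral\<^sup>L (lebesgue_on ?H) (\<lambda>x. u x * ?P x)) \<le>
          norm w * (sqrt (measure lebesgue ?S) * \<nu> k)"
        by simp
    qed
    show "(\<lambda>k. norm w * (sqrt (measure lebesgue ?S) * \<nu> k)) \<longlonglongrightarrow> 0"
      using tendsto_mult_left[OF tendsto_mult_left[OF \<nu>]] by auto
  qed
  define C where "C = (1 + n * 2 ^ (n + 1)) * (norm w * (1 + d) * sqrt (measure lebesgue ?S))"
  have "(\<lambda>k. X k - real n * 2 ^ n * Y k) \<longlonglongrightarrow> 0"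
  proof (rule Lim_null_comparison)
    show "\<forall>\<^sub>F k in sequentially. norm (X k - real n * 2 ^ n * Y k) \<le> C * \<nu> k"
      using sphere_integral_approx[OF u \<phi>, where w=w and d=d]
      by (intro always_eventually allI) (simp add: C_def X_def Y_def \<nu>_def n_def)
    show "(\<lambda>k. C * \<nu> k) \<longlonglongrightarrow> 0"
      using tendsto_mult_left[OF \<nu>, of C] by simp
  qed
  from LIMSEQ_unique[OF this tendsto_diff[OF X tendsto_mult_left[OF Y, of "real n * 2 ^ n"]]]
  show "(\<integral>x. g x * harm w d x \<partial>sphere_measure) =
      real n * 2 ^ n * integral\<^sup>L (lebesgue_on (ball 0 (1/2))) (\<lambda>x. u x * harm w d x)"
    by simp
qed

end

subsection \<open>Norms of the harmonic polynomials on the half ball\<close>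

text \<open>The Euler identity holds pointwise here, so the growth estimate applies with error 0 and
  becomes an equality.\<close>

lemma integral_sphere_measure_homogeneous:
  fixes \<psi> :: "'a::euclidean_space \<Rightarrow> real"
  assumes \<psi>: "smooth \<psi>" and euler: "\<And>x. grad \<psi> x \<bullet> x = real k * \<psi> x"
  defines "n \<equiv> DIM('a) + k"
  shows "integral\<^sup>L sphere_measure \<psi> = real n * 2 ^ n * integral\<^sup>L (lebesgue_on (ball 0 (1/2))) \<psi>"
proof -
  have "integral\<^sup>L sphere_measure \<psi> = (\<integral>x. n * (indicator (ball 0 1) x * \<psi> x) \<partial>lborel)"
    unfolding integral_sphere_measure_smooth[OF \<psi>] euler by (simp add: n_def algebra_simps)
  also have "\<dots> = n * (\<integral>x. indicator (ball 0 1) x * \<psi> x \<partial>lborel)"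
    by simp
  also have "(\<integral>x. indicator (ball 0 1) x * \<psi> x \<partial>lborel) =
      2 ^ n * (\<integral>x. indicator (ball 0 (1/2)) x * \<psi> x \<partial>lborel)"
    using integral_half_ball_growth[OF \<psi>, of k 0] euler by (simp add: n_def)
  also have "(\<integral>x. indicator (ball 0 (1/2)) x * \<psi> x \<partial>lborel) = integral\<^sup>L (lebesgue_on (ball 0 (1/2))) \<psi>"
    using \<psi> by (intro integral_lebesgue_on_borel[symmetric] smooth_borel_measurable) auto
  finally show ?thesis
    by simp
qed

context coordinate_plane
begin

lemma continuous_on_plane: "continuous_on S plane"
  unfolding plane_def[abs_def] by (intro continuous_intros)

text \<open>The square of P is homogeneous of degree 2 d. The factor is the same as in
  \<open>sphere_trace_integral\<close>, so one copy of it cancels in the final Cauchy-Schwarz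
  estimate.\<close>

lemma integral_sphere_harm_power2:
  fixes w :: complex and d :: nat
  defines "n \<equiv> DIM('a) + 2 * d"
  shows "(\<integral>x. (harm w d x)\<^sup>2 \<partial>sphere_measure) = real n * 2 ^ n * (norm_L2 (ball 0 (1/2)) (harm w d))\<^sup>2"
proof -
  have "grad (\<lambda>x. harm w d x * harm w d x) x \<bullet> x = real (2 * d) * (harm w d x * harm w d x)" for x
    unfolding grad_mult[OF smooth_harm smooth_harm]
    using euler_harm[of w d x] by (simp add: inner_add_left)
  from integral_sphere_measure_homogeneous[OF smooth_mult[OF smooth_harm smooth_harm] this]
  show ?thesis
    unfolding norm_L2_power2 by (simp add: n_def power2_eq_square)
qed

text \<open>Green's identity for the constant 1, with weak gradient 0, says that grad \<phi> . grad
  P integrates to zero for every test function \<phi>.\<close>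

lemma harm_in_harmonic_H1:
  assumes S: "bounded S" "open S"
  shows "harm w d \<in> harmonic_H1 S"
proof -
  have Sb: "S \<in> sets borel"
    using S by auto
  have wg: "has_weak_grad S (harm w d) (grad (harm w d))"
    by (rule has_weak_grad_smooth[OF smooth_harm S(1) Sb])
  have 1: "has_weak_grad S (\<lambda>x. 1) (\<lambda>x. 0)"
  proof -
    have "grad (\<lambda>x::'a. 1) = (\<lambda>x. 0)"
      by (rule ext, rule grad_eqI[OF _ has_derivative_const]) simp
    then show ?thesis
      using has_weak_grad_smooth[OF smooth_const[of 1] S(1) Sb] by simp
  qed
  have "integral\<^sup>L (lebesgue_on S) (\<lambda>x. weak_grad S (harm w d) x \<bullet> grad \<phi> x) = 0"
    if \<phi>: "\<phi> \<in> test_functions S" for \<phi>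
  proof -
    note \<phi>D = test_functionsD[OF \<phi>]
    have supp: "closure {x. \<phi> x \<noteq> 0} \<subseteq> S"
      using \<phi> by (simp add: test_functions_def)
    have out: "\<phi> x = 0" if "x \<notin> closure {x. \<phi> x \<noteq> 0}" for x
      using that closure_subset[of "{x. \<phi> x \<noteq> 0}"] by blast
    have "integral\<^sup>L (lebesgue_on S) (\<lambda>x. grad \<phi> x \<bullet> grad (harm w d) x) = 0"
      using green_test[OF smooth_L2(1)[OF smooth_const[of 1] S(1) Sb] 1 S(1) Sb \<phi>D(2) supp out \<phi>D(1), of w d]
      by simp
    moreover have "integral\<^sup>L (lebesgue_on S) (\<lambda>x. weak_grad S (harm w d) x \<bullet> grad \<phi> x) =
        integral\<^sup>L (lebesgue_on S) (\<lambda>x. grad \<phi> x \<bullet> grad (harm w d) x)"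
    proof (rule integral_cong_AE)
      show "AE x in lebesgue_on S. weak_grad S (harm w d) x \<bullet> grad \<phi> x = grad \<phi> x \<bullet> grad (harm w d) x"
        using has_weak_grad_unique[OF S has_weak_grad_weak_grad[OF wg] wg]
        by eventually_elim (simp add: inner_commute)
      have "weak_grad S (harm w d) \<in> L2 S" "grad \<phi> \<in> L2 S" "grad (harm w d) \<in> L2 S"
        using has_weak_grad_weak_grad[OF wg, unfolded has_weak_grad_def] wg[unfolded has_weak_grad_def]
          smooth_L2(2)[OF \<phi>D(1) S(1) Sb] by blast+
      then have "weak_grad S (harm w d) \<in> borel_measurable (lebesgue_on S)"
        "grad \<phi> \<in> borel_measurable (lebesgue_on S)" "grad (harm w d) \<in> borel_measurable (lebesgue_on S)"
        by (simp_all add: L2_def)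
      then show "(\<lambda>x. weak_grad S (harm w d) x \<bullet> grad \<phi> x) \<in> borel_measurable (lebesgue_on S)"
        "(\<lambda>x. grad \<phi> x \<bullet> grad (harm w d) x) \<in> borel_measurable (lebesgue_on S)"
        by (auto intro: borel_measurable_inner)
    qed
    ultimately show ?thesis
      by simp
  qed
  then show ?thesis
    using smooth_L2(1)[OF smooth_harm S(1) Sb] wg by (auto simp: harmonic_H1_def H1_def)
qed

text \<open>Splitting the ball at \<open>norm (plane x) = 1/4\<close>: where \<open>plane x\<close> is larger, the
  integrands are comparable; the rest is controlled by the complement.\<close>

lemma plane_power_ratio:
  obtains K where "K > 0" "\<And>d. d > 0 \<Longrightarrow>
    integral\<^sup>L (lebesgue_on (ball 0 (1/2))) (\<lambda>x. norm (plane x) ^ (2 * (d - 1))) \<le>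
    K * integral\<^sup>L (lebesgue_on (ball 0 (1/2))) (\<lambda>x. norm (plane x) ^ (2 * d))"
    "\<And>d. integral\<^sup>L (lebesgue_on (ball 0 (1/2))) (\<lambda>x. norm (plane x) ^ (2 * d)) > 0"
proof -
  let ?H = "ball (0::'a) (1/2)"
  define A where "A = {x \<in> ?H. norm (plane x) > 1/4}"
  define V where "V = measure lebesgue ?H"
  define \<alpha> where "\<alpha> = measure lebesgue A"
  define J where "J k = integral\<^sup>L (lebesgue_on ?H) (\<lambda>x. norm (plane x) ^ k)" for k
  have "open (ball 0 (1/2) \<inter> {x. norm (plane x) > 1/4})"
    by (intro open_Int open_ball open_Collect_less continuous_intros continuous_on_plane)
  also have "ball 0 (1/2) \<inter> {x. norm (plane x) > 1/4} = A"
    by (auto simp: A_def)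
  finally have A: "open A" .
  then have A_sets: "A \<in> sets lebesgue" "A \<subseteq> ?H" "A \<in> sets borel"
    by (auto simp: A_def)
  \<comment> \<open>The value 3/8 lies between 1/4 and 1/2, so this point is in the open set
    \<open>A\<close>, which therefore has positive measure.\<close>
  have "plane ((3/8::real) *\<^sub>R a) = complex_of_real (3/8)"
    using ab by (simp add: plane_def inner_Basis)
  then have "norm (plane ((3/8::real) *\<^sub>R a)) = 3/8"
    by (simp only: norm_of_real)
  moreover have "norm ((3/8::real) *\<^sub>R a) = 3/8"
    using ab by simp
  ultimately have "(3/8) *\<^sub>R a \<in> A"
    by (simp add: A_def)
  moreover have A_lm: "A \<in> lmeasurable"
    using A A_sets by (intro lmeasurable_open bounded_subset[OF bounded_ball]) auto
  ultimately have \<alpha>: "\<alpha> > 0"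
  proof -
    obtain e where e: "e > 0" "ball ((3/8) *\<^sub>R a) e \<subseteq> A"
      using A \<open>(3/8) *\<^sub>R a \<in> A\<close> open_contains_ball by blast
    have "0 < measure lebesgue (ball ((3/8) *\<^sub>R a) e)"
      using content_ball_pos[OF e(1)] by (simp add: measure_completion)
    also have "\<dots> \<le> \<alpha>"
      unfolding \<alpha>_def by (rule measure_mono_fmeasurable[OF e(2) _ A_lm]) simp
    finally show ?thesis .
  qed
  have V: "V \<ge> 0"
    by (simp add: V_def)
  have int: "integrable (lebesgue_on ?H) (\<lambda>x. norm (plane x) ^ k)" for k
    by (intro integrable_lebesgue_on_continuous continuous_intros continuous_on_plane) auto
  have intA: "integrable (lebesgue_on ?H) (indicator A :: 'a \<Rightarrow> real)"
    using integrable_lebesgue_on_indicator[OF integrable_lebesgue_on_continuous[of "\<lambda>x. 1"], of ?H A] A_sets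
    by simp
  have valA: "integral\<^sup>L (lebesgue_on ?H) (indicator A :: 'a \<Rightarrow> real) = \<alpha>"
    using integral_lebesgue_on_indicator[of A ?H "\<lambda>x. 1"] A_sets
    by (simp add: \<alpha>_def measure_restrict_space)
  have J_lower: "(1/4) ^ k * \<alpha> \<le> J k" for k
  proof -
    have "integral\<^sup>L (lebesgue_on ?H) (\<lambda>x. (1/4) ^ k * indicator A x) \<le> J k"
      unfolding J_def
    proof (rule integral_mono[OF _ int])
      show "(1/4) ^ k * indicator A x \<le> norm (plane x) ^ k" for x
        by (auto simp: indicator_def A_def intro!: power_mono)
    qed (use intA in simp)
    then show ?thesis
      using valA by simp
  qed
  have J_pos: "integral\<^sup>L (lebesgue_on ?H) (\<lambda>x. norm (plane x) ^ (2 * d)) > 0" for d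
    using less_le_trans[OF _ J_lower[of "2 * d"]] \<alpha> by (simp add: J_def)
  \<comment> \<open>Where |z| > 1/4, two powers of |z| cost at most the factor 16. Elsewhere the
    integrand is at most (1/4)^(2(d-1)) = 16 (1/4)^(2 d), which contributes at most 16 (V /
    \<alpha>) times the integral of |z|^(2 d), by \<open>J_lower\<close>.\<close>
  have K_pos: "16 * (1 + V / \<alpha>) > 0"
    using V \<alpha> by (simp add: add_pos_nonneg)
  have "integral\<^sup>L (lebesgue_on ?H) (\<lambda>x. norm (plane x) ^ (2 * (d - 1))) \<le>
      16 * (1 + V / \<alpha>) * integral\<^sup>L (lebesgue_on ?H) (\<lambda>x. norm (plane x) ^ (2 * d))"
    if d: "d > 0" for d
  proof -
    have split: "2 * d = Suc (Suc (2 * (d - 1)))"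
      using d by simp
    have "J (2 * (d - 1)) \<le> integral\<^sup>L (lebesgue_on ?H) (\<lambda>x. 16 * norm (plane x) ^ (2 * d) + (1/4) ^ (2 * (d - 1)))"
      unfolding J_def
    proof (rule integral_mono[OF int])
      show "integrable (lebesgue_on ?H) (\<lambda>x. 16 * norm (plane x) ^ (2 * d) + (1/4) ^ (2 * (d - 1)))"
        by (intro integrable_lebesgue_on_continuous continuous_intros continuous_on_plane) auto
      fix x
      show "norm (plane x) ^ (2 * (d - 1)) \<le> 16 * norm (plane x) ^ (2 * d) + (1/4) ^ (2 * (d - 1))"
      proof (cases "norm (plane x) \<le> 1/4")
        case True
        then have "norm (plane x) ^ (2 * (d - 1)) \<le> (1/4) ^ (2 * (d - 1))"
          by (intro power_mono) auto
        then show ?thesis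
          by (intro add_increasing) auto
      next
        case False
        then have "1/4 * (1/4) \<le> norm (plane x) * norm (plane x)"
          by (intro mult_mono) auto
        then have "1 * norm (plane x) ^ (2 * (d - 1)) \<le>
            (16 * (norm (plane x) * norm (plane x))) * norm (plane x) ^ (2 * (d - 1))"
          by (intro mult_right_mono) auto
        also have "\<dots> = 16 * norm (plane x) ^ (2 * d)"
          unfolding split by simp
        finally show ?thesis
          by (intro add_increasing2) auto
      qed
    qed
    also have "\<dots> = 16 * J (2 * d) + (1/4) ^ (2 * (d - 1)) * V"
    proof -
      have "integrable (lebesgue_on ?H) (\<lambda>x. (1/4) ^ (2 * (d - 1)) :: real)"
        by (intro integrable_lebesgue_on_continuous continuous_intros) auto
      then show ?thesis
        using int[of "2 * d"] by (simp add: J_def V_def measure_restrict_space)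
    qed
    also have "\<dots> \<le> 16 * J (2 * d) + 16 * (V / \<alpha>) * J (2 * d)"
    proof -
      have "(1/4) ^ (2 * (d - 1)) * V = 16 * (V / \<alpha>) * ((1/4) ^ (2 * d) * \<alpha>)"
        unfolding split using \<alpha> by simp
      also have "\<dots> \<le> 16 * (V / \<alpha>) * J (2 * d)"
        using J_lower[of "2 * d"] V \<alpha> by (intro mult_left_mono) auto
      finally show ?thesis
        by simp
    qed
    finally show ?thesis
      unfolding J_def by (simp add: algebra_simps)
  qed
  then show thesis
    using that K_pos J_pos by blast
qed

text \<open>The squares of \<open>harm 1 d\<close> and \<open>harm (- \<i>) d\<close> add up to \<open>norm (plane x) ^ (2 * d)\<close>,
  so one of the two carries at least half of the mass.\<close>

lemma norm_L2_grad_harm_le: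
  obtains K where "K > 0"
    "\<And>d. \<exists>w. norm_L2 (ball 0 (1/2)) (harm w d) > 0 \<and>
      (norm_L2 (ball 0 (1/2)) (grad (harm w d)))\<^sup>2 \<le> K * (real d)\<^sup>2 * (norm_L2 (ball 0 (1/2)) (harm w d))\<^sup>2"
proof -
  let ?H = "ball (0::'a) (1/2)"
  obtain K where K: "K > 0" "\<And>d. d > 0 \<Longrightarrow>
      integral\<^sup>L (lebesgue_on ?H) (\<lambda>x. norm (plane x) ^ (2 * (d - 1))) \<le>
      K * integral\<^sup>L (lebesgue_on ?H) (\<lambda>x. norm (plane x) ^ (2 * d))"
    "\<And>d. integral\<^sup>L (lebesgue_on ?H) (\<lambda>x. norm (plane x) ^ (2 * d)) > 0"
    using plane_power_ratio by blast
  \<comment> \<open>The doubled constant pays for keeping only half of the mass; the length of the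
    gradient depends on w only through |w| = 1.\<close>
  have "\<exists>w. norm_L2 ?H (harm w d) > 0 \<and>
      (norm_L2 ?H (grad (harm w d)))\<^sup>2 \<le> 2 * K * (real d)\<^sup>2 * (norm_L2 ?H (harm w d))\<^sup>2" for d
  proof -
    define J where "J = integral\<^sup>L (lebesgue_on ?H) (\<lambda>x. norm (plane x) ^ (2 * d))"
    have int: "integrable (lebesgue_on ?H) (\<lambda>x. (harm w d x)\<^sup>2)" for w
      by (intro integrable_lebesgue_on_continuous continuous_on_power smooth_continuous_on smooth_harm) auto
    have "(harm 1 d x)\<^sup>2 + (harm (- \<i>) d x)\<^sup>2 = norm (plane x) ^ (2 * d)" for x
    proof -
      have "norm (plane x) ^ (2 * d) = (norm (plane x ^ d))\<^sup>2"
        by (simp add: norm_power power_even_eq)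
      then show ?thesis
        by (simp add: harm_def cmod_power2)
    qed
    then have "J = (norm_L2 ?H (harm 1 d))\<^sup>2 + (norm_L2 ?H (harm (- \<i>) d))\<^sup>2"
      unfolding norm_L2_power2 J_def using int by (simp flip: Bochner_Integration.integral_add)
    then obtain w where w: "w = 1 \<or> w = - \<i>" "J \<le> 2 * (norm_L2 ?H (harm w d))\<^sup>2"
      by (cases "(norm_L2 ?H (harm 1 d))\<^sup>2 \<le> (norm_L2 ?H (harm (- \<i>) d))\<^sup>2") force+
    have nw: "norm w = 1"
      using w(1) by auto
    have "J > 0"
      using K(3) by (simp add: J_def)
    then have "norm_L2 ?H (harm w d) \<noteq> 0"
      using w(2) by auto
    moreover have "norm_L2 ?H (harm w d) \<ge> 0"
      by (simp add: norm_L2_def)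
    moreover have "(norm_L2 ?H (grad (harm w d)))\<^sup>2 \<le> 2 * K * (real d)\<^sup>2 * (norm_L2 ?H (harm w d))\<^sup>2"
    proof (cases "d = 0")
      case True
      then show ?thesis
        by (simp add: norm_L2_power2 norm_grad_harm)
    next
      case False
      have "(norm_L2 ?H (grad (harm w d)))\<^sup>2 =
          (real d)\<^sup>2 * integral\<^sup>L (lebesgue_on ?H) (\<lambda>x. norm (plane x) ^ (2 * (d - 1)))"
        unfolding norm_L2_power2 norm_grad_harm nw
        by (simp add: power_mult_distrib power_mult[symmetric] mult.commute)
      also have "\<dots> \<le> (real d)\<^sup>2 * (K * J)"
        using K(2)[of d] False by (intro mult_left_mono) (auto simp: J_def)
      also have "\<dots> \<le> (real d)\<^sup>2 * (K * (2 * (norm_L2 ?H (harm w d))\<^sup>2))"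
        using w(2) K(1) by (intro mult_left_mono) auto
      finally show ?thesis
        by (simp add: mult_ac)
    qed
    ultimately show ?thesis
      by (intro exI[of _ w]) auto
  qed
  then show ?thesis
    using that[of "2 * K"] K(1) by simp
qed

text \<open>Dividing by the H^1 norm only changes w, so the normalised function stays in the family.
  Since the squared norms of function and gradient add up to 1, the gradient bound forces the L^2
  norm to be at least of order 1 / d.\<close>

lemma normalized_harm:
  obtains K where "K > 0"
    "\<And>d. \<exists>w. norm_H1 (ball 0 (1/2)) (harm w d) = 1 \<and>
      1 \<le> (1 + K * (real d)\<^sup>2) * (norm_L2 (ball 0 (1/2)) (harm w d))\<^sup>2"
proof -
  let ?H = "ball (0::'a) (1/2)"
  obtain K where K: "K > 0" "\<And>d. \<exists>w. norm_L2 ?H (harm w d) > 0 \<and>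
      (norm_L2 ?H (grad (harm w d)))\<^sup>2 \<le> K * (real d)\<^sup>2 * (norm_L2 ?H (harm w d))\<^sup>2"
    using norm_L2_grad_harm_le by blast
  have H1: "(norm_H1 ?H (harm w d))\<^sup>2 = (norm_L2 ?H (harm w d))\<^sup>2 + (norm_L2 ?H (grad (harm w d)))\<^sup>2" for w d
    by (intro norm_H1_power2 has_weak_grad_smooth smooth_harm) auto
  have "\<exists>w. norm_H1 ?H (harm w d) = 1 \<and> 1 \<le> (1 + K * (real d)\<^sup>2) * (norm_L2 ?H (harm w d))\<^sup>2" for d
  proof -
    obtain w where w: "norm_L2 ?H (harm w d) > 0"
      "(norm_L2 ?H (grad (harm w d)))\<^sup>2 \<le> K * (real d)\<^sup>2 * (norm_L2 ?H (harm w d))\<^sup>2"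
      using K(2) by blast
    define N where "N = norm_H1 ?H (harm w d)"
    have "N\<^sup>2 > 0"
      unfolding N_def H1 using w(1) by (simp add: add_pos_nonneg)
    then have N: "N > 0"
      using norm_H1_nonneg[of ?H "harm w d"] by (simp add: N_def less_le)
    define v where "v = w / of_real N"
    have "harm v d x = harm w d x / N" for x
      unfolding harm_def v_def by (metis Re_divide_of_real times_divide_eq_left)
    then have L: "(norm_L2 ?H (harm v d))\<^sup>2 = (norm_L2 ?H (harm w d))\<^sup>2 / N\<^sup>2"
      unfolding norm_L2_power2 by (simp add: power_divide)
    have G: "(norm_L2 ?H (grad (harm v d)))\<^sup>2 = (norm_L2 ?H (grad (harm w d)))\<^sup>2 / N\<^sup>2"
      unfolding norm_L2_power2 norm_grad_harm v_def using N
      by (simp add: norm_divide power_divide power_mult_distrib)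
    have "(norm_H1 ?H (harm v d))\<^sup>2 =
        ((norm_L2 ?H (harm w d))\<^sup>2 + (norm_L2 ?H (grad (harm w d)))\<^sup>2) / N\<^sup>2"
      by (simp only: H1[of v d] L G add_divide_distrib)
    also have "\<dots> = N\<^sup>2 / N\<^sup>2"
      by (simp only: N_def H1[of w d])
    finally have "(norm_H1 ?H (harm v d))\<^sup>2 = 1"
      using N by simp
    then have "norm_H1 ?H (harm v d) = 1"
      using norm_H1_nonneg[of ?H "harm v d"] by (simp add: power2_eq_1_iff)
    moreover have "N\<^sup>2 \<le> (1 + K * (real d)\<^sup>2) * (norm_L2 ?H (harm w d))\<^sup>2"
      using w(2) H1[of w d] by (simp add: N_def algebra_simps)
    then have "1 \<le> (1 + K * (real d)\<^sup>2) * (norm_L2 ?H (harm v d))\<^sup>2"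
      unfolding L using N by (simp add: field_simps)
    ultimately show ?thesis
      by blast
  qed
  then show ?thesis
    using that[of K] K(1) by blast
qed

section \<open>Lower bound for the trace on the sphere\<close>

text \<open>Write M = n 2^n with n = DIM + 2 d, and L for the norm of P on the half ball. Closeness
  gives a pairing of at least L^2 / 2 on the half ball, hence at least M L^2 / 2 on the sphere,
  where P has squared norm M L^2. Cauchy-Schwarz leaves M L^2 / 4 as a lower bound for the squared
  norm of g, and M is at least 2^(2 d).\<close>

lemma sphere_norm_lower_bound:
  fixes u g :: "'a \<Rightarrow> real" and w :: complex and d :: nat
  assumes u: "u \<in> harmonic_H1 (ball 0 1)" and g: "has_sphere_trace u g"
    and close: "norm_L2 (ball 0 (1/2)) (\<lambda>x. harm w d x - u x) \<le> norm_L2 (ball 0 (1/2)) (harm w d) / 2"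
  shows "2 ^ d * norm_L2 (ball 0 (1/2)) (harm w d) / 2 \<le> sqrt (\<integral>x. (g x)\<^sup>2 \<partial>sphere_measure)"
proof (cases "norm_L2 (ball 0 (1/2)) (harm w d) = 0")
  case False
  let ?H = "ball (0::'a) (1/2)" and ?S = "ball (0::'a) 1" and ?P = "harm w d"
  define n where "n = DIM('a) + 2 * d"
  define M :: real where "M = real n * 2 ^ n"
  define L where "L = norm_L2 ?H ?P"
  define I where "I = integral\<^sup>L (lebesgue_on ?H) (\<lambda>x. u x * ?P x)"
  define \<gamma> where "\<gamma> = (\<integral>x. (g x)\<^sup>2 \<partial>sphere_measure)"
  have L: "L > 0"
    using False by (simp add: L_def norm_L2_def less_le)
  have n: "n \<ge> 1"
    by (simp add: n_def Suc_leI)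
  have "1 * (2::real) ^ (2 * d) \<le> real n * 2 ^ n"
    using n by (intro mult_mono power_increasing) (auto simp: n_def)
  then have M: "M \<ge> 2 ^ (2 * d)" "M > 0"
    using n by (auto simp: M_def)
  have uL: "u \<in> L2 ?H"
  proof -
    have uS: "u \<in> borel_measurable (lebesgue_on ?S)" "integrable (lebesgue_on ?S) (\<lambda>x. (u x)\<^sup>2)"
      using harmonic_H1D(1)[OF u] by (auto simp: L2_def)
    have sub: "?H \<subseteq> ?S"
      by auto
    have "integrable (lebesgue_on ?H) (\<lambda>x. (u x)\<^sup>2)"
      using integrable_lebesgue_on_indicator[OF uS(2), of ?H] sub
      by (simp add: integrable_restrict_space indicator_inter_arith[symmetric] Int_absorb1 mult.assoc[symmetric]
          del: mult.assoc)
    moreover have "u \<in> borel_measurable (lebesgue_on ?H)"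
      by (rule measurable_restrict_mono[OF uS(1) sub])
    ultimately show ?thesis
      by (simp add: L2_def)
  qed
  have PL: "?P \<in> L2 ?H"
    by (intro smooth_L2(1) smooth_harm) auto
  have dL: "(\<lambda>x. ?P x - u x) \<in> L2 ?H"
    by (rule L2_diff[OF PL uL])
  have "(integral\<^sup>L (lebesgue_on ?H) (\<lambda>x. (?P x - u x) * ?P x))\<^sup>2 \<le> (norm_L2 ?H (\<lambda>x. ?P x - u x))\<^sup>2 * L\<^sup>2"
    unfolding L_def norm_L2_power2 real_norm_def power2_abs
    using dL PL by (intro Cauchy_Schwarz_L2) (auto simp: L2_def)
  also have "\<dots> \<le> (L / 2)\<^sup>2 * L\<^sup>2"
    using close by (intro mult_right_mono power_mono) (auto simp: L_def norm_L2_def)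
  finally have "(integral\<^sup>L (lebesgue_on ?H) (\<lambda>x. (?P x - u x) * ?P x))\<^sup>2 \<le> (L\<^sup>2 / 2)\<^sup>2"
    by (simp add: power2_eq_square field_simps)
  then have "integral\<^sup>L (lebesgue_on ?H) (\<lambda>x. (?P x - u x) * ?P x) \<le> L\<^sup>2 / 2"
    by (rule power2_le_imp_le) simp
  moreover have "integral\<^sup>L (lebesgue_on ?H) (\<lambda>x. (?P x - u x) * ?P x) = L\<^sup>2 - I"
    using L2_integrable_mult[OF uL PL] L2_integrable_mult[OF PL PL]
    unfolding L_def I_def norm_L2_power2 by (simp add: left_diff_distrib power2_eq_square)
  ultimately have I: "I \<ge> L\<^sup>2 / 2"
    by linarith
  have g_int: "integrable sphere_measure (\<lambda>x. (g x)\<^sup>2)"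
    and gP: "(\<integral>x. g x * ?P x \<partial>sphere_measure) = M * I"
    using sphere_trace_integral[OF u g] by (simp_all add: M_def I_def n_def)
  have [measurable]: "g \<in> borel_measurable borel" "?P \<in> borel_measurable borel"
    using g smooth_borel_measurable[OF smooth_harm] by (auto simp: has_sphere_trace_def)
  have P_int: "integrable sphere_measure (\<lambda>x. (?P x)\<^sup>2)"
    by (intro integrable_sphere_measure_continuous continuous_on_power smooth_continuous_on smooth_harm)
  have "(\<integral>x. g x * ?P x \<partial>sphere_measure)\<^sup>2 \<le> \<gamma> * (\<integral>x. (?P x)\<^sup>2 \<partial>sphere_measure)"
    unfolding \<gamma>_def by (rule Cauchy_Schwarz_L2[OF _ _ g_int P_int]) measurable
  then have "(M * I)\<^sup>2 \<le> \<gamma> * (M * L\<^sup>2)"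
    unfolding gP integral_sphere_harm_power2 by (simp add: M_def n_def L_def)
  moreover have "(M * (L\<^sup>2 / 2))\<^sup>2 \<le> (M * I)\<^sup>2"
    using I M by (intro power_mono mult_left_mono) auto
  ultimately have "(M * (L\<^sup>2 / 2))\<^sup>2 \<le> \<gamma> * (M * L\<^sup>2)"
    by linarith
  \<comment> \<open>Written so that the positive common factor M L^2 can be cancelled.\<close>
  moreover have "(M * (L\<^sup>2 / 2))\<^sup>2 = (M * L\<^sup>2 / 4) * (M * L\<^sup>2)"
    by (simp add: power2_eq_square)
  ultimately have "(M * L\<^sup>2 / 4) * (M * L\<^sup>2) \<le> \<gamma> * (M * L\<^sup>2)"
    by linarith
  moreover have "M * L\<^sup>2 > 0"
    using M(2) L by simp
  ultimately have "M * L\<^sup>2 / 4 \<le> \<gamma>"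
    by (rule mult_right_le_imp_le)
  moreover have "(2 ^ d * L / 2)\<^sup>2 \<le> M * L\<^sup>2 / 4"
  proof -
    have "(2 ^ d * L / 2)\<^sup>2 = 2 ^ (2 * d) * L\<^sup>2 / 4"
      by (simp add: power_mult_distrib power_divide power_mult[symmetric] mult.commute)
    also have "\<dots> \<le> M * L\<^sup>2 / 4"
      using M(1) by (intro divide_right_mono mult_right_mono) auto
    finally show ?thesis .
  qed
  ultimately have "(2 ^ d * L / 2)\<^sup>2 \<le> \<gamma>"
    by linarith
  then show ?thesis
    unfolding \<gamma>_def[symmetric] L_def[symmetric] by (rule real_le_rsqrt)
qed (simp add: integral_nonneg_AE)

end

section \<open>From the L^2 norm to the H^(1/2) norm, and the choice of constants\<close>

text \<open>The double integral in the norm is nonnegative and can only enlarge it; if the sum is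
  infinite, so is the norm and the bound is immediate.\<close>

lemma norm_H_half_sphere_ge:
  fixes g :: "'a::euclidean_space \<Rightarrow> real"
  assumes "integrable sphere_measure (\<lambda>x. (g x)\<^sup>2)"
  shows "norm_H_half_sphere g \<ge> ennreal (sqrt (\<integral>x. (g x)\<^sup>2 \<partial>sphere_measure))"
proof -
  define X where "X = (\<integral>\<^sup>+x. ennreal ((g x)\<^sup>2) \<partial>sphere_measure) +
     (\<integral>\<^sup>+x. (\<integral>\<^sup>+y. ennreal ((g x - g y)\<^sup>2 / norm (x - y) ^ DIM('a)) \<partial>sphere_measure) \<partial>sphere_measure)"
  have "(\<integral>\<^sup>+x. ennreal ((g x)\<^sup>2) \<partial>sphere_measure) = ennreal (\<integral>x. (g x)\<^sup>2 \<partial>sphere_measure)"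
    by (rule nn_integral_eq_integral[OF assms]) simp
  then have X: "ennreal (\<integral>x. (g x)\<^sup>2 \<partial>sphere_measure) \<le> X"
    by (simp add: X_def)
  have "ennreal (sqrt (\<integral>x. (g x)\<^sup>2 \<partial>sphere_measure)) \<le> sqrt_ennreal X"
  proof (cases "X = \<infinity>")
    case False
    then have "(\<integral>x. (g x)\<^sup>2 \<partial>sphere_measure) \<le> enn2real X"
      using enn2real_mono[OF X] by (simp add: less_top integral_nonneg_AE)
    then show ?thesis
      using False by (simp add: sqrt_ennreal_def ennreal_leI)
  qed (simp add: sqrt_ennreal_def)
  then show ?thesis
    by (simp add: norm_H_half_sphere_def X_def)
qed

text \<open>With b = ln 2 / N, rounding in \<open>j div N\<close> loses at most a factor 2 against
  exp(b j). Half of the rate is spent on the denominator j through s <= exp(s) at s = b j / 2. The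
  constants 2, 2 and 10 multiply to 40, which gives c = b / 40; in the exponent c is far below the
  remaining rate b / 2.\<close>

lemma exponential_growth_bound:
  fixes N j :: nat
  assumes N: "N \<ge> 1" and j: "j \<ge> 1"
  defines "c \<equiv> ln 2 / (40 * real N)"
  shows "c * exp (c * j) \<le> 2 ^ (j div N) / (10 * real j)"
proof -
  define b where "b = ln 2 / real N"
  have b: "b > 0"
    using N by (simp add: b_def)
  have "real j / real N < real (j div N) + 1"
    using N by (simp add: divide_less_eq) (metis add.commute dividend_less_times_div mult_Suc_right
        of_nat_Suc of_nat_less_iff of_nat_mult One_nat_def Suc_le_eq mult.commute)
  then have "(real j / N) * ln 2 \<le> (real (j div N) + 1) * ln 2"
    by (intro mult_right_mono) auto
  then have "exp (b * j) \<le> exp ((real (j div N) + 1) * ln 2)"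
    by (simp add: b_def mult.commute)
  also have "\<dots> = 2 * 2 ^ (j div N)"
    by (simp add: distrib_right exp_add exp_of_nat_mult)
  finally have 1: "exp (b * j) / 2 \<le> 2 ^ (j div N)"
    by simp
  have "b * j / 2 \<le> exp (b * j / 2)"
    using exp_ge_add_one_self[of "b * j / 2"] by linarith
  then have "b * j / 2 * exp (b * j / 2) \<le> exp (b * j / 2) * exp (b * j / 2)"
    by (intro mult_right_mono) auto
  also have "\<dots> = exp (b * j)"
    by (simp flip: exp_add)
  finally have 2: "b * j / 2 * exp (b * j / 2) \<le> exp (b * j)" .
  have "c * j \<le> b * j / 2"
    using b N by (simp add: b_def c_def field_simps)
  then have "c * exp (c * j) \<le> b / 40 * exp (b * j / 2)"
    using b by (intro mult_mono) (auto simp: b_def c_def)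
  also have "\<dots> = (b * j / 2 * exp (b * j / 2)) / 2 / (10 * real j)"
    using j by simp
  also have "\<dots> \<le> 2 ^ (j div N) / (10 * real j)"
    using 1 2 by (intro divide_right_mono) auto
  finally show ?thesis .
qed

theorem proposition5p1:
  assumes "CARD('n::finite) \<ge> 2"
  shows "\<exists>c::real. c > 0 \<and> (\<exists>h :: nat \<Rightarrow> real ^ 'n \<Rightarrow> real.
    (\<forall>j\<ge>1. h j \<in> harmonic_H1 (ball 0 (1/2)) \<and> norm_H1 (ball 0 (1/2)) (h j) = 1) \<and>
    (\<forall>j\<ge>1. \<forall>u\<in>harmonic_H1 (ball 0 1).
       norm_L2 (ball 0 (1/2)) (\<lambda>x. h j x - u x) \<le> 1 / (10 * real j) \<longrightarrow>
       (\<forall>g. has_sphere_trace u g \<longrightarrow>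
          norm_H_half_sphere g \<ge> ennreal (c * exp (c * real j)))))"
proof -
  let ?H = "ball (0::real^'n) (1/2)"
  obtain p q :: 'n where "p \<noteq> q"
    using assms by (metis One_nat_def card_le_Suc0_iff_eq finite not_less_eq_eq numeral_2_eq_2 UNIV_I)
  then interpret coordinate_plane "axis p 1 :: real^'n" "axis q 1"
    by unfold_locales (auto simp: axis_eq_axis)
  obtain K where K: "K > 0"
    "\<And>d. \<exists>w. norm_H1 ?H (harm w d) = 1 \<and> 1 \<le> (1 + K * (real d)\<^sup>2) * (norm_L2 ?H (harm w d))\<^sup>2"
    using normalized_harm by blast
  then obtain w where w: "\<And>d. norm_H1 ?H (harm (w d) d) = 1"
    "\<And>d. 1 \<le> (1 + K * (real d)\<^sup>2) * (norm_L2 ?H (harm (w d) d))\<^sup>2"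
    by metis
  \<comment> \<open>Both \<open>K\<close> and the integer square of \<open>N\<close> enter below: K
    <= N <= N^2 yields K d^2 <= (N d)^2 <= j^2 for d = \<open>j div N\<close>.\<close>
  define N where "N = nat \<lceil>K\<rceil> + 1"
  have N: "N \<ge> 1" "K \<le> real N"
    by (auto simp: N_def) linarith
  define c where "c = ln 2 / (40 * real N)"
  have c: "c > 0"
    using N by (simp add: c_def)
  define h where "h j = harm (w (j div N)) (j div N)" for j
  \<comment> \<open>This is twice the tolerance 1 / (10 j), so u within the tolerance is within half
    the norm of \<open>h j\<close>, as \<open>sphere_norm_lower_bound\<close> asks.\<close>
  have L: "1 / (5 * real j) \<le> norm_L2 ?H (h j)" if j: "j \<ge> 1" for j
  proof -
    define d where "d = j div N"
    have "N * d \<le> j"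
      by (simp add: d_def)
    then have "real N * real d \<le> real j"
      by (metis of_nat_le_iff of_nat_mult)
    have "K * (real d)\<^sup>2 \<le> (real N)\<^sup>2 * (real d)\<^sup>2"
      using N by (intro mult_right_mono) (auto simp: power2_eq_square intro: order_trans)
    also have "\<dots> \<le> (real j)\<^sup>2"
      using \<open>real N * real d \<le> real j\<close> by (simp flip: power_mult_distrib)
    finally have "K * (real d)\<^sup>2 \<le> (real j)\<^sup>2" .
    moreover have "1 \<le> (real j)\<^sup>2"
      using j by (intro one_le_power) simp
    ultimately have "1 + K * (real d)\<^sup>2 \<le> 25 * (real j)\<^sup>2"
      by linarith
    then have "(1 + K * (real d)\<^sup>2) * (norm_L2 ?H (h j))\<^sup>2 \<le> 25 * (real j)\<^sup>2 * (norm_L2 ?H (h j))\<^sup>2"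
      by (intro mult_right_mono) auto
    then have "1 \<le> (5 * real j * norm_L2 ?H (h j))\<^sup>2"
      using w(2)[of d] by (simp add: h_def d_def power_mult_distrib)
    then have "1 \<le> 5 * real j * norm_L2 ?H (h j)"
      using power2_le_imp_le[of 1 "5 * real j * norm_L2 ?H (h j)"] by (simp add: norm_L2_def)
    then show ?thesis
      using j by (simp add: field_simps)
  qed
  have "norm_H_half_sphere g \<ge> ennreal (c * exp (c * real j))"
    if j: "j \<ge> 1" and u: "u \<in> harmonic_H1 (ball 0 1)"
      and close: "norm_L2 ?H (\<lambda>x. h j x - u x) \<le> 1 / (10 * real j)"
      and g: "has_sphere_trace u g" for j u g
  proof -
    have "norm_L2 ?H (\<lambda>x. h j x - u x) \<le> norm_L2 ?H (h j) / 2"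
      using close L[OF j] by (simp add: field_simps)
    then have "2 ^ (j div N) * norm_L2 ?H (h j) / 2 \<le> sqrt (\<integral>x. (g x)\<^sup>2 \<partial>sphere_measure)"
      unfolding h_def by (rule sphere_norm_lower_bound[OF u g])
    moreover have "2 ^ (j div N) / (10 * real j) \<le> 2 ^ (j div N) * norm_L2 ?H (h j) / 2"
      using mult_left_mono[OF L[OF j], of "2 ^ (j div N) / 2"] by (simp add: field_simps)
    ultimately have "c * exp (c * real j) \<le> sqrt (\<integral>x. (g x)\<^sup>2 \<partial>sphere_measure)"
      using exponential_growth_bound[OF N(1) j] by (simp add: c_def)
    then show ?thesis
      using norm_H_half_sphere_ge[OF sphere_trace_integral(1)[OF u g]]
      by (meson ennreal_leI order_trans)
  qed
  moreover have "h j \<in> harmonic_H1 ?H" "norm_H1 ?H (h j) = 1" for j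
    unfolding h_def using w(1) by (auto intro: harm_in_harmonic_H1)
  ultimately show ?thesis
    using c by blast
qed

end
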